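(* Let the loss $\ell$ and the data distribution $\mathbb P$ satisfy the standing assumptions on loss, data and compatibility stated in the context. Let $\pi_0\in\mathcal P_2(\overline\Theta)$ and let $(\pi_t)_{t\ge 0}$ be the Wasserstein gradient flow of $\mathcal R$ starting at $\pi_0$. Let $$\Omega^{lim}=\{(g,V)\;:\;\exists\, t_n\to\infty \text{ such that } \delta_\pi\mathcal R(\pi_{t_n},\cdot)\to g \text{ and } \nabla_\theta\delta_\pi\mathcal R(\pi_{t_n},\cdot)\to V \text{ locally uniformly on }\overline\Theta\}.$$ Then: 1. $\Omega^{lim}$ is not empty. 2. $\lim_{t\to\infty}\mathcal R(\pi_t)=\inf_{\pi\in\mathcal P_2(\overline\Theta)}\mathcal R(\pi)$ if and only if $g\equiv 0$ for every $(g,V)\in\Omega^{lim}$.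
   Context: **Network.** Let $d\ge 1$ and $\Theta=\{(a,w,b)\in\mathbb R\times\mathbb R^d\times\mathbb R: a^2<|w|^2+b^2\}$, with closure $\overline\Theta\subset\mathbb R^{d+2}$; write $\theta=(a,w,b)$. Let $\sigma(z)=\max\{z,0\}$, $\sigma'(z)=1_{\{z>0\}}$, $\phi(\theta;x)=a\,\sigma(w^Tx+b)$ and $\nabla_\theta\phi(\theta;x)=\big(\sigma(w^Tx+b),\,a\,\sigma'(w^Tx+b)\,x,\,a\,\sigma'(w^Tx+b)\big)$ for $x\in\mathbb R^d$. $\mathcal P_2(\overline\Theta)$ is the set of Borel probability measures on $\overline\Theta$ with finite second moment $N(\pi)=\int|\theta|^2\,\pi(d\theta)$, and $f_\pi(x)=\int_{\overline\Theta}\phi(\theta;x)\,\pi(d\theta)$. **Loss.** $\ell:\mathbb R\times\mathbb R\to[0,\infty)$ is jointly continuous, continuously differentiable in the first argument with $|\partial_1\ell|\le C_\ell$ for some constant $C_\ell$, and $y\mapsto\ell(y,\bar y)$ is convex for every $\bar y$. **Data.** $\mathbb P$ is a Borel probability measure on $\mathbb R^d\times\mathbb R$ with $\int(|x|+|y|)\,d\mathbb P<\infty$; $\overline{\mathbb P}$ is its marginal on $\mathbb R^d$ and $\mathbb P^x$ are the conditional distributions of $y$ given $x$. The span of $\{\phi(\theta;\cdot):\theta\in\Theta\}$ is dense in $L^1(\overline{\mathbb P})$, and the map $S^d\to L^1(\sqrt{1+|x|^2}\cdot\overline{\mathbb P})$, $(w,b)\mapsto 1_{\{x\,:\,w^Tx+b>0\}}$,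 is Lipschitz continuous (here $S^d\subset\mathbb R^{d+1}$ is the unit sphere and $h\cdot\mu$ is the measure with density $h$ with respect to $\mu$). **Compatibility.** With $L_x(\alpha)=\int_{\mathbb R}\ell(\alpha,y)\,\mathbb P^x(dy)$: $\lim_{|\alpha|\to\infty}L_x(\alpha)=\infty$ for $\overline{\mathbb P}$-a.e. $x$; $\int\ell(0,y)\,d\mathbb P<\infty$; and there is a $\overline{\mathbb P}$-measurable $f^*\in L^1(\overline{\mathbb P})$ with $f^*(x)\in\operatorname{argmin}_\alpha L_x(\alpha)$ for $\overline{\mathbb P}$-a.e. $x$. **Risk and gradient flow.** $\mathcal R(\pi)=\int\ell(f_\pi(x),y)\,\mathbb P(dx\otimes dy)$, $\delta_\pi\mathcal R(\pi,\theta)=\int(\partial_1\ell)(f_\pi(x),y)\,\phi(\theta;x)\,\mathbb P(dx\otimes dy)$, $\nabla_\theta\delta_\pi\mathcal R(\pi,\theta)=\int(\partial_1\ell)(f_\pi(x),y)\,\nabla_\theta\phi(\theta;x)\,\mathbb P(dx\otimes dy)$. The Wasserstein gradient flow starting at $\pi_0$ is the locally absolutely continuous curve $t\mapsto\pi_t\in\mathcal P_2(\overline\Theta)$ with respect to the 2-Wasserstein distance, with initial value $\pi_0$, satisfying $\partial_t\pi_t=\mathrm{div}_\theta(\pi_t\nabla_\theta\delta_\pi\mathcal R(\pi_t,\cdot))$ in the sense that $\frac{d}{dt}\int\psi\,d\pi_t=-\int\langle\nabla\psi,\nabla_\theta\delta_\pi\mathcal R(\pi_t,\cdot)\rangle\,d\pi_t$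 for a.e. $t>0$ and all $\psi\in C_c^\infty(\mathbb R^{d+2})$. *)

theory Defs
  imports "HOL-Probability.Probability"
begin

subsection \<open>The network\<close>

text \<open>Parameters are triples \<open>(a, w, b)\<close>; the product norm on this type is the Euclidean norm of
  \<open>\<real>\<^sup>d\<^sup>+\<^sup>2\<close> with \<open>d = CARD('n)\<close>.\<close>

type_synonym 'n param = "real \<times> (real ^ 'n) \<times> real"

definition Theta :: "('n::finite) param set" where
  "Theta = {(a, w, b). a\<^sup>2 < (norm w)\<^sup>2 + b\<^sup>2}"

definition relu :: "real \<Rightarrow> real" where
  "relu z = max z 0"

definition relu' :: "real \<Rightarrow> real" where
  "relu' z = (if z > 0 then 1 else 0)"

fun phi :: "('n::finite) param \<Rightarrow> real ^ 'n \<Rightarrow> real" where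
  "phi (a, w, b) x = a * relu (w \<bullet> x + b)"

fun grad_phi :: "('n::finite) param \<Rightarrow> real ^ 'n \<Rightarrow> 'n param" where
  "grad_phi (a, w, b) x =
     (relu (w \<bullet> x + b), (a * relu' (w \<bullet> x + b)) *\<^sub>R x, a * relu' (w \<bullet> x + b))"

definition P2 :: "('n::finite) param measure set" where
  "P2 = {\<pi>. sets \<pi> = sets (restrict_space borel (closure Theta)) \<and> prob_space \<pi> \<and>
             integrable \<pi> (\<lambda>\<theta>. (norm \<theta>)\<^sup>2)}"

definition net :: "('n::finite) param measure \<Rightarrow> real ^ 'n \<Rightarrow> real" where
  "net \<pi> x = (\<integral>\<theta>. phi \<theta> x \<partial>\<pi>)"


subsection \<open>Loss, data and compatibility\<close>

definition d1 :: "(real \<Rightarrow> real \<Rightarrow> real) \<Rightarrow> real \<Rightarrow> real \<Rightarrow> real" where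
  "d1 l y z = deriv (\<lambda>u. l u z) y"

definition loss_assms :: "(real \<Rightarrow> real \<Rightarrow> real) \<Rightarrow> bool" where
  "loss_assms l \<longleftrightarrow>
     (\<forall>y z. 0 \<le> l y z) \<and>
     continuous_on UNIV (\<lambda>(y, z). l y z) \<and>
     (\<forall>y z. (\<lambda>u. l u z) field_differentiable (at y)) \<and>
     (\<forall>z. continuous_on UNIV (\<lambda>y. d1 l y z)) \<and>
     (\<exists>C. \<forall>y z. \<bar>d1 l y z\<bar> \<le> C) \<and>
     (\<forall>z. convex_on UNIV (\<lambda>y. l y z))"

definition marginal :: "((real ^ 'n::finite) \<times> real) measure \<Rightarrow> (real ^ 'n) measure" where
  "marginal P = distr P borel fst"

definition conditional_distribution ::
    "((real ^ 'n::finite) \<times> real) measure \<Rightarrow> (real ^ 'n \<Rightarrow> real measure) \<Rightarrow> bool" where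
  "conditional_distribution P K \<longleftrightarrow>
     K \<in> borel \<rightarrow>\<^sub>M prob_algebra borel \<and>
     (\<forall>A \<in> sets borel. \<forall>B \<in> sets borel.
        emeasure P (A \<times> B) = (\<integral>\<^sup>+x\<in>A. emeasure (K x) B \<partial>marginal P))"

text \<open>The map in the Lipschitz condition takes values in
  \<open>L\<^sup>1(\<surd>(1 + |x|\<^sup>2) \<cdot> marginal P)\<close>, whose norm is written out.\<close>

definition data_assms :: "((real ^ 'n::finite) \<times> real) measure \<Rightarrow> bool" where
  "data_assms P \<longleftrightarrow>
     sets P = sets borel \<and> prob_space P \<and>
     integrable P (\<lambda>(x, y). norm x + \<bar>y\<bar>) \<and>
     (\<forall>f. integrable (marginal P) f \<longrightarrow> (\<forall>\<epsilon>>0. \<exists>S c. finite S \<and> S \<subseteq> Theta \<and>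
        (\<integral>x. \<bar>f x - (\<Sum>\<theta>\<in>S. c \<theta> * phi \<theta> x)\<bar> \<partial>marginal P) < \<epsilon>)) \<and>
     (\<exists>C. \<forall>(w, b) \<in> sphere 0 1. \<forall>(w', b') \<in> sphere 0 1.
        (\<integral>x. \<bar>indicator {x. w \<bullet> x + b > 0} x - indicator {x. w' \<bullet> x + b' > 0} x\<bar>
           \<partial>density (marginal P) (\<lambda>x. ennreal (sqrt (1 + (norm x)\<^sup>2))))
        \<le> C * dist (w, b) (w', b'))"

definition cond_loss ::
    "(real \<Rightarrow> real \<Rightarrow> real) \<Rightarrow> (real ^ 'n::finite \<Rightarrow> real measure) \<Rightarrow> real ^ 'n \<Rightarrow> real \<Rightarrow> real" where
  "cond_loss l K x \<alpha> = (\<integral>y. l \<alpha> y \<partial>K x)"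

definition compatibility ::
    "(real \<Rightarrow> real \<Rightarrow> real) \<Rightarrow> ((real ^ 'n::finite) \<times> real) measure \<Rightarrow>
     (real ^ 'n \<Rightarrow> real measure) \<Rightarrow> bool" where
  "compatibility l P K \<longleftrightarrow>
     (AE x in marginal P. filterlim (cond_loss l K x) at_top at_infinity) \<and>
     integrable P (\<lambda>(x, y). l 0 y) \<and>
     (\<exists>fs. integrable (marginal P) fs \<and>
        (AE x in marginal P. is_arg_min (cond_loss l K x) (\<lambda>_. True) (fs x)))"


subsection \<open>Risk and its variations\<close>

definition risk ::
    "(real \<Rightarrow> real \<Rightarrow> real) \<Rightarrow> ((real ^ 'n::finite) \<times> real) measure \<Rightarrow> 'n param measure \<Rightarrow> real" where
  "risk l P \<pi> = (\<integral>(x, y). l (net \<pi> x) y \<partial>P)"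

definition risk_var ::
    "(real \<Rightarrow> real \<Rightarrow> real) \<Rightarrow> ((real ^ 'n::finite) \<times> real) measure \<Rightarrow> 'n param measure \<Rightarrow>
     'n param \<Rightarrow> real" where
  "risk_var l P \<pi> \<theta> = (\<integral>(x, y). d1 l (net \<pi> x) y * phi \<theta> x \<partial>P)"

definition grad_risk_var ::
    "(real \<Rightarrow> real \<Rightarrow> real) \<Rightarrow> ((real ^ 'n::finite) \<times> real) measure \<Rightarrow> 'n param measure \<Rightarrow>
     'n param \<Rightarrow> 'n param" where
  "grad_risk_var l P \<pi> \<theta> = (\<integral>(x, y). d1 l (net \<pi> x) y *\<^sub>R grad_phi \<theta> x \<partial>P)"


subsection \<open>Wasserstein gradient flows\<close>

definition couplings :: "'a measure \<Rightarrow> 'a measure \<Rightarrow> ('a \<times> 'a) measure set" where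
  "couplings \<mu> \<nu> = {\<gamma>. sets \<gamma> = sets (\<mu> \<Otimes>\<^sub>M \<nu>) \<and> distr \<gamma> \<mu> fst = \<mu> \<and> distr \<gamma> \<nu> snd = \<nu>}"

definition W2 :: "('a::metric_space) measure \<Rightarrow> 'a measure \<Rightarrow> real" where
  "W2 \<mu> \<nu> = sqrt (enn2real (INF \<gamma>\<in>couplings \<mu> \<nu>. \<integral>\<^sup>+(x, y). ennreal ((dist x y)\<^sup>2) \<partial>\<gamma>))"

text \<open>Absolute continuity in the metric sense: the distance increments are dominated by the
  integral of a locally integrable function.\<close>

definition locally_AC_W2 :: "(real \<Rightarrow> ('a::metric_space) measure) \<Rightarrow> bool" where
  "locally_AC_W2 \<pi> \<longleftrightarrow>
     (\<exists>m. (\<forall>T\<ge>0. set_integrable lborel {0..T} m) \<and>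
          (\<forall>s t. 0 \<le> s \<and> s \<le> t \<longrightarrow> W2 (\<pi> s) (\<pi> t) \<le> (LINT r:{s..t}|lborel. m r)))"

text \<open>\<open>C\<^sup>k\<close> by iterated directional derivatives.\<close>

primrec Ck :: "nat \<Rightarrow> ('a::euclidean_space \<Rightarrow> real) \<Rightarrow> bool" where
  "Ck 0 f \<longleftrightarrow> continuous_on UNIV f"
| "Ck (Suc k) f \<longleftrightarrow> f differentiable_on UNIV \<and> (\<forall>v. Ck k (\<lambda>x. frechet_derivative f (at x) v))"

definition test_functions :: "('a::euclidean_space \<Rightarrow> real) set" where
  "test_functions = {\<psi>. (\<forall>k. Ck k \<psi>) \<and> compact (closure {x. \<psi> x \<noteq> 0})}"

definition gradient :: "('a::euclidean_space \<Rightarrow> real) \<Rightarrow> 'a \<Rightarrow> 'a" where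
  "gradient f x = (\<Sum>i\<in>Basis. frechet_derivative f (at x) i *\<^sub>R i)"

text \<open>Curves are functions on \<open>\<real>\<close> of which only the values at times \<open>t \<ge> 0\<close> matter.\<close>

definition wasserstein_gradient_flow ::
    "(real \<Rightarrow> real \<Rightarrow> real) \<Rightarrow> ((real ^ 'n::finite) \<times> real) measure \<Rightarrow> 'n param measure \<Rightarrow>
     (real \<Rightarrow> 'n param measure) \<Rightarrow> bool" where
  "wasserstein_gradient_flow l P \<pi>0 \<pi> \<longleftrightarrow>
     (\<forall>t\<ge>0. \<pi> t \<in> P2) \<and> \<pi> 0 = \<pi>0 \<and> locally_AC_W2 \<pi> \<and>
     (AE t in lborel. t > 0 \<longrightarrow> (\<forall>\<psi>\<in>test_functions.
        ((\<lambda>s. \<integral>\<theta>. \<psi> \<theta> \<partial>\<pi> s) has_real_derivative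
           - (\<integral>\<theta>. gradient \<psi> \<theta> \<bullet> grad_risk_var l P (\<pi> t) \<theta> \<partial>\<pi> t)) (at t)))"


subsection \<open>Limit points of the variations\<close>

definition locally_uniform_limit ::
    "'a::metric_space set \<Rightarrow> (nat \<Rightarrow> 'a \<Rightarrow> 'b::metric_space) \<Rightarrow> ('a \<Rightarrow> 'b) \<Rightarrow> bool" where
  "locally_uniform_limit S F f \<longleftrightarrow>
     (\<forall>x\<in>S. \<exists>\<epsilon>>0. uniform_limit (S \<inter> ball x \<epsilon>) F f sequentially)"

text \<open>The limits are functions on \<open>closure Theta\<close>; here they are total functions with
  unconstrained values elsewhere.\<close>

definition Omega_lim ::
    "(real \<Rightarrow> real \<Rightarrow> real) \<Rightarrow> ((real ^ 'n::finite) \<times> real) measure \<Rightarrow>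
     (real \<Rightarrow> 'n param measure) \<Rightarrow> (('n param \<Rightarrow> real) \<times> ('n param \<Rightarrow> 'n param)) set" where
  "Omega_lim l P \<pi> = {(g, V). \<exists>t :: nat \<Rightarrow> real.
     (\<forall>n. 0 \<le> t n) \<and> filterlim t at_top sequentially \<and>
     locally_uniform_limit (closure Theta) (\<lambda>n. risk_var l P (\<pi> (t n))) g \<and>
     locally_uniform_limit (closure Theta) (\<lambda>n. grad_risk_var l P (\<pi> (t n))) V}"

end

theory Submission
  imports Defs "HOL-Complex_Analysis.Great_Picard"
begin

text \<open>The variation \<open>\<delta>R(\<pi>, \<cdot>)\<close> is positively 2-homogeneous, and the Lipschitz condition on the half-space
  indicators makes its gradient Lipschitz on \<open>closure Theta\<close>, uniformly in \<open>\<pi>\<close>; so Arzela--Ascoli on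
  the unit ball and homogeneity yield limit points.

  Along the flow the risk is nonincreasing and the second moment satisfies
  \<open>N' = - 4 \<integral> \<delta>R(\<pi>\<^sub>t) d\<pi>\<^sub>t\<close>. Convexity gives
  \<open>R(\<pi>\<^sub>t) - R(\<rho>) \<le> \<integral> \<delta>R(\<pi>\<^sub>t) d\<pi>\<^sub>t - \<integral> \<delta>R(\<pi>\<^sub>t) d\<rho>\<close>. If all limit points vanish, the last term tends
  to 0, so a risk bounded away from its infimum would force \<open>N\<close> below 0.

  Conversely, a sequence minimising the risk minimises the conditional losses \<open>L\<^sub>x\<close> almost everywhere
  along a subsequence; by coercivity and convexity the derivatives of \<open>L\<^sub>x\<close> along it tend to 0, hence so
  do the variations. This direction does not use the flow.

  The test functions of the weak formulation are smooth and the variation is not, so the flow is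
  evaluated on \<open>\<delta>R(\<pi>\<^sub>t)\<close> through couplings: if \<open>\<psi>\<close> has a second-order expansion and a test function
  \<open>\<eta>\<close> has a gradient close to that of \<open>\<psi>\<close> in \<open>L\<^sup>2(\<pi>\<^sub>t)\<close>, then the increment of \<open>\<integral> (\<psi> - \<eta>) d\<pi>\<close> over
  \<open>[s, t]\<close> is at most \<open>\<epsilon> W + K W\<^sup>2\<close>, where \<open>W\<close> is the Wasserstein distance of \<open>\<pi>\<^sub>s\<close> and \<open>\<pi>\<^sub>t\<close>.\<close>

subsection \<open>Left difference quotients and monotonicity\<close>

text \<open>The obstacle is regularity. \<open>relu'\<close> jumps, and the gradient of the
  variation is Lipschitz only because the jump carries the factor \<open>|a|\<close>, which on
  \<open>closure Theta\<close> is at most the norm of \<open>(w, b)\<close>. That norm compensates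
  exactly for what is lost when the Lipschitz condition on the unit sphere is extended to all
  vectors by scaling (\<open>flip_bound\<close>). The gain is a second-order expansion whose
  constant \<open>K1\<close> does not depend on the measure.

  No energy identity for the risk is proved. Convexity bounds the increment of the risk over
  \<open>[y, s]\<close> by that of the linear functional frozen at the right end point
  \<open>s\<close>, and the weak formulation at time \<open>s\<close> controls just this functional.
  Hence the left difference quotients and the one-sided estimates.

  The factor 4 in the decay of the second moment is 2 from the gradient of the square times 2 from
  Euler's identity in degree 2.

  In the converse direction the predictions along a minimising sequence need not converge, since
  minimisers of \<open>cond_loss\<close> need not be unique. Only the slopes converge, by
  compactness.\<close>

text \<open>The exceptional null set is covered by an open set on which \<open>m\<close> has small integral. Errors
  proportional to the integral of \<open>m\<close> are admitted, so almost everywhere differentiability of that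
  integral is not needed.\<close>

lemma left_growth_nonincreasing:
  fixes F m :: "real \<Rightarrow> real"
  assumes ab: "a \<le> b" and m: "set_integrable lborel {a..b} m" and m0: "\<And>x. 0 \<le> m x"
    and AC: "\<And>s t. a \<le> s \<Longrightarrow> s \<le> t \<Longrightarrow> t \<le> b \<Longrightarrow> \<bar>F t - F s\<bar> \<le> (LINT r:{s..t}|lborel. m r)"
    and ae: "AE s in lborel. a < s \<and> s < b \<longrightarrow> (\<forall>\<epsilon>>0. \<forall>\<^sub>F y in at_left s.
               F s - F y \<le> \<epsilon> * ((s - y) + (LINT r:{y..s}|lborel. m r)))"
  shows "F b \<le> F a"
proof -
  define I where "I s t = (LINT r:{s..t}|lborel. m r)" for s t
  have sub: "set_integrable lborel A m" if "A \<subseteq> {a..b}" "A \<in> sets borel" for A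
    using set_integrable_subset[OF m] that by auto
  have I0: "0 \<le> I s t" for s t
    unfolding I_def set_lebesgue_integral_def by (intro Bochner_Integration.integral_nonneg) (auto simp: m0)
  \<comment> \<open>The three summands are the total allowances for drift, for the mass of
    \<open>m\<close>, and for the exceptional set.\<close>
  have key: "F b - F a \<le> \<epsilon> * (b - a + I a b + 1)" if e: "\<epsilon> > 0" for \<epsilon>
  proof -
    from ae obtain N where N: "N \<in> null_sets lborel"
      and N2: "{s. \<not> (a < s \<and> s < b \<longrightarrow> (\<forall>\<epsilon>>0. \<forall>\<^sub>F y in at_left s.
               F s - F y \<le> \<epsilon> * ((s - y) + I y s)))} \<subseteq> N"
      unfolding I_def by (auto elim!: AE_E simp: null_sets_def)
    \<comment> \<open>A finite measure, hence outer regular. Its null sets include the Lebesgue null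
      sets, so the exceptional set has open neighbourhoods of arbitrarily small
      \<open>D\<close>-mass.\<close>
    define D where "D = density lborel (\<lambda>x. ennreal (indicator {a..b} x * m x))"
    have mm: "(\<lambda>x. indicator {a..b} x * m x) \<in> borel_measurable lborel"
      using m unfolding set_integrable_def by (auto dest: borel_measurable_integrable)
    have "emeasure D (space D) = (\<integral>\<^sup>+x. ennreal (indicator {a..b} x * m x) \<partial>lborel)"
      unfolding D_def using mm by (subst emeasure_density) auto
    also have "\<dots> < \<infinity>"
      using m m0 unfolding set_integrable_def
      by (subst nn_integral_eq_integral) auto
    finally have Dfin: "emeasure D (space D) \<noteq> \<infinity>" by simp
    have Dsets: "sets D = sets borel" by (simp add: D_def)
    \<comment> \<open>The end points join the exceptional set because the hypothesis speaks of the
      open interval only, while the point \<open>c\<close> below may be \<open>b\<close>.\<close>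
    define N' where "N' = N \<union> {a, b}"
    have N': "N' \<in> null_sets lborel" unfolding N'_def by (intro null_sets.Un[OF N finite_imp_null_set_lborel]) auto
    have "AE x in lborel. x \<in> N' \<longrightarrow> ennreal (indicator {a..b} x * m x) = 0"
      using AE_not_in[OF N'] by eventually_elim auto
    then have "N' \<in> null_sets D" unfolding D_def
      using N' mm by (subst null_sets_density_iff) auto
    then have "emeasure D N' = 0" "N' \<in> sets borel" using Dsets by auto
    with outer_regular[OF Dsets Dfin, of N'] have "(INF U\<in>{U. N' \<subseteq> U \<and> open U}. emeasure D U) = 0" by simp
    then have "(INF U\<in>{U. N' \<subseteq> U \<and> open U}. emeasure D U) < ennreal \<epsilon>" using e by simp
    then obtain U where U: "N' \<subseteq> U" "open U" and Ue: "emeasure D U < ennreal \<epsilon>"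
      unfolding INF_less_iff by auto
    have Ub[measurable]: "U \<in> sets borel" using U by auto
    have intU: "set_integrable lborel A (\<lambda>x. indicator U x * m x)" if "A \<subseteq> {a..b}" "A \<in> sets borel" for A
      using sub[of "A \<inter> U"] that
      by (auto simp: set_integrable_def indicator_inter_arith mult.assoc)
    define W where "W s t = (LINT r:{s..t}|lborel. indicator U r * m r)" for s t
    have Wab: "W a b \<le> \<epsilon>"
    proof -
      have "ennreal (W a b) = (\<integral>\<^sup>+x. ennreal (indicator {a..b} x * (indicator U x * m x)) \<partial>lborel)"
        using intU[of "{a..b}"] m0 unfolding W_def set_lebesgue_integral_def set_integrable_def
        by (subst nn_integral_eq_integral) auto
      also have "\<dots> = emeasure D U"
        unfolding D_def using mm Ub
        by (subst emeasure_density) (auto intro!: nn_integral_cong split: split_indicator)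
      finally show ?thesis using Ue e
        by (metis ennreal_le_iff less_eq_real_def order_less_imp_le)
    qed
    have cont_I: "continuous_on {a..b} (\<lambda>x. LINT r:{a..x}|lborel. f r)"
      if f: "set_integrable lborel {a..b} f" for f :: "real \<Rightarrow> real"
    proof -
      have "continuous_on {a..b} (\<lambda>x. integral {a..x} f)"
        by (rule indefinite_integral_continuous_1) (rule set_borel_integral_eq_integral(1)[OF f])
      moreover have "(LINT r:{a..x}|lborel. f r) = integral {a..x} f" if "x \<in> {a..b}" for x
        by (rule set_borel_integral_eq_integral(2), rule set_integrable_subset[OF f]) (use that in auto)
      ultimately show ?thesis by (subst continuous_on_cong[OF refl, of _ _ "\<lambda>x. integral {a..x} f"]) auto
    qed
    have split: "(LINT r:{a..t}|lborel. f r) = (LINT r:{a..s}|lborel. f r) + (LINT r:{s..t}|lborel. f r)"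
      if f: "set_integrable lborel {a..b} f" and st: "a \<le> s" "s \<le> t" "t \<le> b" for f :: "real \<Rightarrow> real" and s t
    proof -
      have i: "set_integrable lborel {x..y} f" if "a \<le> x" "y \<le> b" for x y
        by (rule set_integrable_subset[OF f]) (use that in auto)
      show ?thesis
        using set_borel_integral_eq_integral[OF i[of a t]] set_borel_integral_eq_integral[OF i[of a s]]
          set_borel_integral_eq_integral[OF i[of s t]] st
          Henstock_Kurzweil_Integration.integral_combine[of a s t f] by simp
    qed
    have mU: "set_integrable lborel {a..b} (\<lambda>x. indicator U x * m x)" by (rule intU) auto
    \<comment> \<open>\<open>W\<close>, the mass of \<open>m\<close> inside \<open>U\<close>, pays
      for the increments next to exceptional points; over all of \<open>{a..b}\<close> it costs at
      most \<open>\<epsilon>\<close>.\<close>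
    define G where "G x = F x - \<epsilon> * (x - a) - \<epsilon> * I a x - W a x" for x
    have contF: "continuous_on {a..b} F"
    proof (subst continuous_on_iff, intro ballI allI impI)
      fix x e assume x: "x \<in> {a..b}" and e: "(e::real) > 0"
      from cont_I[OF m] x e obtain d where d: "d > 0"
        "\<And>y. y \<in> {a..b} \<Longrightarrow> dist y x < d \<Longrightarrow> dist (I a y) (I a x) < e"
        unfolding continuous_on_iff I_def by blast
      have "dist (F y) (F x) < e" if y: "y \<in> {a..b}" "dist y x < d" for y
      proof (cases "x \<le> y")
        case True
        have "\<bar>F y - F x\<bar> \<le> I x y" unfolding I_def by (rule AC) (use x y True in auto)
        also have "\<dots> = I a y - I a x" using split[OF m, of x y] x y True by (simp add: I_def)
        finally show ?thesis using d(2)[OF y] by (simp add: dist_real_def)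
      next
        case False
        have "\<bar>F x - F y\<bar> \<le> I y x" unfolding I_def by (rule AC) (use x y False in auto)
        also have "\<dots> = I a x - I a y" using split[OF m, of y x] x y False by (simp add: I_def)
        finally show ?thesis using d(2)[OF y] by (simp add: dist_real_def)
      qed
      then show "\<exists>d>0. \<forall>x'\<in>{a..b}. dist x' x < d \<longrightarrow> dist (F x') (F x) < e" using d(1) by blast
    qed
    have contG: "continuous_on {a..b} G"
      unfolding G_def I_def W_def
      by (intro continuous_intros contF cont_I m mU)
    \<comment> \<open>Descent from \<open>b\<close>: the least point of \<open>S\<close> must be
      \<open>a\<close>, since any other \<open>c\<close> has some \<open>y < c\<close> with
      \<open>G c \<le> G y\<close>.\<close>
    define S where "S = {y \<in> {a..b}. G b \<le> G y}"
    have "closed S" unfolding S_def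
      by (rule continuous_on_closed_Collect_le[OF continuous_on_const contG]) auto
    then have "compact S" by (intro compact_eq_bounded_closed[THEN iffD2] conjI)
      (auto intro: bounded_subset[OF bounded_closed_interval[of a b]] simp: S_def)
    moreover have "b \<in> S" using ab by (simp add: S_def)
    ultimately obtain c where c: "c \<in> S" "\<And>y. y \<in> S \<Longrightarrow> c \<le> y"
      using compact_attains_inf[of S] by blast
    have "c = a"
    proof (rule ccontr)
      assume "c \<noteq> a"
      then have ac: "a < c" "c \<le> b" using c(1) by (auto simp: S_def)
      have ev1: "\<forall>\<^sub>F y in at_left c. y \<in> {a<..<c}"
        using eventually_at_left_real[OF ac(1)] by simp
      \<comment> \<open>Near an exceptional \<open>c\<close> the interval \<open>{y..c}\<close> lies
        in \<open>U\<close>, so \<open>I y c = W y c\<close> and absolute continuity alone suffices.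
        Elsewhere the hypothesis applies.\<close>
      have "\<forall>\<^sub>F y in at_left c. F c - F y \<le> \<epsilon> * (c - y) + \<epsilon> * I y c + W y c"
      proof (cases "c \<in> N'")
        case True
        then obtain d where d: "d > 0" "ball c d \<subseteq> U" using U by (meson openE subsetD)
        have "\<forall>\<^sub>F y in at_left c. y \<in> {c - d<..<c}"
          using eventually_at_left_real[of "c - d" c] d(1) by simp
        then show ?thesis using ev1
        proof eventually_elim
          case (elim y)
          have "F c - F y \<le> I y c" using AC[of y c] elim ac by (auto simp: I_def)
          also have "I y c = W y c" unfolding I_def W_def
          proof (rule set_lebesgue_integral_cong, simp, safe)
            fix x assume "x \<in> {y..c}"
            then have "x \<in> ball c d" using elim by (auto simp: dist_real_def)
            then show "m x = indicator U x * m x" using d by auto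
          qed
          finally show ?case using e elim I0[of y c]
            by (smt (verit) greaterThanLessThan_iff mult_nonneg_nonneg)
        qed
      next
        case False
        then have "c \<notin> N" "c < b" using ac by (auto simp: N'_def)
        then have "\<forall>\<^sub>F y in at_left c. F c - F y \<le> \<epsilon> * ((c - y) + I y c)"
          using N2 ac e by blast
        then show ?thesis
        proof eventually_elim
          case (elim y)
          have "0 \<le> W y c" unfolding W_def set_lebesgue_integral_def
            by (intro Bochner_Integration.integral_nonneg) (auto simp: m0)
          then show ?case using elim by (simp add: algebra_simps)
        qed
      qed
      then have "\<forall>\<^sub>F y in at_left c. y \<in> {a<..<c} \<and> F c - F y \<le> \<epsilon> * (c - y) + \<epsilon> * I y c + W y c"
        using ev1 by eventually_elim auto
      then obtain y where y: "y \<in> {a<..<c}" "F c - F y \<le> \<epsilon> * (c - y) + \<epsilon> * I y c + W y c"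
        using eventually_happens'[OF trivial_limit_at_left_real] by blast
      have "I a c = I a y + I y c" "W a c = W a y + W y c"
        using split[OF m, of y c] split[OF mU, of y c] y ac by (auto simp: I_def W_def)
      then have "G c \<le> G y" using y unfolding G_def by (simp add: algebra_simps)
      then have "y \<in> S" using c(1) y ac by (auto simp: S_def)
      then show False using c(2)[of y] y by auto
    qed
    then have "G b \<le> G a" using c(1) by (simp add: S_def)
    moreover have "I a a = 0" "W a a = 0"
      using split[OF m, of a a] split[OF mU, of a a] ab by (auto simp: I_def W_def)
    ultimately show ?thesis using Wab unfolding G_def by (simp add: algebra_simps)
  qed
  have "F b - F a \<le> 0 + e" if "e > 0" for e
  proof -
    have pos: "b - a + I a b + 1 > 0" using ab I0[of a b] by simp
    show ?thesis using key[of "e / (b - a + I a b + 1)"] that pos by simp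
  qed
  then show ?thesis using field_le_epsilon[of "F b - F a" 0] by simp
qed

subsection \<open>Smooth test functions\<close>

lemma Ck_imp_continuous_on: "Ck k f \<Longrightarrow> continuous_on UNIV f"
  by (cases k) (auto intro: differentiable_imp_continuous_on)

lemma Ck_SucI:
  assumes "\<And>x. (f has_derivative D x) (at x)" and "\<And>v. Ck k (\<lambda>x. D x v)"
  shows "Ck (Suc k) f"
proof -
  have "frechet_derivative f (at x) = D x" for x
    using frechet_derivative_at[OF assms(1)] by simp
  then show ?thesis
    using assms by (auto simp: differentiable_on_def differentiable_def)
qed

lemma Ck_has_derivative:
  "Ck (Suc k) f \<Longrightarrow> (f has_derivative frechet_derivative f (at x)) (at x)"
  by (auto simp: differentiable_on_def frechet_derivative_works)

lemma Ck_SucD: "Ck (Suc k) f \<Longrightarrow> Ck k f"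
proof (induction k arbitrary: f)
  case 0
  then show ?case by (auto intro: differentiable_imp_continuous_on)
next
  case (Suc k)
  then show ?case by (metis Ck.simps(2))
qed

lemma Ck_const: "Ck k (\<lambda>x. c)"
proof (induction k arbitrary: c)
  case (Suc k)
  show ?case by (rule Ck_SucI[where D = "\<lambda>x v. 0"]) (auto intro: Suc)
qed auto

lemma Ck_bounded_linear: "bounded_linear f \<Longrightarrow> Ck k f"
proof (cases k)
  case 0
  then show "bounded_linear f \<Longrightarrow> Ck k f" by (simp add: linear_continuous_on)
next
  case (Suc n)
  show "bounded_linear f \<Longrightarrow> Ck k f" unfolding Suc
    by (rule Ck_SucI[where D = "\<lambda>x. f"]) (auto intro: Ck_const bounded_linear.has_derivative)
qed

lemma Ck_add: "Ck k f \<Longrightarrow> Ck k g \<Longrightarrow> Ck k (\<lambda>x. f x + g x)"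
proof (induction k arbitrary: f g)
  case 0
  then show ?case by (auto intro: continuous_intros)
next
  case (Suc k)
  show ?case
    by (rule Ck_SucI[OF has_derivative_add[OF Ck_has_derivative[OF Suc.prems(1)]
            Ck_has_derivative[OF Suc.prems(2)]]])
       (use Suc in auto)
qed

lemma Ck_mult: "Ck k f \<Longrightarrow> Ck k g \<Longrightarrow> Ck k (\<lambda>x. f x * g x)"
proof (induction k arbitrary: f g)
  case 0
  then show ?case by (auto intro: continuous_intros)
next
  case (Suc k)
  show ?case
    by (rule Ck_SucI[OF has_derivative_mult[OF Ck_has_derivative[OF Suc.prems(1)]
            Ck_has_derivative[OF Suc.prems(2)]]], rule Ck_add; rule Suc.IH)
       (use Suc.prems Ck_SucD[OF Suc.prems(1)] Ck_SucD[OF Suc.prems(2)] in auto)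
qed

lemma Ck_sum: "(\<And>i. i \<in> I \<Longrightarrow> Ck k (f i)) \<Longrightarrow> Ck k (\<lambda>x. \<Sum>i\<in>I. f i x)"
  by (induction I rule: infinite_finite_induct) (auto intro: Ck_const Ck_add)

lemma Ck_norm_square: "Ck k (\<lambda>x::'a::euclidean_space. (norm x)\<^sup>2)"
proof -
  have "Ck k (\<lambda>x::'a. \<Sum>b\<in>Basis. (x \<bullet> b) * (x \<bullet> b))"
    by (intro Ck_sum Ck_mult Ck_bounded_linear bounded_linear_intros)
  also have "(\<lambda>x::'a. \<Sum>b\<in>Basis. (x \<bullet> b) * (x \<bullet> b)) = (\<lambda>x. (norm x)\<^sup>2)"
    by (auto simp: power2_norm_eq_inner fun_eq_iff intro: euclidean_inner[symmetric])
  finally show ?thesis .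
qed

lemma gradient_eqI:
  assumes "(f has_derivative (\<lambda>h. g \<bullet> h)) (at x)"
  shows "gradient f x = g"
  unfolding gradient_def frechet_derivative_at[OF assms, symmetric]
  by (rule euclidean_representation)

lemma gradient_inner:
  assumes "f differentiable (at x)"
  shows "gradient f x \<bullet> h = frechet_derivative f (at x) h"
proof -
  interpret linear "frechet_derivative f (at x)"
    using assms by (simp add: linear_frechet_derivative)
  have "frechet_derivative f (at x) h = frechet_derivative f (at x) (\<Sum>b\<in>Basis. (h \<bullet> b) *\<^sub>R b)"
    by (simp add: euclidean_representation)
  also have "\<dots> = gradient f x \<bullet> h"
    by (simp add: sum scale gradient_def inner_sum_left inner_sum_right inner_commute mult.commute)
  finally show ?thesis by simp
qed

text \<open>Up to linear combinations the family \<open>bump k\<close> is closed under differentiation, which makes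
  \<open>bump 0\<close> smooth.\<close>

definition bump :: "nat \<Rightarrow> real \<Rightarrow> real" where
  "bump k y = (if y > 0 then exp (- 1 / y) / y ^ k else 0)"

text \<open>This is the difference quotient at the gluing point. On the right, with
  \<open>u = 1 / y\<close>, it is a power of \<open>u\<close> divided by
  \<open>exp u\<close>.\<close>

lemma bump_at_0: "((\<lambda>y. bump k y / y) \<longlongrightarrow> 0) (at 0)"
proof (rule filterlim_split_at)
  have "eventually (\<lambda>y. y < (0::real)) (at_left 0)"
    by (simp add: eventually_at_filter)
  then show "((\<lambda>y. bump k y / y) \<longlongrightarrow> 0) (at_left 0)"
    by (rule tendsto_eventually[OF eventually_mono]) (simp add: bump_def)
next
  have "((\<lambda>y::real. inverse y ^ Suc k / exp (inverse y)) \<longlongrightarrow> 0) (at_right 0)"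
    by (rule filterlim_compose[OF tendsto_power_div_exp_0 filterlim_inverse_at_top_right])
  moreover have "eventually (\<lambda>y. inverse y ^ Suc k / exp (inverse y) = bump k y / y) (at_right 0)"
    by (simp add: eventually_at_filter bump_def exp_minus field_simps)
  ultimately show "((\<lambda>y. bump k y / y) \<longlongrightarrow> 0) (at_right 0)"
    by (rule Lim_transform_eventually)
qed

lemma bump_deriv:
  "(bump k has_real_derivative bump (k + 2) y - real k * bump (k + 1) y) (at y)"
proof (cases y "0::real" rule: linorder_cases)
  case less
  have "((\<lambda>_. 0) has_real_derivative 0) (at y)" by simp
  then have "(bump k has_real_derivative 0) (at y)"
    by (rule has_field_derivative_transform_within_open[where S = "{..<0}"])
       (use less in \<open>auto simp: bump_def\<close>)
  then show ?thesis using less by (simp add: bump_def)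
next
  case equal
  have "(bump k has_real_derivative 0) (at 0)"
    unfolding has_field_derivative_iff using bump_at_0[of k] by (simp add: bump_def[of k 0])
  then show ?thesis using equal by (simp add: bump_def)
next
  case greater
  have "((\<lambda>y. exp (- 1 / y) / y ^ k) has_real_derivative bump (k + 2) y - real k * bump (k + 1) y) (at y)"
  proof (cases k)
    case 0
    then show ?thesis using greater
      by (auto intro!: derivative_eq_intros simp: bump_def power2_eq_square)
  next
    case (Suc j)
    show ?thesis using greater unfolding Suc
      by (auto intro!: derivative_eq_intros simp: bump_def power2_eq_square divide_simps)
        (simp add: algebra_simps, cases j, auto)
  qed
  then show ?thesis
    by (rule has_field_derivative_transform_within_open[where S = "{0<..}"])
       (use greater in \<open>auto simp: bump_def\<close>)
qed

lemma bump_nonneg: "0 \<le> bump k y"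
  by (simp add: bump_def)

lemma bump_0_le: "y \<le> 1 \<Longrightarrow> bump 0 y \<le> exp (- 1)"
  by (auto simp: bump_def field_simps)

text \<open>\<open>bump 2\<close> is the derivative of \<open>bump 0\<close>. The bound comes from
  \<open>exp u \<ge> u^2 / 2\<close> at \<open>u = 1 / y\<close>.\<close>

lemma bump_2_le: "bump 2 y \<le> 2"
proof (cases "y > 0")
  case True
  have "(1 / y)\<^sup>2 \<le> 2 * exp (1 / y)"
    using exp_lower_Taylor_quadratic[of "1 / y"] True by (smt (verit) divide_pos_pos zero_less_one field_sum_of_halves)
  then show ?thesis using True by (simp add: bump_def exp_minus field_simps)
qed (simp add: bump_def)

text \<open>The index \<open>j\<close> must stay arbitrary in the induction, because differentiation
  raises it by 1 and by 2.\<close>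

lemma Ck_bump_compose:
  assumes "\<And>k. Ck k q"
  shows "Ck k (\<lambda>x. bump j (q x))"
proof (induction k arbitrary: j)
  case 0
  have "continuous_on UNIV (bump j)"
    by (meson DERIV_isCont bump_deriv continuous_at_imp_continuous_on)
  then show ?case
    using continuous_on_compose2[OF _ Ck_imp_continuous_on[OF assms]] by auto
next
  case (Suc k)
  have q: "(q has_derivative frechet_derivative q (at x)) (at x)" for x
    by (rule Ck_has_derivative[OF assms])
  show ?case
  proof (rule Ck_SucI)
    fix x
    show "((\<lambda>x. bump j (q x)) has_derivative
       (\<lambda>v. (bump (j + 2) (q x) + (- real j) * bump (j + 1) (q x)) * frechet_derivative q (at x) v)) (at x)"
      using has_derivative_compose[OF q bump_deriv[of j "q x", unfolded has_field_derivative_def]]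
      by simp
  next
    fix v
    have "Ck k (\<lambda>x. frechet_derivative q (at x) v)" using assms[of "Suc k"] by simp
    then show "Ck k (\<lambda>x. (bump (j + 2) (q x) + (- real j) * bump (j + 1) (q x)) * frechet_derivative q (at x) v)"
      by (intro Ck_mult Ck_add Ck_const Suc)
  qed
qed

text \<open>The cutoff lives on the scale \<open>n + 1\<close>, so its gradient is of order
  \<open>norm x / (n + 1)^2\<close>. Multiplied by a function of quadratic growth this stays below a
  multiple of \<open>norm x\<close> on the support and tends to 0 at each fixed point. Linear growth
  of the gradients, uniform in \<open>n\<close>, is what dominated convergence under a measure with
  second moment requires. The bounds are assumed on a ball only, since polynomial approximations are
  controlled only there.\<close>

lemma cutoff_approximation:
  fixes F :: "nat \<Rightarrow> 'a::euclidean_space \<Rightarrow> real" and Fg :: "nat \<Rightarrow> 'a \<Rightarrow> 'a"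
  assumes smooth: "\<And>n k. Ck k (F n)"
    and der: "\<And>n x. (F n has_derivative (\<lambda>h. Fg n x \<bullet> h)) (at x)"
    and bound: "\<And>n x. norm x \<le> real (Suc n) \<Longrightarrow> \<bar>F n x\<bar> \<le> B * (norm x)\<^sup>2"
      "\<And>n x. norm x \<le> real (Suc n) \<Longrightarrow> norm (Fg n x) \<le> B * norm x"
    and conv: "\<And>x. x \<in> S \<Longrightarrow> (\<lambda>n. Fg n x) \<longlonglongrightarrow> G x"
    and B: "0 \<le> B"
  obtains \<eta> :: "nat \<Rightarrow> 'a \<Rightarrow> real" where "\<And>n. \<eta> n \<in> test_functions"
    "\<And>n x. norm (gradient (\<eta> n) x) \<le> B * (1 + 4 * exp 1) * norm x"
    "\<And>x. x \<in> S \<Longrightarrow> (\<lambda>n. gradient (\<eta> n) x) \<longlonglongrightarrow> G x"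
proof -
  define q where "q n x = 1 + (- (1 / (real (Suc n))\<^sup>2)) * (norm x)\<^sup>2" for n and x :: 'a
  \<comment> \<open>The factor \<open>exp 1\<close> normalises the value at the origin to 1, because
    \<open>bump 0 1 = exp (- 1)\<close>.\<close>
  define \<kappa> where "\<kappa> n x = exp 1 * bump 0 (q n x)" for n x
  define \<eta> where "\<eta> n x = \<kappa> n x * F n x" for n x
  have qC: "Ck k (q n)" for k n
    unfolding q_def by (intro Ck_add Ck_mult Ck_const Ck_norm_square)
  have CkE: "Ck k (\<eta> n)" for k n
    unfolding \<eta>_def \<kappa>_def by (intro Ck_mult Ck_const Ck_bump_compose qC smooth)
  have dq: "(q n has_derivative (\<lambda>h. - (2 / (real (Suc n))\<^sup>2) * (x \<bullet> h))) (at x)" for n x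
  proof -
    have "((\<lambda>x. 1 + c * (x \<bullet> x)) has_derivative (\<lambda>h. 2 * c * (x \<bullet> h))) (at x)" for c
      by (auto intro!: derivative_eq_intros simp: inner_commute)
    from this[of "- (1 / (real (Suc n))\<^sup>2)"] show ?thesis
      unfolding q_def power2_norm_eq_inner by (simp del: of_nat_Suc)
  qed
  have d\<kappa>: "(\<kappa> n has_derivative (\<lambda>h. exp 1 * (bump 2 (q n x) * (- (2 / (real (Suc n))\<^sup>2) * (x \<bullet> h))))) (at x)" for n x
    unfolding \<kappa>_def
    using has_derivative_compose[OF dq bump_deriv[of 0 "q n x", unfolded has_field_derivative_def]]
    by (auto intro!: derivative_eq_intros simp: numeral_2_eq_2)
  define H where "H n x = \<kappa> n x *\<^sub>R Fg n x - (F n x * exp 1 * bump 2 (q n x) * 2 / (real (Suc n))\<^sup>2) *\<^sub>R x" for n x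
  have gr: "gradient (\<eta> n) x = H n x" for n x
  proof (rule gradient_eqI)
    show "(\<eta> n has_derivative (\<lambda>h. H n x \<bullet> h)) (at x)"
      unfolding \<eta>_def H_def
      by (rule has_derivative_eq_rhs[OF has_derivative_mult[OF d\<kappa> der]])
        (auto simp: fun_eq_iff inner_diff_left algebra_simps)
  qed
  have q1: "q n x \<le> 1" for n x by (simp add: q_def)
  have qpos: "q n x > 0 \<longleftrightarrow> norm x < real (Suc n)" for n x
  proof -
    have "q n x > 0 \<longleftrightarrow> (norm x)\<^sup>2 < (real (Suc n))\<^sup>2"
      by (simp add: q_def field_simps del: of_nat_Suc)
    also have "\<dots> \<longleftrightarrow> norm x < real (Suc n)"
      using power2_less_imp_less[of "norm x" "real (Suc n)"] power_strict_mono[of "norm x" "real (Suc n)" 2] by auto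
    finally show ?thesis .
  qed
  have \<kappa>1: "0 \<le> \<kappa> n x" "\<kappa> n x \<le> 1" for n x
    using bump_nonneg[of 0 "q n x"] bump_0_le[OF q1[of n x]]
    by (auto simp: \<kappa>_def exp_minus field_simps)
  \<comment> \<open>Used twice: with \<open>norm x < real (Suc n)\<close> it gives the summand
    \<open>4 * exp 1\<close> of the gradient bound, and for fixed \<open>x\<close> it is a null
    sequence. Its 4 is the 2 of \<open>bump_2_le\<close> times the 2 from differentiating the
    square.\<close>
  have sm: "norm ((F n x * exp 1 * bump 2 (q n x) * 2 / (real (Suc n))\<^sup>2) *\<^sub>R x)
      \<le> 4 * exp 1 * B * (norm x) ^ 3 / (real (Suc n))\<^sup>2" for n x
  proof (cases "norm x < real (Suc n)")
    case True
    have "\<bar>F n x * exp 1 * bump 2 (q n x) * 2 / (real (Suc n))\<^sup>2\<bar>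
       = \<bar>F n x\<bar> * bump 2 (q n x) * (2 * exp 1) / (real (Suc n))\<^sup>2"
      using bump_nonneg[of 2 "q n x"] by (simp add: abs_mult)
    also have "\<dots> \<le> (B * (norm x)\<^sup>2) * 2 * (2 * exp 1) / (real (Suc n))\<^sup>2"
      using True by (intro divide_right_mono mult_right_mono mult_mono bound bump_2_le) (auto simp: B bump_nonneg)
    finally have "\<bar>F n x * exp 1 * bump 2 (q n x) * 2 / (real (Suc n))\<^sup>2\<bar> * norm x
       \<le> ((B * (norm x)\<^sup>2) * 2 * (2 * exp 1) / (real (Suc n))\<^sup>2) * norm x"
      by (rule mult_right_mono) simp
    then show ?thesis by (simp add: power3_eq_cube power2_eq_square mult_ac)
  next
    case False
    then have "bump 2 (q n x) = 0" using qpos[of n x] by (simp add: bump_def)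
    then show ?thesis using B by simp
  qed
  have H1: "norm (H n x) \<le> B * (1 + 4 * exp 1) * norm x" for n x
  proof (cases "norm x < real (Suc n)")
    case True
    have "norm (\<kappa> n x *\<^sub>R Fg n x) \<le> 1 * (B * norm x)"
      unfolding norm_scaleR using \<kappa>1[of n x] True by (intro mult_mono bound) auto
    moreover have "4 * exp 1 * B * (norm x) ^ 3 / (real (Suc n))\<^sup>2 \<le> 4 * exp 1 * B * norm x"
    proof -
      have "(norm x)\<^sup>2 \<le> (real (Suc n))\<^sup>2" using True by (intro power_mono) auto
      then have "(norm x) ^ 3 \<le> norm x * (real (Suc n))\<^sup>2"
        using mult_left_mono[of "(norm x)\<^sup>2" "(real (Suc n))\<^sup>2" "norm x"] by (simp add: power3_eq_cube power2_eq_square mult_ac)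
      then have "4 * exp 1 * B * (norm x) ^ 3 \<le> 4 * exp 1 * B * (norm x * (real (Suc n))\<^sup>2)"
        using B by (intro mult_left_mono) auto
      then show ?thesis by (simp add: divide_le_eq mult_ac del: of_nat_Suc)
    qed
    ultimately show ?thesis using sm[of n x] 
      norm_triangle_ineq4[of "\<kappa> n x *\<^sub>R Fg n x" "(F n x * exp 1 * bump 2 (q n x) * 2 / (real (Suc n))\<^sup>2) *\<^sub>R x"]
      unfolding H_def by (simp add: algebra_simps)
  next
    case False
    then have "bump 2 (q n x) = 0" "\<kappa> n x = 0" using qpos[of n x] by (simp_all add: bump_def \<kappa>_def)
    then show ?thesis using B by (simp add: H_def)
  qed
  have H2: "(\<lambda>n. H n x) \<longlonglongrightarrow> G x" if x: "x \<in> S" for x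
  proof -
    have l0: "(\<lambda>n. 1 / (real (Suc n))\<^sup>2) \<longlonglongrightarrow> 0"
    proof -
      have "(\<lambda>n. (inverse (real (Suc n)))\<^sup>2) \<longlonglongrightarrow> 0\<^sup>2"
        by (intro tendsto_power LIMSEQ_inverse_real_of_nat)
      moreover have "(\<lambda>n. 1 / (real (Suc n))\<^sup>2) = (\<lambda>n. (inverse (real (Suc n)))\<^sup>2)"
        by (simp add: power_one_over[symmetric] inverse_eq_divide del: of_nat_Suc)
      ultimately show ?thesis by (simp only: power_zero_numeral)
    qed
    have "(\<lambda>n. 1 + (- (1 / (real (Suc n))\<^sup>2)) * (norm x)\<^sup>2) \<longlonglongrightarrow> 1 + (- 0) * (norm x)\<^sup>2"
      by (intro tendsto_intros l0)
    then have "(\<lambda>n. q n x) \<longlonglongrightarrow> 1" by (simp add: q_def)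
    moreover have "isCont (bump 0) 1" using bump_deriv by (rule DERIV_isCont)
    ultimately have "(\<lambda>n. \<kappa> n x) \<longlonglongrightarrow> exp 1 * bump 0 1"
      unfolding \<kappa>_def by (intro tendsto_intros isCont_tendsto_compose[of _ "bump 0"])
    then have "(\<lambda>n. \<kappa> n x) \<longlonglongrightarrow> 1" by (simp add: bump_def flip: exp_add)
    from tendsto_scaleR[OF this conv[OF x]]
    have 1: "(\<lambda>n. \<kappa> n x *\<^sub>R Fg n x) \<longlonglongrightarrow> G x" by simp
    have "(\<lambda>n. (4 * exp 1 * B * (norm x) ^ 3) * (1 / (real (Suc n))\<^sup>2)) \<longlonglongrightarrow> (4 * exp 1 * B * (norm x) ^ 3) * 0"
      by (intro tendsto_intros l0)
    then have "(\<lambda>n. (F n x * exp 1 * bump 2 (q n x) * 2 / (real (Suc n))\<^sup>2) *\<^sub>R x) \<longlonglongrightarrow> 0"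
      by (intro Lim_null_comparison[OF always_eventually[OF allI[OF sm]]]) simp
    from tendsto_diff[OF 1 this] show ?thesis by (simp add: H_def)
  qed
  have "\<eta> n \<in> test_functions" for n
  proof -
    have "{x. \<eta> n x \<noteq> 0} \<subseteq> cball 0 (real (Suc n))"
    proof
      fix x assume "x \<in> {x. \<eta> n x \<noteq> 0}"
      then have "q n x > 0" by (auto simp: \<eta>_def \<kappa>_def bump_def split: if_splits)
      then show "x \<in> cball 0 (real (Suc n))" using qpos[of n x] by simp
    qed
    then have "closure {x. \<eta> n x \<noteq> 0} \<subseteq> cball 0 (real (Suc n))"
      by (rule closure_minimal) simp
    then have "compact (closure {x. \<eta> n x \<noteq> 0})"
      by (meson bounded_cball bounded_subset closed_closure compact_eq_bounded_closed)
    then show ?thesis using CkE by (simp add: test_functions_def)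
  qed
  then show thesis by (intro that[of \<eta>]) (simp_all only: gr H1 H2)
qed

text \<open>The complement of \<open>K\<close> is open, so derivatives vanish there. On
  \<open>K\<close> each partial derivative is continuous and hence bounded.\<close>

lemma compact_support_deriv_bounded:
  fixes f :: "'a::euclidean_space \<Rightarrow> real"
  assumes f: "Ck (Suc 0) f" and K: "compact K" and z: "\<And>x. x \<notin> K \<Longrightarrow> f x = 0"
  shows "\<exists>B\<ge>0. \<forall>x h. \<bar>frechet_derivative f (at x) h\<bar> \<le> B * norm h"
    and "x \<notin> K \<Longrightarrow> frechet_derivative f (at x) h = 0"
proof -
  note der = Ck_has_derivative[OF f]
  have z': "frechet_derivative f (at x) h = 0" if "x \<notin> K" for x h
  proof -
    have "((\<lambda>x. 0) has_derivative (\<lambda>h. 0)) (at x)" by simp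
    then have "(f has_derivative (\<lambda>h. 0)) (at x)"
      by (rule has_derivative_transform_within_open[where s = "- K"])
        (use K that z in \<open>auto simp: compact_imp_closed open_Compl\<close>)
    then show ?thesis using frechet_derivative_at by metis
  qed
  then show "x \<notin> K \<Longrightarrow> frechet_derivative f (at x) h = 0" .
  have "\<exists>C. \<forall>x. \<bar>frechet_derivative f (at x) b\<bar> \<le> C" for b
  proof -
    have "continuous_on K (\<lambda>x. frechet_derivative f (at x) b)"
      using f by (auto intro: continuous_on_subset)
    then have "bounded ((\<lambda>x. frechet_derivative f (at x) b) ` K)"
      using K by (intro compact_imp_bounded compact_continuous_image)
    then obtain C where "\<And>x. x \<in> K \<Longrightarrow> \<bar>frechet_derivative f (at x) b\<bar> \<le> C"
      unfolding bounded_iff by auto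
    then have "\<bar>frechet_derivative f (at x) b\<bar> \<le> max C 0" for x
      using z'[of x b] by (cases "x \<in> K") (auto simp: le_max_iff_disj)
    then show ?thesis by blast
  qed
  then obtain C where C: "\<And>b x. \<bar>frechet_derivative f (at x) b\<bar> \<le> C b" by metis
  have C0: "0 \<le> C b" for b using C[of undefined b] by linarith
  have "\<bar>frechet_derivative f (at x) h\<bar> \<le> (\<Sum>b\<in>Basis. C b) * norm h" for x h
  proof -
    interpret linear "frechet_derivative f (at x)"
      using der by (meson has_derivative_linear)
    have "frechet_derivative f (at x) h = frechet_derivative f (at x) (\<Sum>b\<in>Basis. (h \<bullet> b) *\<^sub>R b)"
      by (simp add: euclidean_representation)
    also have "\<dots> = (\<Sum>b\<in>Basis. (h \<bullet> b) * frechet_derivative f (at x) b)"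
      by (simp add: sum scale)
    also have "\<bar>\<dots>\<bar> \<le> (\<Sum>b\<in>Basis. norm h * C b)"
      by (rule order_trans[OF sum_abs sum_mono])
         (auto simp: abs_mult intro!: mult_mono C Basis_le_norm)
    finally show ?thesis by (simp add: sum_distrib_left sum_distrib_right mult.commute)
  qed
  then show "\<exists>B\<ge>0. \<forall>x h. \<bar>frechet_derivative f (at x) h\<bar> \<le> B * norm h"
    using C0 by (intro exI[of _ "\<Sum>b\<in>Basis. C b"]) (auto intro: sum_nonneg)
qed

lemma test_function_zero_outside:
  assumes "f \<in> test_functions"
  shows "x \<notin> closure {x. f x \<noteq> 0} \<Longrightarrow> f x = 0"
  using closure_subset[of "{x. f x \<noteq> 0}"] by auto

lemma test_function_derivative:
  assumes "f \<in> test_functions"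
  shows "(f has_derivative (\<lambda>h. gradient f x \<bullet> h)) (at x)"
proof -
  have "Ck (Suc 0) f" using assms by (auto simp: test_functions_def)
  then show ?thesis using Ck_has_derivative[of 0 f x] gradient_inner[of f x]
    by (simp add: differentiableI)
qed

text \<open>The preceding bound, applied to the first partial derivatives, makes the gradient
  Lipschitz, and the remainder is then quadratic. Integrated against a coupling, such a remainder
  becomes a multiple of the squared transport cost.\<close>

lemma test_function_expansion:
  fixes f :: "'a::euclidean_space \<Rightarrow> real"
  assumes f: "f \<in> test_functions"
  shows "\<exists>L\<ge>0. \<forall>x y. \<bar>f y - f x - gradient f x \<bullet> (y - x)\<bar> \<le> L * (norm (y - x))\<^sup>2"
proof -
  let ?K = "closure {x. f x \<noteq> 0}"
  have K: "compact ?K" and Ck: "\<And>k. Ck k f" using f by (auto simp: test_functions_def)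
  have C1: "Ck (Suc 0) f" by (rule Ck)
  note z' = compact_support_deriv_bounded(2)[OF C1 K test_function_zero_outside[OF f]]
  have "\<exists>B\<ge>0. \<forall>x h. \<bar>frechet_derivative (\<lambda>x. frechet_derivative f (at x) b) (at x) h\<bar> \<le> B * norm h" for b
    by (rule compact_support_deriv_bounded(1)[OF _ K]) (use Ck[of "Suc (Suc 0)"] z' in auto)
  then obtain B where B0: "\<And>b. B b \<ge> 0"
    and B: "\<And>b x h. \<bar>frechet_derivative (\<lambda>x. frechet_derivative f (at x) b) (at x) h\<bar> \<le> B b * norm h"
    by metis
  have lip: "\<bar>frechet_derivative f (at y) b - frechet_derivative f (at x) b\<bar> \<le> B b * norm (y - x)" for b x y
  proof -
    have "norm (frechet_derivative f (at y) b - frechet_derivative f (at x) b) \<le> B b * norm (y - x)"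
    proof (rule differentiable_bound[of UNIV "\<lambda>x. frechet_derivative f (at x) b"
            "\<lambda>x. frechet_derivative (\<lambda>x. frechet_derivative f (at x) b) (at x)"])
      fix x
      show "((\<lambda>x. frechet_derivative f (at x) b) has_derivative
         frechet_derivative (\<lambda>x. frechet_derivative f (at x) b) (at x)) (at x)"
        using Ck[of "Suc (Suc 0)"] by (intro Ck_has_derivative[of 0]) auto
      show "onorm (frechet_derivative (\<lambda>x. frechet_derivative f (at x) b) (at x)) \<le> B b"
        by (rule onorm_le) (simp add: B)
    qed auto
    then show ?thesis by simp
  qed
  define L where "L = (\<Sum>b\<in>Basis. B b)"
  have L0: "0 \<le> L" unfolding L_def by (simp add: B0 sum_nonneg)
  have gl: "norm (gradient f y - gradient f x) \<le> L * norm (y - x)" for x y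
  proof -
    have "gradient f y - gradient f x = (\<Sum>b\<in>Basis. (frechet_derivative f (at y) b - frechet_derivative f (at x) b) *\<^sub>R b)"
      by (simp add: gradient_def scaleR_diff_left sum_subtractf)
    also have "norm \<dots> \<le> (\<Sum>b\<in>Basis. B b * norm (y - x))"
      by (rule order_trans[OF norm_sum sum_mono]) (use lip in auto)
    finally show ?thesis by (simp add: L_def sum_distrib_right)
  qed
  have "\<bar>f y - f x - gradient f x \<bullet> (y - x)\<bar> \<le> L * (norm (y - x))\<^sup>2" for x y
  proof -
    have "norm (f y - f x - gradient f x \<bullet> (y - x)) \<le> norm (y - x) * (L * norm (y - x))"
    proof (rule differentiable_bound_linearization[where S = "closed_segment x y" and f' = "\<lambda>z h. gradient f z \<bullet> h"])
      fix t :: real assume "t \<in> {0..1}"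
      then show "x + t *\<^sub>R (y - x) \<in> closed_segment x y"
        unfolding closed_segment_def by (force simp: algebra_simps)
    next
      fix z assume z: "z \<in> closed_segment x y"
      show "(f has_derivative (\<lambda>h. gradient f z \<bullet> h)) (at z within closed_segment x y)"
        using test_function_derivative[OF f] by (rule has_derivative_at_withinI)
      have "norm (z - x) \<le> norm (y - x)"
        using segment_bound1[OF z] by (simp add: norm_minus_commute)
      then have le: "norm (gradient f z - gradient f x) \<le> L * norm (y - x)"
        using gl[of z x] mult_left_mono[OF _ L0] by (meson order_trans)
      show "onorm ((\<lambda>h. gradient f z \<bullet> h) - (\<lambda>h. gradient f x \<bullet> h)) \<le> L * norm (y - x)"
      proof (rule onorm_le)
        fix h
        have "norm (((\<lambda>h. gradient f z \<bullet> h) - (\<lambda>h. gradient f x \<bullet> h)) h) = \<bar>(gradient f z - gradient f x) \<bullet> h\<bar>"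
          by (simp add: inner_diff_left)
        also have "\<dots> \<le> norm (gradient f z - gradient f x) * norm h" by (rule Cauchy_Schwarz_ineq2)
        also have "\<dots> \<le> L * norm (y - x) * norm h" using le by (rule mult_right_mono) simp
        finally show "norm (((\<lambda>h. gradient f z \<bullet> h) - (\<lambda>h. gradient f x \<bullet> h)) h) \<le> L * norm (y - x) * norm h" .
      qed
    qed auto
    then show ?thesis by (simp add: power2_eq_square mult_ac)
  qed
  then show ?thesis using L0 by blast
qed

lemma test_function_continuous:
  assumes "f \<in> test_functions"
  shows "continuous_on A f" "continuous_on A (gradient f)"
proof -
  have "Ck 0 f" "Ck (Suc 0) f" using assms unfolding test_functions_def by blast+
  then show "continuous_on A f" "continuous_on A (gradient f)"
    by (auto simp: gradient_def[abs_def] intro!: continuous_intros intro: continuous_on_subset)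
qed

lemma test_function_bounded:
  assumes f: "f \<in> test_functions"
  shows "\<exists>B. \<forall>x. \<bar>f x\<bar> \<le> B"
proof -
  let ?K = "closure {x. f x \<noteq> 0}"
  have "compact ?K" using f by (auto simp: test_functions_def)
  then have "bounded (f ` ?K)"
    by (intro compact_imp_bounded compact_continuous_image test_function_continuous f)
  then obtain C where "\<And>x. x \<in> ?K \<Longrightarrow> \<bar>f x\<bar> \<le> C"
    unfolding bounded_iff by auto
  then have "\<bar>f x\<bar> \<le> max C 0" for x
    using test_function_zero_outside[OF f, of x] by (cases "x \<in> ?K") (auto simp: le_max_iff_disj)
  then show ?thesis by blast
qed

subsection \<open>Pointwise estimates for the network\<close>

text \<open>Induction along Horner's scheme: the remainder of \<open>pCons a p\<close> is
  \<open>z'\<close> times the remainder of \<open>p\<close> plus \<open>poly (pderiv p) z\<close>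
  times the squared increment. Uniformity on bounded sets is needed for differentiating under the
  integral in \<open>plin_derivative\<close>.\<close>

lemma poly_taylor_bound:
  fixes p :: "real poly"
  shows "\<exists>B\<ge>0. \<forall>z z'. \<bar>z\<bar> \<le> R \<longrightarrow> \<bar>z'\<bar> \<le> R \<longrightarrow>
     \<bar>poly p z' - poly p z - poly (pderiv p) z * (z' - z)\<bar> \<le> B * (z' - z)\<^sup>2"
proof (induction p)
  case 0
  then show ?case by (intro exI[of _ 0]) auto
next
  case (pCons a p)
  from pCons obtain B where B: "B \<ge> 0" "\<And>z z'. \<bar>z\<bar> \<le> R \<Longrightarrow> \<bar>z'\<bar> \<le> R \<Longrightarrow>
     \<bar>poly p z' - poly p z - poly (pderiv p) z * (z' - z)\<bar> \<le> B * (z' - z)\<^sup>2" by blast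
  have "bounded (poly (pderiv p) ` cball 0 R)"
    by (intro compact_imp_bounded compact_continuous_image continuous_intros compact_cball)
  then obtain S where "\<forall>z\<in>cball 0 R. \<bar>poly (pderiv p) z\<bar> \<le> S"
    unfolding bounded_iff by auto
  then have S: "\<bar>poly (pderiv p) z\<bar> \<le> S" if "\<bar>z\<bar> \<le> R" for z using that by auto
  have "\<bar>poly (pCons a p) z' - poly (pCons a p) z - poly (pderiv (pCons a p)) z * (z' - z)\<bar>
     \<le> (\<bar>R\<bar> * B + \<bar>S\<bar>) * (z' - z)\<^sup>2" if z: "\<bar>z\<bar> \<le> R" "\<bar>z'\<bar> \<le> R" for z z'
  proof -
    have "poly (pCons a p) z' - poly (pCons a p) z - poly (pderiv (pCons a p)) z * (z' - z)
      = z' * (poly p z' - poly p z - poly (pderiv p) z * (z' - z)) + poly (pderiv p) z * (z' - z)\<^sup>2"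
      by (simp add: pderiv_pCons algebra_simps power2_eq_square)
    also have "\<bar>\<dots>\<bar> \<le> \<bar>z'\<bar> * \<bar>poly p z' - poly p z - poly (pderiv p) z * (z' - z)\<bar> + \<bar>poly (pderiv p) z\<bar> * (z' - z)\<^sup>2"
      by (rule order_trans[OF abs_triangle_ineq]) (simp add: abs_mult)
    also have "\<dots> \<le> \<bar>R\<bar> * (B * (z' - z)\<^sup>2) + \<bar>S\<bar> * (z' - z)\<^sup>2"
      using z B S[OF z(1)] by (intro add_mono mult_mono) auto
    finally show ?thesis by (simp add: algebra_simps)
  qed
  then show ?case using B by (intro exI[of _ "\<bar>R\<bar> * B + \<bar>S\<bar>"]) auto
qed

text \<open>Stone--Weierstrass is applied to the derivative of the activation, so its polynomial has
  to be integrated back.\<close>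

lemma real_polynomial_antiderivative:
  assumes "real_polynomial_function (q :: real \<Rightarrow> real)"
  obtains p where "poly (pderiv p) = q" "poly p 0 = 0"
proof -
  from assms obtain a n where q: "q = (\<lambda>x. \<Sum>i\<le>n. a i * x ^ i)"
    unfolding real_polynomial_function_iff_sum by blast
  define p where "p = (\<Sum>i\<le>n. monom (a i / real (Suc i)) (Suc i))"
  have pderiv_sum: "pderiv (\<Sum>i\<in>A. f i) = (\<Sum>i\<in>A. pderiv (f i))" for A :: "nat set" and f :: "nat \<Rightarrow> real poly"
    by (induction A rule: infinite_finite_induct) (auto simp: pderiv_add)
  have "poly (pderiv p) = q"
    by (auto simp: p_def q pderiv_sum pderiv_monom poly_sum poly_monom fun_eq_iff simp del: of_nat_Suc)
  moreover have "poly p 0 = 0" by (simp add: p_def poly_sum poly_monom)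
  ultimately show thesis by (rule that)
qed

text \<open>The transition is placed to the right of 0, not around it: the ramps vanish at 0, in
  agreement with \<open>relu' 0 = 0\<close>.\<close>

definition ramp :: "real \<Rightarrow> real \<Rightarrow> real" where
  "ramp e z = max 0 (min 1 (z / e))"

text \<open>Approximating \<open>relu\<close> itself would say nothing about derivatives, so the
  derivative is approximated uniformly and integrated from 0. Since \<open>p\<close> vanishes at 0
  and its derivative is at most \<open>1 + e\<close>, the growth of \<open>p\<close> is linear with
  constant 2.\<close>

lemma relu_polynomial_approximation:
  assumes e: "0 < e" "e \<le> 1" and R: "0 \<le> R"
  obtains p :: "real poly" where
    "\<And>z. \<bar>z\<bar> \<le> R \<Longrightarrow> \<bar>poly (pderiv p) z - ramp e z\<bar> \<le> e"
    "\<And>z. \<bar>z\<bar> \<le> R \<Longrightarrow> \<bar>poly (pderiv p) z\<bar> \<le> 2"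
    "\<And>z. \<bar>z\<bar> \<le> R \<Longrightarrow> \<bar>poly p z\<bar> \<le> 2 * \<bar>z\<bar>"
    "\<And>z. \<bar>z\<bar> \<le> R \<Longrightarrow> \<bar>poly p z - relu z\<bar> \<le> (3 + \<bar>z\<bar>) * e"
proof -
  have "continuous_on {-R..R} (ramp e)"
    unfolding ramp_def using e by (intro continuous_intros) auto
  then obtain q where q: "real_polynomial_function q" "\<And>z. z \<in> {-R..R} \<Longrightarrow> \<bar>ramp e z - q z\<bar> < e"
    using Stone_Weierstrass_real_polynomial_function[of "{-R..R}" "ramp e" e] e by auto
  obtain p where p: "poly (pderiv p) = q" "poly p 0 = 0"
    using real_polynomial_antiderivative[OF q(1)] .
  have 1: "\<bar>poly (pderiv p) z - ramp e z\<bar> \<le> e" if "\<bar>z\<bar> \<le> R" for z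
    proof -
    have "\<bar>ramp e z - q z\<bar> < e" using q(2)[of z] that by (simp add: abs_le_iff)
    then show ?thesis unfolding p by linarith
  qed
  have r01: "0 \<le> ramp e z" "ramp e z \<le> 1" for z by (auto simp: ramp_def)
  have 2: "\<bar>poly (pderiv p) z\<bar> \<le> 2" if "\<bar>z\<bar> \<le> R" for z
    using 1[OF that] r01[of z] e by linarith
  have mvt: "\<bar>f y - f x\<bar> \<le> B * \<bar>y - x\<bar>"
    if "\<And>z. z \<in> {min x y..max x y} \<Longrightarrow> (f has_real_derivative f' z) (at z)"
       "\<And>z. z \<in> {min x y..max x y} \<Longrightarrow> \<bar>f' z\<bar> \<le> B" for f f' and x y B :: real
    using field_differentiable_bound[of "{min x y..max x y}" f f' B y x] that
    by (auto intro: has_field_derivative_at_within)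
  have 3: "\<bar>poly p z\<bar> \<le> 2 * \<bar>z\<bar>" if "\<bar>z\<bar> \<le> R" for z
  proof -
    have "\<bar>poly (pderiv p) w\<bar> \<le> 2" if "w \<in> {min 0 z..max 0 z}" for w
      using 2[of w] that \<open>\<bar>z\<bar> \<le> R\<close> R by auto
    then have "\<bar>poly p z - poly p 0\<bar> \<le> 2 * \<bar>z - 0\<bar>"
      by (intro mvt[of 0 z "poly p" "poly (pderiv p)"]) (auto simp: poly_DERIV)
    then show ?thesis using p(2) by simp
  qed
  have 4: "\<bar>poly p z - relu z\<bar> \<le> (3 + \<bar>z\<bar>) * e" if z: "\<bar>z\<bar> \<le> R" for z
  proof -
    \<comment> \<open>Left of 0 the ramp vanishes. On the transition zone both functions are small,
      together at most \<open>3 * z\<close>. Beyond it the derivative is within \<open>e\<close> of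
      1, and the error \<open>3 * e\<close> reached at \<open>e\<close> is carried along.\<close>
    consider "z \<le> 0" | "0 < z" "z \<le> e" | "e < z" by linarith
    then show ?thesis
    proof cases
      case 1
      have "\<bar>poly (pderiv p) w\<bar> \<le> e" if "w \<in> {min 0 z..max 0 z}" for w
        proof -
        have "w \<le> 0" "\<bar>w\<bar> \<le> R" using that 1 z R by auto
        moreover from this have "w / e \<le> 0" using e by (simp add: divide_le_0_iff)
        ultimately show ?thesis
          using \<open>\<And>z. \<bar>z\<bar> \<le> R \<Longrightarrow> \<bar>poly (pderiv p) z - ramp e z\<bar> \<le> e\<close>[of w] by (simp add: ramp_def)
      qed
      then have "\<bar>poly p z - poly p 0\<bar> \<le> e * \<bar>z - 0\<bar>"
        by (intro mvt[of 0 z "poly p" "poly (pderiv p)"]) (auto simp: poly_DERIV)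
      then show ?thesis using 1 p(2) e by (simp add: relu_def algebra_simps)
    next
      case 2
      then have "\<bar>poly p z - relu z\<bar> \<le> 3 * z" using 3[OF z] by (auto simp: relu_def)
      also have "\<dots> \<le> 3 * e" using 2 by simp
      also have "\<dots> \<le> (3 + \<bar>z\<bar>) * e" using e by (simp add: algebra_simps)
      finally show ?thesis .
    next
      case 3
      have "\<bar>poly (pderiv p) w - 1\<bar> \<le> e" if "w \<in> {min e z..max e z}" for w
        using 1[of w] that 3 z e by (auto simp: ramp_def min_def max_def split: if_splits)
      then have "\<bar>(poly p z - z) - (poly p e - e)\<bar> \<le> e * \<bar>z - e\<bar>"
        by (intro mvt[of e z "\<lambda>z. poly p z - z" "\<lambda>w. poly (pderiv p) w - 1"])
          (auto intro!: derivative_eq_intros simp: poly_DERIV)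
      moreover have "\<bar>poly p e - e\<bar> \<le> 3 * e"
        using \<open>\<And>z. \<bar>z\<bar> \<le> R \<Longrightarrow> \<bar>poly p z\<bar> \<le> 2 * \<bar>z\<bar>\<close>[of e] 3 z e by auto
      moreover have "e * \<bar>z - e\<bar> \<le> e * \<bar>z\<bar>" using 3 e by (intro mult_left_mono) auto
      ultimately have "\<bar>poly p z - z\<bar> \<le> 3 * e + e * \<bar>z\<bar>" by linarith
      then show ?thesis using 3 e by (simp add: relu_def algebra_simps)
    qed
  qed
  show thesis by (rule that[OF 1 2 3 4])
qed

lemma ramp_eventually: "\<forall>\<^sub>F n in sequentially. ramp (1 / real (Suc n)) z = relu' z"
proof (cases "z > 0")
  case True
  have "\<forall>\<^sub>F n in sequentially. 1 / z \<le> real n"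
    by (rule eventually_sequentiallyI[of "nat \<lceil>1 / z\<rceil>"]) linarith
  then show ?thesis
  proof eventually_elim
    case (elim n)
    then have "1 \<le> z * real (Suc n)" using True by (simp add: field_simps)
    then show ?case using True by (simp add: ramp_def relu'_def)
  qed
next
  case False
  then have "z / (1 / real (Suc n)) \<le> 0" for n by (simp add: mult_le_0_iff)
  then have "ramp (1 / real (Suc n)) z = 0" for n
    unfolding ramp_def by (smt (verit))
  then show ?thesis using False by (simp add: relu'_def)
qed

text \<open>Homogeneous coordinates: \<open>w \<bullet> x + b\<close> becomes
  \<open>snd \<theta> \<bullet> aug x\<close>. The norm of \<open>aug x\<close> is the density in
  the Lipschitz condition, and it is also the weight that dominates every integrand below.\<close>

definition aug :: "real ^ 'n::finite \<Rightarrow> (real ^ 'n) \<times> real" where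
  "aug x = (x, 1)"

lemma abs_fst_le: "\<bar>fst \<theta>\<bar> \<le> norm \<theta>" for \<theta> :: "real \<times> 'b::real_normed_vector"
  using norm_fst_le[of "fst \<theta>" "snd \<theta>"] by simp

lemma norm_snd_le': "norm (snd \<theta>) \<le> norm \<theta>" for \<theta> :: "real \<times> 'b::real_normed_vector"
  using norm_snd_le[of "snd \<theta>" "fst \<theta>"] by simp

lemma norm_aug: "norm (aug x) = sqrt (1 + (norm x)\<^sup>2)"
  by (simp add: aug_def norm_Pair add.commute)

lemma norm_aug_le: "norm (aug x) \<le> norm x + 1"
  unfolding aug_def by (rule order_trans[OF norm_Pair_le]) simp

lemma phi_aug: "phi \<theta> x = fst \<theta> * relu (snd \<theta> \<bullet> aug x)"
  by (cases \<theta>) (auto simp: aug_def)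

lemma grad_phi_aug:
  "grad_phi \<theta> x = (relu (snd \<theta> \<bullet> aug x), (fst \<theta> * relu' (snd \<theta> \<bullet> aug x)) *\<^sub>R aug x)"
  by (cases \<theta>) (auto simp: aug_def)

lemma relu_lipschitz: "\<bar>relu z - relu z'\<bar> \<le> \<bar>z - z'\<bar>"
  by (auto simp: relu_def)

lemma abs_relu_le: "\<bar>relu z\<bar> \<le> \<bar>z\<bar>"
  by (auto simp: relu_def)

lemma abs_relu'_le: "\<bar>relu' z\<bar> \<le> 1"
  by (auto simp: relu'_def)

text \<open>The linear expansion is exact unless the two arguments lie on different sides of the
  kink, and then the error is at most their distance.\<close>

lemma relu_expansion:
  "\<bar>relu z' - relu z - relu' z * (z' - z)\<bar> \<le> \<bar>z' - z\<bar> * \<bar>relu' z - relu' z'\<bar>"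
  by (auto simp: relu_def relu'_def)

lemma abs_inner_aug_le: "\<bar>u \<bullet> aug x\<bar> \<le> norm u * norm (aug x)"
  by (rule Cauchy_Schwarz_ineq2)

section \<open>Growth and first-order expansion of a single neuron\<close>

lemma abs_phi_le: "\<bar>phi \<theta> x\<bar> \<le> (norm \<theta>)\<^sup>2 * norm (aug x)"
proof -
  have "\<bar>phi \<theta> x\<bar> \<le> norm \<theta> * (norm \<theta> * norm (aug x))"
    unfolding phi_aug abs_mult
    by (intro mult_mono order_trans[OF abs_relu_le] order_trans[OF abs_inner_aug_le])
       (use abs_fst_le[of \<theta>] norm_snd_le'[of \<theta>] in \<open>auto intro!: mult_right_mono\<close>)
  then show ?thesis by (simp add: power2_eq_square mult_ac)
qed

lemma abs_phi_diff_le: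
  "\<bar>phi \<theta> x - phi \<theta>' x\<bar> \<le> (norm \<theta> + norm \<theta>') * norm (\<theta> - \<theta>') * norm (aug x)"
proof -
  have "phi \<theta> x - phi \<theta>' x = fst \<theta> * (relu (snd \<theta> \<bullet> aug x) - relu (snd \<theta>' \<bullet> aug x))
      + (fst \<theta> - fst \<theta>') * relu (snd \<theta>' \<bullet> aug x)"
    by (simp add: phi_aug algebra_simps)
  also have "\<bar>\<dots>\<bar> \<le> norm \<theta> * (norm (\<theta> - \<theta>') * norm (aug x)) + norm (\<theta> - \<theta>') * (norm \<theta>' * norm (aug x))"
  proof (rule order_trans[OF abs_triangle_ineq], unfold abs_mult, intro add_mono mult_mono)
    show "\<bar>relu (snd \<theta> \<bullet> aug x) - relu (snd \<theta>' \<bullet> aug x)\<bar> \<le> norm (\<theta> - \<theta>') * norm (aug x)"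
      using relu_lipschitz[of "snd \<theta> \<bullet> aug x" "snd \<theta>' \<bullet> aug x"] abs_inner_aug_le[of "snd (\<theta> - \<theta>')" x]
        mult_right_mono[OF norm_snd_le'[of "\<theta> - \<theta>'"], of "norm (aug x)"]
      by (simp add: inner_diff_left)
    show "\<bar>relu (snd \<theta>' \<bullet> aug x)\<bar> \<le> norm \<theta>' * norm (aug x)"
      using abs_relu_le[of "snd \<theta>' \<bullet> aug x"] abs_inner_aug_le[of "snd \<theta>'" x]
        mult_right_mono[OF norm_snd_le'[of "\<theta>'"], of "norm (aug x)"] by simp
    show "\<bar>fst \<theta> - fst \<theta>'\<bar> \<le> norm (\<theta> - \<theta>')" using abs_fst_le[of "\<theta> - \<theta>'"] by simp
  qed (use abs_fst_le[of \<theta>] in auto)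
  finally show ?thesis by (simp add: algebra_simps)
qed

lemma norm_grad_phi_le: "norm (grad_phi \<theta> x) \<le> 2 * norm \<theta> * norm (aug x)"
proof -
  have "norm (grad_phi \<theta> x) \<le> \<bar>relu (snd \<theta> \<bullet> aug x)\<bar> + \<bar>fst \<theta> * relu' (snd \<theta> \<bullet> aug x)\<bar> * norm (aug x)"
    unfolding grad_phi_aug by (rule order_trans[OF norm_Pair_le]) simp
  also have "\<dots> \<le> norm (snd \<theta>) * norm (aug x) + \<bar>fst \<theta>\<bar> * 1 * norm (aug x)"
    unfolding abs_mult
    by (intro add_mono mult_mono order_trans[OF abs_relu_le abs_inner_aug_le] abs_relu'_le) auto
  also have "\<dots> \<le> norm \<theta> * norm (aug x) + norm \<theta> * norm (aug x)"
    using abs_fst_le[of \<theta>] norm_snd_le'[of \<theta>] by (intro add_mono mult_right_mono) auto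
  finally show ?thesis by (simp add: algebra_simps)
qed

text \<open>The jump of \<open>relu'\<close> is not small at any given input, so it is kept as a
  separate term with its factor \<open>\<bar>fst \<theta>\<bar>\<close>; only its integral over the
  inputs is Lipschitz.\<close>

lemma norm_grad_phi_diff_le:
  "norm (grad_phi \<theta> x - grad_phi \<theta>' x) \<le> 2 * norm (\<theta> - \<theta>') * norm (aug x)
     + \<bar>fst \<theta>\<bar> * (norm (aug x) * \<bar>relu' (snd \<theta> \<bullet> aug x) - relu' (snd \<theta>' \<bullet> aug x)\<bar>)"
proof -
  let ?z = "snd \<theta> \<bullet> aug x" and ?z' = "snd \<theta>' \<bullet> aug x"
  have "grad_phi \<theta> x - grad_phi \<theta>' x
     = (relu ?z - relu ?z', (fst \<theta> * (relu' ?z - relu' ?z') + (fst \<theta> - fst \<theta>') * relu' ?z') *\<^sub>R aug x)"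
    by (simp add: grad_phi_aug algebra_simps)
  also have "norm \<dots> \<le> \<bar>relu ?z - relu ?z'\<bar> + \<bar>fst \<theta> * (relu' ?z - relu' ?z') + (fst \<theta> - fst \<theta>') * relu' ?z'\<bar> * norm (aug x)"
    by (rule order_trans[OF norm_Pair_le]) simp
  also have "\<dots> \<le> norm (\<theta> - \<theta>') * norm (aug x) + (\<bar>fst \<theta>\<bar> * \<bar>relu' ?z - relu' ?z'\<bar> + norm (\<theta> - \<theta>') * 1) * norm (aug x)"
  proof (intro add_mono mult_right_mono)
    show "\<bar>relu ?z - relu ?z'\<bar> \<le> norm (\<theta> - \<theta>') * norm (aug x)"
      using relu_lipschitz[of ?z ?z'] abs_inner_aug_le[of "snd (\<theta> - \<theta>')" x]
        mult_right_mono[OF norm_snd_le'[of "\<theta> - \<theta>'"], of "norm (aug x)"]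
      by (simp add: inner_diff_left)
    show "\<bar>fst \<theta> * (relu' ?z - relu' ?z') + (fst \<theta> - fst \<theta>') * relu' ?z'\<bar>
      \<le> \<bar>fst \<theta>\<bar> * \<bar>relu' ?z - relu' ?z'\<bar> + norm (\<theta> - \<theta>') * 1"
      using abs_fst_le[of "\<theta> - \<theta>'"]
      by (intro order_trans[OF abs_triangle_ineq], unfold abs_mult, intro add_mono mult_mono abs_relu'_le) auto
  qed auto
  finally show ?thesis by (simp add: algebra_simps)
qed

text \<open>The product structure gives a cross term, which is quadratic, and the expansion error of
  \<open>relu\<close>. The latter is only linear in the increment until the jump term has been
  integrated.\<close>

lemma phi_expansion:
  "\<bar>phi \<theta>' x - phi \<theta> x - grad_phi \<theta> x \<bullet> (\<theta>' - \<theta>)\<bar> \<le> (norm (\<theta>' - \<theta>))\<^sup>2 * norm (aug x)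
     + norm (\<theta>' - \<theta>) * (\<bar>fst \<theta>\<bar> * (norm (aug x) * \<bar>relu' (snd \<theta> \<bullet> aug x) - relu' (snd \<theta>' \<bullet> aug x)\<bar>))"
proof -
  let ?z = "snd \<theta> \<bullet> aug x" and ?z' = "snd \<theta>' \<bullet> aug x"
  have zz: "\<bar>?z' - ?z\<bar> \<le> norm (\<theta>' - \<theta>) * norm (aug x)"
    using abs_inner_aug_le[of "snd (\<theta>' - \<theta>)" x]
        mult_right_mono[OF norm_snd_le'[of "\<theta>' - \<theta>"], of "norm (aug x)"]
    by (simp add: inner_diff_left)
  have "grad_phi \<theta> x \<bullet> (\<theta>' - \<theta>) = (fst \<theta>' - fst \<theta>) * relu ?z + fst \<theta> * relu' ?z * (?z' - ?z)"
  proof -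
    have "grad_phi \<theta> x \<bullet> (\<theta>' - \<theta>) = grad_phi \<theta> x \<bullet> (fst \<theta>' - fst \<theta>, snd \<theta>' - snd \<theta>)"
      by (simp add: minus_prod_def)
    then show ?thesis by (simp add: grad_phi_aug inner_diff_right inner_commute algebra_simps)
  qed
  then have "phi \<theta>' x - phi \<theta> x - grad_phi \<theta> x \<bullet> (\<theta>' - \<theta>)
     = (fst \<theta>' - fst \<theta>) * (relu ?z' - relu ?z) + fst \<theta> * (relu ?z' - relu ?z - relu' ?z * (?z' - ?z))"
    by (simp add: phi_aug algebra_simps)
  also have "\<bar>\<dots>\<bar> \<le> norm (\<theta>' - \<theta>) * (norm (\<theta>' - \<theta>) * norm (aug x))
     + \<bar>fst \<theta>\<bar> * ((norm (\<theta>' - \<theta>) * norm (aug x)) * \<bar>relu' ?z - relu' ?z'\<bar>)"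
    using abs_fst_le[of "\<theta>' - \<theta>"] zz
    by (intro order_trans[OF abs_triangle_ineq], unfold abs_mult, intro add_mono mult_mono
        order_trans[OF relu_lipschitz] order_trans[OF relu_expansion]) auto
  finally show ?thesis by (simp add: algebra_simps power2_eq_square)
qed

text \<open>Euler's identity in degree 2. It holds at the kink too, because
  \<open>relu z = relu' z * z\<close> for every \<open>z\<close>.\<close>

lemma euler_phi: "\<theta> \<bullet> grad_phi \<theta> x = 2 * phi \<theta> x"
  by (cases \<theta>) (auto simp: grad_phi_aug phi_aug relu_def relu'_def max_def)

lemma phi_scaleR: "c \<ge> 0 \<Longrightarrow> phi (c *\<^sub>R \<theta>) x = c\<^sup>2 * phi \<theta> x"
  by (auto simp: phi_aug relu_def max_def mult_le_0_iff zero_le_mult_iff power2_eq_square)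

lemma grad_phi_scaleR: "c > 0 \<Longrightarrow> grad_phi (c *\<^sub>R \<theta>) x = c *\<^sub>R grad_phi \<theta> x"
  by (auto simp: grad_phi_aug relu_def relu'_def max_def mult_le_0_iff zero_le_mult_iff zero_less_mult_iff)

text \<open>The form in which the domain enters the estimates: the factor in front of the jump of
  \<open>relu'\<close> is controlled by the vector that defines the hyperplane.\<close>

lemma closure_Theta_le: "\<theta> \<in> closure Theta \<Longrightarrow> \<bar>fst \<theta>\<bar> \<le> norm (snd \<theta>)"
proof -
  have "closed {\<theta> :: ('n::finite) param. \<bar>fst \<theta>\<bar> \<le> norm (snd \<theta>)}"
    by (intro closed_Collect_le continuous_intros)
  moreover have "Theta \<subseteq> {\<theta> :: ('n::finite) param. \<bar>fst \<theta>\<bar> \<le> norm (snd \<theta>)}"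
    by (auto simp: Theta_def norm_Pair intro!: real_le_rsqrt)
  ultimately have "closure Theta \<subseteq> {\<theta> :: ('n::finite) param. \<bar>fst \<theta>\<bar> \<le> norm (snd \<theta>)}"
    by (rule closure_minimal[rotated])
  then show "\<theta> \<in> closure Theta \<Longrightarrow> \<bar>fst \<theta>\<bar> \<le> norm (snd \<theta>)" by auto
qed

lemma Theta_scaleR: "c > 0 \<Longrightarrow> \<theta> \<in> Theta \<Longrightarrow> c *\<^sub>R \<theta> \<in> Theta"
  by (cases \<theta>) (auto simp: Theta_def power_mult_distrib simp flip: distrib_left)

lemma closure_Theta_scaleR: "c > 0 \<Longrightarrow> \<theta> \<in> closure Theta \<Longrightarrow> c *\<^sub>R \<theta> \<in> closure Theta"
proof -
  assume c: "c > 0" and t: "\<theta> \<in> closure Theta"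
  have "(\<lambda>x. c *\<^sub>R x) ` Theta \<subseteq> Theta" using Theta_scaleR[OF c] by auto
  then have "closure ((\<lambda>x. c *\<^sub>R x) ` Theta) \<subseteq> closure Theta" by (rule closure_mono)
  then show ?thesis using t by (auto simp: closure_scaleR[symmetric])
qed

lemma zero_in_closure_Theta: "0 \<in> closure Theta"
proof (unfold closure_approachable, intro allI impI)
  fix e :: real assume "e > 0"
  then have "(0, 0, e / 2) \<in> Theta" "dist (0, 0, e / 2) (0 :: ('n::finite) param) < e"
    by (auto simp: Theta_def dist_norm norm_Pair)
  then show "\<exists>y\<in>Theta. dist y (0 :: ('n::finite) param) < e" by blast
qed

subsection \<open>Linear functionals of the network\<close>

locale risk_setting =
  fixes l :: "real \<Rightarrow> real \<Rightarrow> real" and P :: "((real ^ 'n::finite) \<times> real) measure" and C L :: real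
  assumes loss: "loss_assms l" and data: "data_assms P"
    and abs_d1_le: "\<And>y z. \<bar>d1 l y z\<bar> \<le> C"
    and L_nonneg: "0 \<le> L"
    and indicator_lipschitz: "\<And>u u'. u \<in> sphere 0 1 \<Longrightarrow> u' \<in> sphere 0 1 \<Longrightarrow>
        (\<integral>x. \<bar>indicator {x. fst u \<bullet> x + snd u > 0} x - indicator {x. fst u' \<bullet> x + snd u' > 0} x\<bar>
           \<partial>density (marginal P) (\<lambda>x. ennreal (sqrt (1 + (norm x)\<^sup>2)))) \<le> L * dist u u'"
    and integrable_l0: "integrable P (\<lambda>(x, y). l 0 y)"
begin

lemma sets_P[measurable_cong]: "sets P = sets borel"
  using data by (simp add: data_assms_def)

lemma space_P: "space P = UNIV"
  using sets_eq_imp_space_eq[OF sets_P] by simp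

sublocale P: prob_space P
  using data by (simp add: data_assms_def)

lemma C_nonneg: "0 \<le> C"
  using abs_d1_le[of 0 0] by linarith

lemma continuous_measurable_P: "continuous_on UNIV f \<Longrightarrow> f \<in> borel_measurable P"
  using borel_measurable_continuous_onI measurable_cong_sets[OF sets_P refl] by blast

lemma aug_measurable[measurable]: "(\<lambda>z. aug (fst z)) \<in> borel_measurable P"
  unfolding aug_def by (intro continuous_measurable_P continuous_intros)

lemma fst_measurable_P[measurable]: "fst \<in> P \<rightarrow>\<^sub>M borel"
  by (intro continuous_measurable_P continuous_intros)

lemma snd_measurable_P[measurable]: "snd \<in> borel_measurable P"
  by (intro continuous_measurable_P continuous_intros)

lemma relu_measurable[measurable]: "relu \<in> borel_measurable borel"
  unfolding relu_def[abs_def] by measurable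

lemma relu'_measurable[measurable]: "relu' \<in> borel_measurable borel"
  unfolding relu'_def[abs_def] by measurable

lemma phi_measurable[measurable]: "(\<lambda>z. phi \<theta> (fst z)) \<in> borel_measurable P"
  unfolding phi_aug by measurable

lemma grad_phi_measurable[measurable]: "(\<lambda>z. grad_phi \<theta> (fst z)) \<in> borel_measurable P"
  unfolding grad_phi_aug by measurable

section \<open>Integration against the first moment of the data\<close>

lemma integrable_aug: "integrable P (\<lambda>z. norm (aug (fst z)))"
proof -
  have "integrable P (\<lambda>z. (case z of (x, y) \<Rightarrow> norm x + \<bar>y\<bar>) + 1)"
    using data by (intro Bochner_Integration.integrable_add P.integrable_const) (auto simp: data_assms_def)
  then show ?thesis
    by (rule Bochner_Integration.integrable_bound)
       (auto intro!: AE_I2 order_trans[OF norm_aug_le] simp: split_beta)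
qed

definition A :: real where "A = (\<integral>z. norm (aug (fst z)) \<partial>P)"

lemma A_nonneg: "0 \<le> A"
  unfolding A_def by simp

lemma integrable_aug_bound:
  fixes f :: "_ \<Rightarrow> 'b::{banach, second_countable_topology}"
  assumes "f \<in> borel_measurable P" "\<And>z. norm (f z) \<le> c * norm (aug (fst z))"
  shows "integrable P f"
  by (rule Bochner_Integration.integrable_bound[OF integrable_mult_right[OF integrable_aug, of c]])
     (use assms in \<open>auto intro!: AE_I2 order_trans[OF assms(2)]\<close>)

lemma norm_integral_aug_bound:
  fixes f :: "_ \<Rightarrow> 'b::{banach, second_countable_topology}"
  assumes "f \<in> borel_measurable P" "\<And>z. norm (f z) \<le> c * norm (aug (fst z))"
  shows "norm (\<integral>z. f z \<partial>P) \<le> c * A"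
proof -
  have "norm (\<integral>z. f z \<partial>P) \<le> (\<integral>z. norm (f z) \<partial>P)" by (rule integral_norm_bound)
  also have "\<dots> \<le> (\<integral>z. c * norm (aug (fst z)) \<partial>P)"
    by (intro integral_mono integrable_norm integrable_aug_bound[OF assms] integrable_mult_right integrable_aug assms)
  finally show ?thesis by (simp add: A_def)
qed

text \<open>The distance of two half-space indicators in the weighted space \<open>L^1\<close> of
  the Lipschitz condition, written as an integral over \<open>P\<close> and for vectors of any
  length.\<close>

definition flip :: "(real ^ 'n) \<times> real \<Rightarrow> (real ^ 'n) \<times> real \<Rightarrow> real" where
  "flip u u' = (\<integral>z. norm (aug (fst z)) * \<bar>relu' (u \<bullet> aug (fst z)) - relu' (u' \<bullet> aug (fst z))\<bar> \<partial>P)"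

lemma abs_relu'_diff_le: "\<bar>relu' a - relu' b\<bar> \<le> 1"
  by (auto simp: relu'_def)

lemma integrable_flip:
  "integrable P (\<lambda>z. norm (aug (fst z)) * \<bar>relu' (u \<bullet> aug (fst z)) - relu' (u' \<bullet> aug (fst z))\<bar>)"
  by (rule integrable_aug_bound[where c = 1])
     (auto simp: abs_mult intro!: mult_left_le abs_relu'_diff_le)

lemma flip_nonneg: "0 \<le> flip u u'"
  unfolding flip_def by (intro Bochner_Integration.integral_nonneg) auto

lemma flip_le_A: "flip u u' \<le> A"
  unfolding flip_def A_def
  by (intro integral_mono integrable_flip integrable_aug) (auto intro!: mult_left_le abs_relu'_diff_le)

lemma flip_sphere: "u \<in> sphere 0 1 \<Longrightarrow> u' \<in> sphere 0 1 \<Longrightarrow> flip u u' \<le> L * dist u u'"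
proof -
  assume u: "u \<in> sphere 0 1" "u' \<in> sphere 0 1"
  let ?I = "\<lambda>u x. indicator {x. fst u \<bullet> x + snd u > 0} x :: real"
  have I: "?I u x = relu' (u \<bullet> aug x)" for u x
    by (cases u) (auto simp: relu'_def aug_def indicator_def)
  have m1[measurable]: "(\<lambda>x. aug x) \<in> borel_measurable borel"
    unfolding aug_def by (intro borel_measurable_continuous_onI continuous_intros)
  have sm: "sets (marginal P) = sets borel" by (simp add: marginal_def)
  have meas: "(\<lambda>x. \<bar>relu' (u \<bullet> aug x) - relu' (u' \<bullet> aug x)\<bar>) \<in> borel_measurable borel"
    by measurable
  have "(\<integral>x. \<bar>?I u x - ?I u' x\<bar> \<partial>density (marginal P) (\<lambda>x. ennreal (sqrt (1 + (norm x)\<^sup>2))))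
     = (\<integral>x. sqrt (1 + (norm x)\<^sup>2) *\<^sub>R \<bar>?I u x - ?I u' x\<bar> \<partial>marginal P)"
    unfolding I
    by (rule integral_density) (auto simp: measurable_cong_sets[OF sm refl] intro!: meas)
  also have "\<dots> = flip u u'"
    unfolding marginal_def I flip_def norm_aug
    by (subst integral_distr) auto
  finally show ?thesis using indicator_lipschitz[OF u] by simp
qed

lemma flip_scaleR: "c > 0 \<Longrightarrow> c' > 0 \<Longrightarrow> flip (c *\<^sub>R u) (c' *\<^sub>R u') = flip u u'"
  by (simp add: flip_def relu'_def zero_less_mult_iff)

text \<open>\<open>2 * L\<close> comes from normalising two nonzero vectors; \<open>A\<close> covers
  a vanishing second vector, which has no direction.\<close>

definition K0 :: real where "K0 = 2 * L + A"

lemma K0_nonneg: "0 \<le> K0"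
  using L_nonneg A_nonneg by (simp add: K0_def)

text \<open>Half-spaces depend on directions only, so the condition on the sphere can be used after
  normalising. Passing to unit vectors may magnify distances by up to \<open>2 / norm u\<close>, and
  the factor \<open>norm u\<close> on the left absorbs this.\<close>

lemma flip_bound: "norm u * flip u u' \<le> K0 * norm (u - u')"
proof -
  consider "u = 0" | "u' = 0" | "u \<noteq> 0" "u' \<noteq> 0" by blast
  then show ?thesis
  proof cases
    case 1
    then show ?thesis using K0_nonneg by simp
  next
    case 2
    have "norm u * flip u u' \<le> norm u * K0"
      using flip_le_A[of u u'] L_nonneg by (intro mult_left_mono) (auto simp: K0_def)
    then show ?thesis using 2 by (simp add: mult.commute)
  next
    case 3
    let ?v = "u /\<^sub>R norm u" and ?v' = "u' /\<^sub>R norm u'"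
    have "flip u u' = flip ?v ?v'" using 3 by (subst flip_scaleR) auto
    also have "\<dots> \<le> L * dist ?v ?v'" using 3 by (intro flip_sphere) auto
    finally have "norm u * flip u u' \<le> norm u * (L * dist ?v ?v')" by (rule mult_left_mono) simp
    also have "\<dots> = L * norm (norm u *\<^sub>R (?v - ?v'))" by (simp add: dist_norm)
    \<comment> \<open>After multiplication by \<open>norm u\<close>, the first direction is
      \<open>u\<close> itself, and the second differs from \<open>u'\<close> only by the difference
      of the lengths, which is again at most \<open>norm (u - u')\<close>.\<close>
    also have "norm u *\<^sub>R (?v - ?v') = (u - u') + (norm u' - norm u) *\<^sub>R ?v'"
      using 3 by (simp add: algebra_simps)
    also have "norm \<dots> \<le> norm (u - u') + \<bar>norm u' - norm u\<bar>"
      using norm_triangle_ineq[of "u - u'" "(norm u' - norm u) *\<^sub>R ?v'"] 3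
      by (simp add: abs_mult mult.assoc)
    also have "\<dots> \<le> 2 * norm (u - u')"
      using norm_triangle_ineq3[of u' u] by (simp add: norm_minus_commute)
    finally have "norm u * flip u u' \<le> L * (2 * norm (u - u'))"
      using L_nonneg by (simp add: mult_left_mono)
    also have "\<dots> \<le> K0 * norm (u - u')" using A_nonneg by (simp add: K0_def algebra_simps)
    finally show ?thesis .
  qed
qed

text \<open>Abstracts the derivative of the loss along a network. Bounds proved for every admissible
  weight depend on \<open>C\<close> alone and are therefore uniform over all measures and all
  times.\<close>

definition admissible :: "((real ^ 'n) \<times> real \<Rightarrow> real) \<Rightarrow> bool" where
  "admissible h \<longleftrightarrow> h \<in> borel_measurable P \<and> (\<forall>z. \<bar>h z\<bar> \<le> C)"

text \<open>For \<open>h = dloss \<rho>\<close> this is the variation of the risk at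
  \<open>\<rho>\<close>, and \<open>glin h\<close> is its gradient.\<close>

definition lin :: "((real ^ 'n) \<times> real \<Rightarrow> real) \<Rightarrow> 'n param \<Rightarrow> real" where
  "lin h \<theta> = (\<integral>z. h z * phi \<theta> (fst z) \<partial>P)"

definition glin :: "((real ^ 'n) \<times> real \<Rightarrow> real) \<Rightarrow> 'n param \<Rightarrow> 'n param" where
  "glin h \<theta> = (\<integral>z. h z *\<^sub>R grad_phi \<theta> (fst z) \<partial>P)"

section \<open>Growth, Lipschitz and expansion bounds for the variation\<close>

lemma admissibleD: "admissible h \<Longrightarrow> h \<in> borel_measurable P" "admissible h \<Longrightarrow> \<bar>h z\<bar> \<le> C"
  unfolding admissible_def by blast+

lemma lin_pointwise_bound:
  assumes "admissible h"
  shows "\<bar>h z * phi \<theta> (fst z)\<bar> \<le> C * (norm \<theta>)\<^sup>2 * norm (aug (fst z))"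
  unfolding abs_mult mult.assoc
  by (intro mult_mono admissibleD[OF assms] abs_phi_le C_nonneg) auto

lemma integrable_lin: "admissible h \<Longrightarrow> integrable P (\<lambda>z. h z * phi \<theta> (fst z))"
  by (rule integrable_aug_bound[where c = "C * (norm \<theta>)\<^sup>2"])
     (use lin_pointwise_bound admissibleD(1)[of h] in auto)

lemma glin_pointwise_bound:
  assumes "admissible h"
  shows "norm (h z *\<^sub>R grad_phi \<theta> (fst z)) \<le> C * (2 * norm \<theta>) * norm (aug (fst z))"
  unfolding norm_scaleR real_norm_def mult.assoc[of C]
  by (intro mult_mono admissibleD[OF assms] norm_grad_phi_le C_nonneg) auto

lemma integrable_glin: "admissible h \<Longrightarrow> integrable P (\<lambda>z. h z *\<^sub>R grad_phi \<theta> (fst z))"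
  by (rule integrable_aug_bound[where c = "C * (2 * norm \<theta>)"])
     (use glin_pointwise_bound admissibleD(1)[of h] in auto)

lemma abs_lin_le: "admissible h \<Longrightarrow> \<bar>lin h \<theta>\<bar> \<le> C * A * (norm \<theta>)\<^sup>2"
  unfolding lin_def
  using norm_integral_aug_bound[of "\<lambda>z. h z * phi \<theta> (fst z)" "C * (norm \<theta>)\<^sup>2"]
    lin_pointwise_bound admissibleD(1)[of h] by (simp add: mult_ac)

lemma norm_glin_le: "admissible h \<Longrightarrow> norm (glin h \<theta>) \<le> 2 * C * A * norm \<theta>"
  unfolding glin_def
  using norm_integral_aug_bound[of "\<lambda>z. h z *\<^sub>R grad_phi \<theta> (fst z)" "C * (2 * norm \<theta>)"]
    glin_pointwise_bound admissibleD(1)[of h] by (simp add: mult_ac)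

lemma abs_lin_diff_le:
  assumes h: "admissible h"
  shows "\<bar>lin h \<theta> - lin h \<theta>'\<bar> \<le> C * A * ((norm \<theta> + norm \<theta>') * norm (\<theta> - \<theta>'))"
proof -
  have "lin h \<theta> - lin h \<theta>' = (\<integral>z. h z * (phi \<theta> (fst z) - phi \<theta>' (fst z)) \<partial>P)"
    unfolding lin_def right_diff_distrib
    by (rule Bochner_Integration.integral_diff[symmetric]; rule integrable_lin[OF h])
  also have "norm \<dots> \<le> (C * ((norm \<theta> + norm \<theta>') * norm (\<theta> - \<theta>'))) * A"
  proof (rule norm_integral_aug_bound)
    show "norm (h z * (phi \<theta> (fst z) - phi \<theta>' (fst z))) \<le> C * ((norm \<theta> + norm \<theta>') * norm (\<theta> - \<theta>')) * norm (aug (fst z))" for z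
      unfolding real_norm_def abs_mult mult.assoc[of C]
      by (intro mult_mono admissibleD[OF h] C_nonneg order_trans[OF abs_phi_diff_le]) auto
  qed (use admissibleD(1)[OF h] in measurable)
  finally show ?thesis by (simp add: mult_ac)
qed

text \<open>\<open>2 * A\<close> stems from the Lipschitz part of the gradient of a neuron,
  \<open>K0\<close> from the jumps of \<open>relu'\<close>.\<close>

definition K1 :: real where "K1 = C * (2 * A + K0)"

lemma K1_nonneg: "0 \<le> K1"
  unfolding K1_def by (intro mult_nonneg_nonneg C_nonneg add_nonneg_nonneg A_nonneg K0_nonneg) auto

text \<open>Here the cone condition meets the Lipschitz condition. Only the base point has to lie in
  \<open>closure Theta\<close>.\<close>

lemma fst_flip_le:
  assumes "\<theta> \<in> closure Theta"
  shows "\<bar>fst \<theta>\<bar> * flip (snd \<theta>) (snd \<theta>') \<le> K0 * norm (\<theta> - \<theta>')"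
proof -
  have "\<bar>fst \<theta>\<bar> * flip (snd \<theta>) (snd \<theta>') \<le> norm (snd \<theta>) * flip (snd \<theta>) (snd \<theta>')"
    by (intro mult_right_mono closure_Theta_le assms flip_nonneg)
  also have "\<dots> \<le> K0 * norm (snd \<theta> - snd \<theta>')" by (rule flip_bound)
  also have "\<dots> \<le> K0 * norm (\<theta> - \<theta>')"
    using norm_snd_le'[of "\<theta> - \<theta>'"] by (intro mult_left_mono K0_nonneg) simp
  finally show ?thesis .
qed

lemma integral_flip_combination:
  "integrable P (\<lambda>z. a * norm (aug (fst z)) + b * (norm (aug (fst z)) * \<bar>relu' (u \<bullet> aug (fst z)) - relu' (u' \<bullet> aug (fst z))\<bar>))"
  "(\<integral>z. a * norm (aug (fst z)) + b * (norm (aug (fst z)) * \<bar>relu' (u \<bullet> aug (fst z)) - relu' (u' \<bullet> aug (fst z))\<bar>) \<partial>P) = a * A + b * flip u u'"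
proof -
  note i = integrable_mult_right[OF integrable_aug, of a] integrable_mult_right[OF integrable_flip[of u u'], of b]
  show "integrable P (\<lambda>z. a * norm (aug (fst z)) + b * (norm (aug (fst z)) * \<bar>relu' (u \<bullet> aug (fst z)) - relu' (u' \<bullet> aug (fst z))\<bar>))"
    by (rule Bochner_Integration.integrable_add[OF i])
  show "(\<integral>z. a * norm (aug (fst z)) + b * (norm (aug (fst z)) * \<bar>relu' (u \<bullet> aug (fst z)) - relu' (u' \<bullet> aug (fst z))\<bar>) \<partial>P) = a * A + b * flip u u'"
    by (subst Bochner_Integration.integral_add[OF i]) (simp add: A_def flip_def)
qed

lemma norm_glin_diff_le:
  assumes h: "admissible h" and \<theta>: "\<theta> \<in> closure Theta"
  shows "norm (glin h \<theta> - glin h \<theta>') \<le> K1 * norm (\<theta> - \<theta>')"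
proof -
  have "glin h \<theta> - glin h \<theta>' = (\<integral>z. h z *\<^sub>R (grad_phi \<theta> (fst z) - grad_phi \<theta>' (fst z)) \<partial>P)"
    unfolding glin_def scaleR_right_diff_distrib
    by (rule Bochner_Integration.integral_diff[symmetric]; rule integrable_glin[OF h])
  also have "norm \<dots> \<le> (\<integral>z. C * (2 * norm (\<theta> - \<theta>')) * norm (aug (fst z)) + (C * \<bar>fst \<theta>\<bar>) *
      (norm (aug (fst z)) * \<bar>relu' (snd \<theta> \<bullet> aug (fst z)) - relu' (snd \<theta>' \<bullet> aug (fst z))\<bar>) \<partial>P)"
  proof (rule order_trans[OF integral_norm_bound integral_mono[OF _ integral_flip_combination(1)]])
    show "integrable P (\<lambda>z. norm (h z *\<^sub>R (grad_phi \<theta> (fst z) - grad_phi \<theta>' (fst z))))"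
      unfolding scaleR_right_diff_distrib
      by (intro integrable_norm Bochner_Integration.integrable_diff integrable_glin h)
    fix z
    have "norm (h z *\<^sub>R (grad_phi \<theta> (fst z) - grad_phi \<theta>' (fst z))) \<le> C * (2 * norm (\<theta> - \<theta>') * norm (aug (fst z))
     + \<bar>fst \<theta>\<bar> * (norm (aug (fst z)) * \<bar>relu' (snd \<theta> \<bullet> aug (fst z)) - relu' (snd \<theta>' \<bullet> aug (fst z))\<bar>))"
      unfolding norm_scaleR real_norm_def
      by (intro mult_mono admissibleD[OF h] C_nonneg norm_grad_phi_diff_le) auto
    then show "norm (h z *\<^sub>R (grad_phi \<theta> (fst z) - grad_phi \<theta>' (fst z))) \<le> C * (2 * norm (\<theta> - \<theta>')) * norm (aug (fst z)) + (C * \<bar>fst \<theta>\<bar>) *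
      (norm (aug (fst z)) * \<bar>relu' (snd \<theta> \<bullet> aug (fst z)) - relu' (snd \<theta>' \<bullet> aug (fst z))\<bar>)"
      by (simp add: algebra_simps)
  qed
  also have "\<dots> = C * (2 * norm (\<theta> - \<theta>')) * A + C * \<bar>fst \<theta>\<bar> * flip (snd \<theta>) (snd \<theta>')"
    by (rule integral_flip_combination(2))
  also have "\<dots> \<le> K1 * norm (\<theta> - \<theta>')"
    using mult_left_mono[OF fst_flip_le[OF \<theta>, of \<theta>'] C_nonneg] by (simp add: K1_def algebra_simps)
  finally show ?thesis .
qed

text \<open>The jump term carries one factor \<open>norm (\<theta>' - \<theta>)\<close> already; its
  integral supplies the second one through \<open>fst_flip_le\<close>. So averaging over the inputs
  restores the quadratic remainder that a single neuron does not have.\<close>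

lemma lin_expansion:
  assumes h: "admissible h" and \<theta>: "\<theta> \<in> closure Theta"
  shows "\<bar>lin h \<theta>' - lin h \<theta> - glin h \<theta> \<bullet> (\<theta>' - \<theta>)\<bar> \<le> K1 * (norm (\<theta>' - \<theta>))\<^sup>2"
proof -
  let ?d = "\<theta>' - \<theta>"
  have e: "lin h \<theta>' - lin h \<theta> - glin h \<theta> \<bullet> ?d
    = (\<integral>z. h z * phi \<theta>' (fst z) - h z * phi \<theta> (fst z) - (h z *\<^sub>R grad_phi \<theta> (fst z)) \<bullet> ?d \<partial>P)"
    unfolding lin_def glin_def
    using integrable_lin[OF h] integrable_glin[OF h] by (simp del: inner_scaleR_left)
  have i: "integrable P (\<lambda>z. h z * phi \<theta>' (fst z) - h z * phi \<theta> (fst z) - (h z *\<^sub>R grad_phi \<theta> (fst z)) \<bullet> ?d)"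
    by (intro Bochner_Integration.integrable_diff integrable_lin h integrable_inner_left integrable_glin)
  have "norm (lin h \<theta>' - lin h \<theta> - glin h \<theta> \<bullet> ?d) \<le> (\<integral>z. C * (norm ?d)\<^sup>2 * norm (aug (fst z)) + (C * norm ?d * \<bar>fst \<theta>\<bar>) *
      (norm (aug (fst z)) * \<bar>relu' (snd \<theta> \<bullet> aug (fst z)) - relu' (snd \<theta>' \<bullet> aug (fst z))\<bar>) \<partial>P)"
    unfolding e
  proof (rule order_trans[OF integral_norm_bound integral_mono[OF integrable_norm[OF i] integral_flip_combination(1)]])
    fix z
    have "h z * phi \<theta>' (fst z) - h z * phi \<theta> (fst z) - (h z *\<^sub>R grad_phi \<theta> (fst z)) \<bullet> ?d
      = h z * (phi \<theta>' (fst z) - phi \<theta> (fst z) - grad_phi \<theta> (fst z) \<bullet> ?d)"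
      by (simp add: algebra_simps)
    also have "norm \<dots> \<le> C * ((norm ?d)\<^sup>2 * norm (aug (fst z))
     + norm ?d * (\<bar>fst \<theta>\<bar> * (norm (aug (fst z)) * \<bar>relu' (snd \<theta> \<bullet> aug (fst z)) - relu' (snd \<theta>' \<bullet> aug (fst z))\<bar>)))"
      unfolding real_norm_def abs_mult
      by (intro mult_mono admissibleD[OF h] C_nonneg phi_expansion) auto
    finally show "norm (h z * phi \<theta>' (fst z) - h z * phi \<theta> (fst z) - (h z *\<^sub>R grad_phi \<theta> (fst z)) \<bullet> ?d) \<le>
       C * (norm ?d)\<^sup>2 * norm (aug (fst z)) + (C * norm ?d * \<bar>fst \<theta>\<bar>) *
      (norm (aug (fst z)) * \<bar>relu' (snd \<theta> \<bullet> aug (fst z)) - relu' (snd \<theta>' \<bullet> aug (fst z))\<bar>)"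
      by (simp add: algebra_simps)
  qed
  also have "\<dots> = C * (norm ?d)\<^sup>2 * A + C * norm ?d * \<bar>fst \<theta>\<bar> * flip (snd \<theta>) (snd \<theta>')"
    by (rule integral_flip_combination(2))
  also have "\<dots> \<le> K1 * (norm ?d)\<^sup>2"
  proof -
    have "C * norm ?d * (\<bar>fst \<theta>\<bar> * flip (snd \<theta>) (snd \<theta>')) \<le> C * norm ?d * (K0 * norm ?d)"
      using fst_flip_le[OF \<theta>, of \<theta>'] C_nonneg by (intro mult_left_mono) (auto simp: norm_minus_commute)
    moreover have "0 \<le> C * A * (norm ?d)\<^sup>2" using C_nonneg A_nonneg by simp
    ultimately show ?thesis by (simp add: K1_def algebra_simps power2_eq_square)
  qed
  finally show ?thesis by simp
qed

lemma euler_lin: "admissible h \<Longrightarrow> \<theta> \<bullet> glin h \<theta> = 2 * lin h \<theta>"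
proof -
  assume h: "admissible h"
  have "\<theta> \<bullet> glin h \<theta> = (\<integral>z. \<theta> \<bullet> (h z *\<^sub>R grad_phi \<theta> (fst z)) \<partial>P)"
    unfolding glin_def using integrable_glin[OF h] by (simp del: inner_scaleR_right)
  also have "\<dots> = (\<integral>z. 2 * (h z * phi \<theta> (fst z)) \<partial>P)"
    by (simp add: euler_phi mult.left_commute)
  finally show ?thesis by (simp add: lin_def)
qed

lemma lin_scaleR: "c \<ge> 0 \<Longrightarrow> lin h (c *\<^sub>R \<theta>) = c\<^sup>2 * lin h \<theta>"
  by (simp add: lin_def phi_scaleR mult.left_commute[of _ "c\<^sup>2"])

lemma glin_scaleR: "c > 0 \<Longrightarrow> glin h (c *\<^sub>R \<theta>) = c *\<^sub>R glin h \<theta>"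
  by (simp add: glin_def grad_phi_scaleR scaleR_left_commute[of _ c] del: scaleR_scaleR)

text \<open>With \<open>p\<close> close to \<open>relu\<close> and \<open>c\<close> a truncation of
  \<open>h\<close>, a smooth substitute for the integral of \<open>h\<close> times
  \<open>relu (u \<bullet> aug x)\<close>.\<close>

definition plin :: "((real ^ 'n) \<times> real \<Rightarrow> real) \<Rightarrow> real poly \<Rightarrow> (real ^ 'n) \<times> real \<Rightarrow> real" where
  "plin c p u = (\<integral>z. c z * poly p (u \<bullet> aug (fst z)) \<partial>P)"

text \<open>\<open>P\<close> has only a first moment, so polynomials of the input are integrated against weights that
  vanish for large inputs.\<close>

definition truncated :: "real \<Rightarrow> ((real ^ 'n) \<times> real \<Rightarrow> real) \<Rightarrow> bool" where
  "truncated r c \<longleftrightarrow> c \<in> borel_measurable P \<and> (\<exists>B. \<forall>z. \<bar>c z\<bar> \<le> B) \<and> (\<forall>z. norm (aug (fst z)) > r \<longrightarrow> c z = 0)"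

lemma truncatedD:
  assumes "truncated r c"
  shows "c \<in> borel_measurable P" "norm (aug (fst z)) > r \<Longrightarrow> c z = 0"
  using assms unfolding truncated_def by blast+

lemma poly_measurable[measurable]: "poly (p :: real poly) \<in> borel_measurable borel"
  by (intro borel_measurable_continuous_onI continuous_intros)

lemma integrable_plin:
  assumes c: "truncated r c" and r: "0 \<le> r"
  shows "integrable P (\<lambda>z. c z * poly p (u \<bullet> aug (fst z)))"
proof -
  have [measurable]: "c \<in> borel_measurable P" using c by (simp add: truncated_def)
  obtain B where B: "\<And>z. \<bar>c z\<bar> \<le> B" using c by (auto simp: truncated_def)
  have "bounded (poly p ` {- (norm u * r)..norm u * r})"
    by (intro compact_imp_bounded compact_continuous_image continuous_intros) auto
  then obtain D where D: "\<forall>w\<in>{- (norm u * r)..norm u * r}. \<bar>poly p w\<bar> \<le> D"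
    unfolding bounded_iff by auto
  have le: "\<bar>c z * poly p (u \<bullet> aug (fst z))\<bar> \<le> B * max D 0" for z
  proof (cases "norm (aug (fst z)) > r")
    case True
    then show ?thesis using truncatedD(2)[OF c True] B[of z] by simp
  next
    case False
    then have "\<bar>u \<bullet> aug (fst z)\<bar> \<le> norm u * r"
      by (intro order_trans[OF abs_inner_aug_le] mult_left_mono) auto
    then have "\<bar>poly p (u \<bullet> aug (fst z))\<bar> \<le> D" using D by (auto simp: abs_le_iff)
    then show ?thesis unfolding abs_mult using B[of z] by (intro mult_mono) auto
  qed
  show ?thesis by (rule P.integrable_const_bound[where B = "B * max D 0"]) (use le in auto)
qed

text \<open>Differentiation in direction \<open>v\<close> multiplies the weight by
  \<open>v \<bullet> aug x\<close>. Truncation keeps this factor bounded, so the class of weights is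
  stable.\<close>

lemma truncated_mult_inner:
  assumes "truncated r c" and r: "0 \<le> r"
  shows "truncated r (\<lambda>z. c z * (v \<bullet> aug (fst z)))"
proof -
  have [measurable]: "c \<in> borel_measurable P" using assms by (simp add: truncated_def)
  obtain B where B: "\<And>z. \<bar>c z\<bar> \<le> B" using assms by (auto simp: truncated_def)
  have "\<bar>c z * (v \<bullet> aug (fst z))\<bar> \<le> B * (norm v * r)" for z
  proof (cases "norm (aug (fst z)) > r")
    case True
    then show ?thesis using truncatedD(2)[OF assms(1) True] B[of z] r by simp
  next
    case False
    then have "\<bar>v \<bullet> aug (fst z)\<bar> \<le> norm v * r"
      by (intro order_trans[OF abs_inner_aug_le] mult_left_mono) auto
    then show ?thesis unfolding abs_mult using B[of z] by (intro mult_mono) auto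
  qed
  then have "\<exists>B. \<forall>z. \<bar>c z * (v \<bullet> aug (fst z))\<bar> \<le> B" by blast
  moreover have "(\<lambda>z. c z * (v \<bullet> aug (fst z))) \<in> borel_measurable P" by measurable
  ultimately show ?thesis unfolding truncated_def using truncatedD(2)[OF assms(1)] by auto
qed

lemma integrable_plin_gradient:
  assumes c: "truncated r c" and r: "0 \<le> r"
  shows "integrable P (\<lambda>z. (c z * poly p (u \<bullet> aug (fst z))) *\<^sub>R aug (fst z))"
proof -
  have [measurable]: "c \<in> borel_measurable P" using c by (simp add: truncated_def)
  show ?thesis
  proof (rule Bochner_Integration.integrable_bound[OF integrable_mult_right[OF integrable_norm[OF integrable_plin[OF c r, of p u]], of r]])
    show "AE z in P. norm ((c z * poly p (u \<bullet> aug (fst z))) *\<^sub>R aug (fst z)) \<le> norm (r * norm (c z * poly p (u \<bullet> aug (fst z))))"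
    proof (rule AE_I2)
      fix z
      show "norm ((c z * poly p (u \<bullet> aug (fst z))) *\<^sub>R aug (fst z)) \<le> norm (r * norm (c z * poly p (u \<bullet> aug (fst z))))"
      proof (cases "norm (aug (fst z)) > r")
        case True
        then show ?thesis using truncatedD(2)[OF c True] by simp
      next
        case False
        then show ?thesis using r by (auto simp: abs_mult mult.commute intro!: mult_right_mono)
      qed
    qed
  qed measurable
qed

lemma plin_derivative:
  assumes c: "truncated r c" and r: "0 \<le> r"
  shows "(plin c p has_derivative (\<lambda>v. (\<integral>z. (c z * poly (pderiv p) (u \<bullet> aug (fst z))) *\<^sub>R aug (fst z) \<partial>P) \<bullet> v)) (at u)"
proof -
  let ?W = "\<integral>z. (c z * poly (pderiv p) (u \<bullet> aug (fst z))) *\<^sub>R aug (fst z) \<partial>P"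
  obtain B where B: "\<And>z. \<bar>c z\<bar> \<le> B" using c by (auto simp: truncated_def)
  have B0: "0 \<le> B" using B[of undefined] by linarith
  \<comment> \<open>For \<open>v\<close> at distance less than 1 from \<open>u\<close>, and inputs
    that survive the truncation, both arguments of \<open>p\<close> have modulus at most
    \<open>(norm u + 1) * r\<close>.\<close>
  obtain D where D: "D \<ge> 0" "\<And>w w'. \<bar>w\<bar> \<le> (norm u + 1) * r \<Longrightarrow> \<bar>w'\<bar> \<le> (norm u + 1) * r \<Longrightarrow>
     \<bar>poly p w' - poly p w - poly (pderiv p) w * (w' - w)\<bar> \<le> D * (w' - w)\<^sup>2"
    using poly_taylor_bound[of "(norm u + 1) * r" p] by blast
  have *: "norm (plin c p v - plin c p u - ?W \<bullet> (v - u)) / norm (v - u) \<le> B * D * r\<^sup>2 * norm (v - u)"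
    if v: "v \<noteq> u" "dist v u < 1" for v
  proof -
    let ?f = "\<lambda>z. c z * poly p (v \<bullet> aug (fst z)) - c z * poly p (u \<bullet> aug (fst z)) - ((c z * poly (pderiv p) (u \<bullet> aug (fst z))) *\<^sub>R aug (fst z)) \<bullet> (v - u)"
    have e: "plin c p v - plin c p u - ?W \<bullet> (v - u) = (\<integral>z. ?f z \<partial>P)"
      unfolding plin_def using integrable_plin[OF c r] integrable_plin_gradient[OF c r] by (simp del: inner_scaleR_left)
    have i: "integrable P ?f"
      by (intro Bochner_Integration.integrable_diff integrable_inner_left integrable_plin[OF c r] integrable_plin_gradient[OF c r])
    have "norm (\<integral>z. ?f z \<partial>P) \<le> (\<integral>z. B * (D * (r * norm (v - u))\<^sup>2) \<partial>P)"
    proof (rule order_trans[OF integral_norm_bound integral_mono[OF integrable_norm[OF i]]])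
      fix z
      show "norm (?f z) \<le> B * (D * (r * norm (v - u))\<^sup>2)"
      proof (cases "norm (aug (fst z)) > r")
        case True
        then show ?thesis using truncatedD(2)[OF c True] B0 D(1) by simp
      next
        case False
        have nv: "norm v \<le> norm u + 1"
          using v(2) norm_triangle_ineq2[of v u] by (simp add: dist_norm)
        have "\<bar>u \<bullet> aug (fst z)\<bar> \<le> (norm u + 1) * r" "\<bar>v \<bullet> aug (fst z)\<bar> \<le> (norm u + 1) * r"
          using False nv by (auto intro!: order_trans[OF abs_inner_aug_le] mult_mono)
        from D(2)[OF this] have d: "\<bar>poly p (v \<bullet> aug (fst z)) - poly p (u \<bullet> aug (fst z)) - poly (pderiv p) (u \<bullet> aug (fst z)) * ((v - u) \<bullet> aug (fst z))\<bar>
            \<le> D * ((v - u) \<bullet> aug (fst z))\<^sup>2" by (simp add: inner_diff_left)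
        have "\<bar>(v - u) \<bullet> aug (fst z)\<bar> \<le> r * norm (v - u)"
          using False by (intro order_trans[OF abs_inner_aug_le], subst mult.commute[of r], intro mult_left_mono) auto
        then have "((v - u) \<bullet> aug (fst z))\<^sup>2 \<le> (r * norm (v - u))\<^sup>2"
          using r by (simp add: abs_le_square_iff[symmetric])
        then have d': "D * ((v - u) \<bullet> aug (fst z))\<^sup>2 \<le> D * (r * norm (v - u))\<^sup>2"
          using D(1) by (rule mult_left_mono)
        have "?f z = c z * (poly p (v \<bullet> aug (fst z)) - poly p (u \<bullet> aug (fst z)) - poly (pderiv p) (u \<bullet> aug (fst z)) * ((v - u) \<bullet> aug (fst z)))"
          by (simp add: algebra_simps inner_commute[of "aug (fst z)"])
        also have "norm \<dots> \<le> B * (D * (r * norm (v - u))\<^sup>2)"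
          unfolding real_norm_def abs_mult using B0 d d' by (intro mult_mono B) auto
        finally show ?thesis .
      qed
    qed simp
    also have "\<dots> = B * D * r\<^sup>2 * norm (v - u) * norm (v - u)"
      by (simp add: P.prob_space power2_eq_square mult_ac)
    finally show ?thesis unfolding e using v(1) by (simp add: divide_le_eq)
  qed
  show ?thesis
  proof (rule has_derivativeI_sandwich[where e = 1 and H = "\<lambda>v. B * D * r\<^sup>2 * norm (v - u)"])
    show "bounded_linear ((\<bullet>) ?W)" by (rule bounded_linear_inner_right)
    have "((\<lambda>v. B * D * r\<^sup>2 * norm (v - u)) \<longlongrightarrow> B * D * r\<^sup>2 * norm (u - u)) (at u)"
      by (intro tendsto_intros)
    then show "((\<lambda>v. B * D * r\<^sup>2 * norm (v - u)) \<longlongrightarrow> 0) (at u)" by simp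
  qed (use * in auto)
qed

text \<open>A directional derivative is again of the form \<open>plin\<close>, with a new weight and
  the derived polynomial. This drives the induction for smoothness.\<close>

lemma plin_derivative_direction:
  assumes c: "truncated r c" and r: "0 \<le> r"
  shows "(\<integral>z. (c z * poly (pderiv p) (u \<bullet> aug (fst z))) *\<^sub>R aug (fst z) \<partial>P) \<bullet> v
     = plin (\<lambda>z. c z * (v \<bullet> aug (fst z))) (pderiv p) u"
  unfolding plin_def
  by (subst integral_inner_left[symmetric])
     (auto simp: inner_commute mult_ac intro!: integrable_plin_gradient[OF c r] Bochner_Integration.integral_cong)

lemma Ck_plin: "truncated r c \<Longrightarrow> 0 \<le> r \<Longrightarrow> Ck k (\<lambda>\<theta> :: 'n param. plin c p (snd \<theta>))"
proof (induction k arbitrary: c p)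
  case 0
  have "continuous_on UNIV (plin c p)"
    using has_derivative_continuous[OF plin_derivative[OF 0(1,2)]] continuous_at_imp_continuous_on by blast
  then have "continuous_on UNIV (\<lambda>\<theta> :: 'n param. plin c p (snd \<theta>))"
    by (rule continuous_on_compose2) (auto intro: continuous_intros)
  then show ?case by simp
next
  case (Suc k)
  show ?case
  proof (rule Ck_SucI)
    fix \<theta> :: "'n param"
    show "((\<lambda>\<theta>. plin c p (snd \<theta>)) has_derivative
       (\<lambda>v. plin (\<lambda>z. c z * (snd v \<bullet> aug (fst z))) (pderiv p) (snd \<theta>))) (at \<theta>)"
      using has_derivative_compose[OF has_derivative_snd[OF has_derivative_ident] plin_derivative[OF Suc.prems, of p "snd \<theta>"]]
      unfolding plin_derivative_direction[OF Suc.prems] by simp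
  next
    fix v :: "'n param"
    show "Ck k (\<lambda>\<theta> :: 'n param. plin (\<lambda>z. c z * (snd v \<bullet> aug (fst z))) (pderiv p) (snd \<theta>))"
      by (rule Suc.IH[OF truncated_mult_inner[OF Suc.prems] Suc.prems(2)])
  qed
qed

end

subsection \<open>Networks given by measures\<close>

lemma P2_measurable:
  assumes "\<rho> \<in> P2" "f \<in> borel_measurable borel"
  shows "f \<in> borel_measurable \<rho>"
proof -
  have "f \<in> borel_measurable (restrict_space borel (closure Theta))"
    using assms(2) by (rule measurable_restrict_space1)
  then show ?thesis using assms(1) measurable_cong_sets[OF _ refl] by (auto simp: P2_def)
qed

lemma P2_measurable_continuous_on:
  fixes f :: "('n::finite) param \<Rightarrow> 'b::topological_space"
  assumes "\<rho> \<in> P2" "continuous_on (closure Theta) f"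
  shows "f \<in> borel_measurable \<rho>"
  using borel_measurable_continuous_on_restrict[OF assms(2)] assms(1) measurable_cong_sets[OF _ refl]
  by (auto simp: P2_def)

lemma P2_space: "\<rho> \<in> P2 \<Longrightarrow> space \<rho> = closure Theta"
  using sets_eq_imp_space_eq[of \<rho> "restrict_space borel (closure Theta)"]
  by (auto simp: P2_def space_restrict_space)

lemma P2_prob: "\<rho> \<in> P2 \<Longrightarrow> prob_space \<rho>"
  by (simp add: P2_def)

lemma P2_integrable_square: "\<rho> \<in> P2 \<Longrightarrow> integrable \<rho> (\<lambda>\<theta>. (norm \<theta>)\<^sup>2)"
  by (simp add: P2_def)

definition moment :: "('n::finite) param measure \<Rightarrow> real" where
  "moment \<rho> = (\<integral>\<theta>. (norm \<theta>)\<^sup>2 \<partial>\<rho>)"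

lemma moment_nonneg: "0 \<le> moment \<rho>"
  unfolding moment_def by simp

lemma P2_integrable_bound:
  fixes f :: "('n::finite) param \<Rightarrow> 'b::{banach, second_countable_topology}"
  assumes \<rho>: "\<rho> \<in> P2" and "f \<in> borel_measurable \<rho>"
    and "\<And>\<theta>. \<theta> \<in> closure Theta \<Longrightarrow> norm (f \<theta>) \<le> c * (norm \<theta>)\<^sup>2 + d"
  shows "integrable \<rho> f"
proof -
  interpret prob_space \<rho> using \<rho> by (rule P2_prob)
  have "integrable \<rho> (\<lambda>\<theta>. c * (norm \<theta>)\<^sup>2 + d)"
    using P2_integrable_square[OF \<rho>] by simp
  then show ?thesis
  proof (rule Bochner_Integration.integrable_bound[OF _ assms(2)], intro AE_I2)
    fix \<theta> assume "\<theta> \<in> space \<rho>"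
    then have "norm (f \<theta>) \<le> c * (norm \<theta>)\<^sup>2 + d" using assms(3) P2_space[OF \<rho>] by simp
    then show "norm (f \<theta>) \<le> norm (c * (norm \<theta>)\<^sup>2 + d)" by simp
  qed
qed

lemma P2_norm_integral_bound:
  fixes f :: "('n::finite) param \<Rightarrow> 'b::{banach, second_countable_topology}"
  assumes \<rho>: "\<rho> \<in> P2" and "f \<in> borel_measurable \<rho>"
    and "\<And>\<theta>. \<theta> \<in> closure Theta \<Longrightarrow> norm (f \<theta>) \<le> c * (norm \<theta>)\<^sup>2"
  shows "norm (\<integral>\<theta>. f \<theta> \<partial>\<rho>) \<le> c * moment \<rho>"
proof -
  have i: "integrable \<rho> f" by (rule P2_integrable_bound[OF assms(1,2), of c 0]) (use assms(3) in auto)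
  have "norm (\<integral>\<theta>. f \<theta> \<partial>\<rho>) \<le> (\<integral>\<theta>. norm (f \<theta>) \<partial>\<rho>)" by (rule integral_norm_bound)
  also have "\<dots> \<le> (\<integral>\<theta>. c * (norm \<theta>)\<^sup>2 \<partial>\<rho>)"
    using assms(3) P2_space[OF \<rho>] P2_integrable_square[OF \<rho>]
    by (intro integral_mono integrable_norm i) auto
  finally show ?thesis by (simp add: moment_def)
qed

lemma continuous_phi: "continuous_on S (\<lambda>\<theta>. phi \<theta> x)"
  unfolding phi_aug relu_def by (intro continuous_intros)

lemma P2_phi_measurable: "\<rho> \<in> P2 \<Longrightarrow> (\<lambda>\<theta>. phi \<theta> x) \<in> borel_measurable \<rho>"
  by (intro P2_measurable_continuous_on continuous_phi)

lemma P2_integrable_phi: "\<rho> \<in> P2 \<Longrightarrow> integrable \<rho> (\<lambda>\<theta>. phi \<theta> x)"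
  by (rule P2_integrable_bound[where c = "norm (aug x)" and d = 0])
     (use abs_phi_le[of _ x] in \<open>auto simp: P2_phi_measurable mult.commute\<close>)

lemma abs_net_le: "\<rho> \<in> P2 \<Longrightarrow> \<bar>net \<rho> x\<bar> \<le> moment \<rho> * norm (aug x)"
  unfolding net_def
  using P2_norm_integral_bound[of \<rho> "\<lambda>\<theta>. phi \<theta> x" "norm (aug x)"] abs_phi_le[of _ x]
  by (auto simp: P2_phi_measurable mult.commute)

lemma abs_phi_diff_input_le: "\<bar>phi \<theta> x - phi \<theta> x'\<bar> \<le> (norm \<theta>)\<^sup>2 * norm (x - x')"
proof -
  have "\<bar>snd \<theta> \<bullet> aug x - snd \<theta> \<bullet> aug x'\<bar> \<le> norm \<theta> * norm (x - x')"
  proof -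
    have "\<bar>snd \<theta> \<bullet> (aug x - aug x')\<bar> \<le> norm (snd \<theta>) * norm (aug x - aug x')"
      by (rule Cauchy_Schwarz_ineq2)
    also have "norm (aug x - aug x') = norm (x - x')" by (simp add: aug_def norm_Pair)
    also have "norm (snd \<theta>) * norm (x - x') \<le> norm \<theta> * norm (x - x')"
      by (intro mult_right_mono norm_snd_le') simp
    finally show ?thesis by (simp add: inner_diff_right)
  qed
  then have "\<bar>fst \<theta>\<bar> * \<bar>relu (snd \<theta> \<bullet> aug x) - relu (snd \<theta> \<bullet> aug x')\<bar> \<le> norm \<theta> * (norm \<theta> * norm (x - x'))"
    by (intro mult_mono abs_fst_le order_trans[OF relu_lipschitz]) auto
  then show ?thesis by (simp add: phi_aug power2_eq_square mult_ac flip: right_diff_distrib abs_mult)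
qed

lemma continuous_net:
  assumes \<rho>: "\<rho> \<in> P2"
  shows "continuous_on UNIV (net \<rho>)"
proof -
  have "\<bar>net \<rho> x - net \<rho> x'\<bar> \<le> moment \<rho> * norm (x - x')" for x x'
  proof -
    have "net \<rho> x - net \<rho> x' = (\<integral>\<theta>. phi \<theta> x - phi \<theta> x' \<partial>\<rho>)"
      unfolding net_def by (rule Bochner_Integration.integral_diff[symmetric]; rule P2_integrable_phi[OF \<rho>])
    also have "norm \<dots> \<le> norm (x - x') * moment \<rho>"
      by (rule P2_norm_integral_bound[OF \<rho>])
         (use abs_phi_diff_input_le[of _ x x'] P2_phi_measurable[OF \<rho>] in \<open>auto simp: mult.commute\<close>)
    finally show ?thesis by (simp add: mult.commute)
  qed
  then have "(moment \<rho>)-lipschitz_on UNIV (net \<rho>)"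
    by (intro lipschitz_onI) (auto simp: dist_norm moment_nonneg)
  then show ?thesis by (rule lipschitz_on_continuous_on)
qed

context risk_setting
begin

text \<open>Replace \<open>relu\<close> by polynomials whose derivatives approximate \<open>ramp (1 / (n + 1))\<close>. These ramps
  converge to \<open>relu'\<close> at every point, 0 included, so the hyperplanes \<open>u \<bullet> aug x = 0\<close> need no
  separate treatment.\<close>

lemma lin_test_approximation:
  assumes h: "admissible h"
  obtains \<eta> :: "nat \<Rightarrow> 'n param \<Rightarrow> real" and B where "0 \<le> B" "\<And>n. \<eta> n \<in> test_functions"
    "\<And>n \<theta>. norm (gradient (\<eta> n) \<theta>) \<le> B * norm \<theta>"
    "\<And>\<theta>. (\<lambda>n. gradient (\<eta> n) \<theta>) \<longlonglongrightarrow> glin h \<theta>"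
proof -
  \<comment> \<open>For \<open>norm u \<le> real (Suc n)\<close> and
    \<open>norm (aug x) \<le> real (n + 2)\<close> the inner product stays within
    \<open>R n\<close>, where \<open>p n\<close> is controlled.\<close>
  define R where "R n = real (Suc n) * real (n + 2)" for n
  have R0: "0 \<le> R n" and Rn: "real n \<le> R n" for n
    by (auto simp: R_def algebra_simps)
  have "\<exists>p :: real poly. (\<forall>z. \<bar>z\<bar> \<le> R n \<longrightarrow> \<bar>poly (pderiv p) z - ramp (1 / real (Suc n)) z\<bar> \<le> 1 / real (Suc n)
     \<and> \<bar>poly (pderiv p) z\<bar> \<le> 2 \<and> \<bar>poly p z\<bar> \<le> 2 * \<bar>z\<bar> \<and> \<bar>poly p z - relu z\<bar> \<le> (3 + \<bar>z\<bar>) * (1 / real (Suc n)))" for n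
  proof (rule relu_polynomial_approximation[of "1 / real (Suc n)" "R n"])
    fix q :: "real poly"
    assume "\<And>z. \<bar>z\<bar> \<le> R n \<Longrightarrow> \<bar>poly (pderiv q) z - ramp (1 / real (Suc n)) z\<bar> \<le> 1 / real (Suc n)"
      "\<And>z. \<bar>z\<bar> \<le> R n \<Longrightarrow> \<bar>poly (pderiv q) z\<bar> \<le> 2" "\<And>z. \<bar>z\<bar> \<le> R n \<Longrightarrow> \<bar>poly q z\<bar> \<le> 2 * \<bar>z\<bar>"
      "\<And>z. \<bar>z\<bar> \<le> R n \<Longrightarrow> \<bar>poly q z - relu z\<bar> \<le> (3 + \<bar>z\<bar>) * (1 / real (Suc n))"
    then show ?thesis by (intro exI[of _ q] allI impI conjI)
  qed (use R0 in auto)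
  then have "\<exists>p :: nat \<Rightarrow> real poly. \<forall>n z. \<bar>z\<bar> \<le> R n \<longrightarrow> \<bar>poly (pderiv (p n)) z - ramp (1 / real (Suc n)) z\<bar> \<le> 1 / real (Suc n)
     \<and> \<bar>poly (pderiv (p n)) z\<bar> \<le> 2 \<and> \<bar>poly (p n) z\<bar> \<le> 2 * \<bar>z\<bar> \<and> \<bar>poly (p n) z - relu z\<bar> \<le> (3 + \<bar>z\<bar>) * (1 / real (Suc n))"
    by (intro choice allI)
  then obtain p :: "nat \<Rightarrow> real poly" where
    p: "\<And>n z. \<bar>z\<bar> \<le> R n \<Longrightarrow> \<bar>poly (pderiv (p n)) z - ramp (1 / real (Suc n)) z\<bar> \<le> 1 / real (Suc n)"
      "\<And>n z. \<bar>z\<bar> \<le> R n \<Longrightarrow> \<bar>poly (pderiv (p n)) z\<bar> \<le> 2"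
      "\<And>n z. \<bar>z\<bar> \<le> R n \<Longrightarrow> \<bar>poly (p n) z\<bar> \<le> 2 * \<bar>z\<bar>"
      "\<And>n z. \<bar>z\<bar> \<le> R n \<Longrightarrow> \<bar>poly (p n) z - relu z\<bar> \<le> (3 + \<bar>z\<bar>) * (1 / real (Suc n))"
    by blast
  have evR: "\<forall>\<^sub>F n in sequentially. \<bar>w\<bar> \<le> R n" for w
  proof (rule eventually_sequentiallyI[of "nat \<lceil>\<bar>w\<bar>\<rceil>"])
    fix n assume "nat \<lceil>\<bar>w\<bar>\<rceil> \<le> n"
    then have "\<bar>w\<bar> \<le> real n" by linarith
    then show "\<bar>w\<bar> \<le> R n" using Rn[of n] by linarith
  qed
  have inv0: "(\<lambda>n. c * (1 / real (Suc n))) \<longlonglongrightarrow> 0" for c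
    using tendsto_mult[OF tendsto_const[of c] LIMSEQ_inverse_real_of_nat] by (simp add: inverse_eq_divide)
  have lim_p: "(\<lambda>n. poly (p n) w) \<longlonglongrightarrow> relu w" for w
  proof -
    have "\<forall>\<^sub>F n in sequentially. norm (poly (p n) w - relu w) \<le> (3 + \<bar>w\<bar>) * (1 / real (Suc n))"
      using evR[of w] by eventually_elim (simp only: real_norm_def p(4))
    from Lim_null_comparison[OF this inv0] show ?thesis by (rule LIM_zero_cancel)
  qed
  have lim_p': "(\<lambda>n. poly (pderiv (p n)) w) \<longlonglongrightarrow> relu' w" for w
  proof -
    have "\<forall>\<^sub>F n in sequentially. norm (poly (pderiv (p n)) w - relu' w) \<le> 1 * (1 / real (Suc n))"
      using evR[of w] ramp_eventually[of w] 
    proof eventually_elim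
      case (elim n)
      then show ?case using p(1)[OF elim(1)] by (simp only: mult_1 real_norm_def)
    qed
    from Lim_null_comparison[OF this inv0] show ?thesis by (rule LIM_zero_cancel)
  qed
  define c where "c n z = (if norm (aug (fst z)) \<le> real (n + 2) then h z else 0)" for n and z :: "(real ^ 'n) \<times> real"
  have [measurable]: "h \<in> borel_measurable P" using admissibleD(1)[OF h] .
  have cm[measurable]: "c n \<in> borel_measurable P" for n unfolding c_def[abs_def] by measurable
  have cC: "\<bar>c n z\<bar> \<le> C" for n z using admissibleD(2)[OF h, of z] C_nonneg by (simp add: c_def)
  have tr: "truncated (real (n + 2)) (c n)" for n
    unfolding truncated_def
  proof (intro conjI cm)
    show "\<exists>B. \<forall>z. \<bar>c n z\<bar> \<le> B" using cC[of n] by blast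
  qed (auto simp: c_def[of n])
  have lim_c: "(\<lambda>n. c n z) \<longlonglongrightarrow> h z" for z
  proof (rule tendsto_eventually, rule eventually_sequentiallyI[of "nat \<lceil>norm (aug (fst z))\<rceil>"])
    fix n assume "nat \<lceil>norm (aug (fst z))\<rceil> \<le> n"
    then have "norm (aug (fst z)) \<le> real (n + 2)" by linarith
    then show "c n z = h z" by (simp add: c_def)
  qed
  define W where "W n u = (\<integral>z. (c n z * poly (pderiv (p n)) (u \<bullet> aug (fst z))) *\<^sub>R aug (fst z) \<partial>P)" for n u
  \<comment> \<open>Either the weight vanishes or the argument lies where the polynomial is
    controlled; its wild growth elsewhere is never seen.\<close>
  have cz: "c n z = 0 \<or> \<bar>u \<bullet> aug (fst z)\<bar> \<le> R n" if "norm u \<le> real (Suc n)" for n z u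
  proof (cases "norm (aug (fst z)) \<le> real (n + 2)")
    case True
    then have "\<bar>u \<bullet> aug (fst z)\<bar> \<le> R n" unfolding R_def
      using that by (intro order_trans[OF abs_inner_aug_le] mult_mono) auto
    then show ?thesis ..
  qed (simp add: c_def)
  have b1: "norm (c n z * poly (p n) (u \<bullet> aug (fst z))) \<le> (2 * C * norm u) * norm (aug (fst z))"
    if "norm u \<le> real (Suc n)" for n z u
    using cz[OF that, of z]
  proof
    assume "c n z = 0" then show ?thesis using C_nonneg by simp
  next
    assume "\<bar>u \<bullet> aug (fst z)\<bar> \<le> R n"
    then have "\<bar>poly (p n) (u \<bullet> aug (fst z))\<bar> \<le> 2 * (norm u * norm (aug (fst z)))"
      using p(3)[of "u \<bullet> aug (fst z)" n] abs_inner_aug_le[of u "fst z"] by linarith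
    then have "\<bar>c n z\<bar> * \<bar>poly (p n) (u \<bullet> aug (fst z))\<bar> \<le> C * (2 * (norm u * norm (aug (fst z))))"
      by (intro mult_mono cC C_nonneg) auto
    then show ?thesis by (simp add: abs_mult mult_ac)
  qed
  have b2: "norm ((c n z * poly (pderiv (p n)) (u \<bullet> aug (fst z))) *\<^sub>R aug (fst z)) \<le> (2 * C) * norm (aug (fst z))"
    if "norm u \<le> real (Suc n)" for n z u
    using cz[OF that, of z]
  proof
    assume "c n z = 0" then show ?thesis using C_nonneg by simp
  next
    assume "\<bar>u \<bullet> aug (fst z)\<bar> \<le> R n"
    then have "\<bar>c n z\<bar> * \<bar>poly (pderiv (p n)) (u \<bullet> aug (fst z))\<bar> \<le> C * 2"
      by (intro mult_mono cC C_nonneg p) auto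
    from mult_right_mono[OF this norm_ge_zero[of "aug (fst z)"]]
    show ?thesis by (simp add: abs_mult mult_ac)
  qed
  have nW: "norm (W n u) \<le> 2 * C * A" if "norm u \<le> real (Suc n)" for n u
    unfolding W_def by (rule norm_integral_aug_bound) (use b2[OF that] in auto)
  have nplin: "\<bar>plin (c n) (p n) u\<bar> \<le> 2 * C * norm u * A" if "norm u \<le> real (Suc n)" for n u
    unfolding plin_def real_norm_def[symmetric]
    by (rule norm_integral_aug_bound) (use b1[OF that] in auto)
  define F where "F n \<theta> = fst \<theta> * plin (c n) (p n) (snd \<theta>)" for n and \<theta> :: "'n param"
  define Fg where "Fg n \<theta> = (plin (c n) (p n) (snd \<theta>), fst \<theta> *\<^sub>R W n (snd \<theta>))" for n and \<theta> :: "'n param"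
  have lim1: "(\<lambda>n. plin (c n) (p n) u) \<longlonglongrightarrow> (\<integral>z. h z * relu (u \<bullet> aug (fst z)) \<partial>P)" for u
  proof -
    \<comment> \<open>The bounds need \<open>norm u \<le> real (Suc n)\<close>, so domination starts
      after a shift by \<open>N\<close>.\<close>
    obtain N where N: "norm u \<le> real N" using real_arch_simple by blast
    have "(\<lambda>n. plin (c (n + N)) (p (n + N)) u) \<longlonglongrightarrow> (\<integral>z. h z * relu (u \<bullet> aug (fst z)) \<partial>P)"
      unfolding plin_def
    proof (rule integral_dominated_convergence[where w = "\<lambda>z. (2 * C * norm u) * norm (aug (fst z))"])
      show "AE z in P. (\<lambda>n. c (n + N) z * poly (p (n + N)) (u \<bullet> aug (fst z))) \<longlonglongrightarrow> h z * relu (u \<bullet> aug (fst z))"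
        by (intro AE_I2 tendsto_mult LIMSEQ_ignore_initial_segment lim_c lim_p)
      show "AE z in P. norm (c (n + N) z * poly (p (n + N)) (u \<bullet> aug (fst z))) \<le> 2 * C * norm u * norm (aug (fst z))" for n
        by (intro AE_I2 b1) (use N in auto)
    qed (auto intro: integrable_aug)
    then show ?thesis by (rule LIMSEQ_offset)
  qed
  have lim2: "(\<lambda>n. W n u) \<longlonglongrightarrow> (\<integral>z. (h z * relu' (u \<bullet> aug (fst z))) *\<^sub>R aug (fst z) \<partial>P)" for u
  proof -
    obtain N where N: "norm u \<le> real N" using real_arch_simple by blast
    have "(\<lambda>n. W (n + N) u) \<longlonglongrightarrow> (\<integral>z. (h z * relu' (u \<bullet> aug (fst z))) *\<^sub>R aug (fst z) \<partial>P)"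
      unfolding W_def
    proof (rule integral_dominated_convergence[where w = "\<lambda>z. (2 * C) * norm (aug (fst z))"])
      show "AE z in P. (\<lambda>n. (c (n + N) z * poly (pderiv (p (n + N))) (u \<bullet> aug (fst z))) *\<^sub>R aug (fst z)) \<longlonglongrightarrow> (h z * relu' (u \<bullet> aug (fst z))) *\<^sub>R aug (fst z)"
        by (intro AE_I2 tendsto_mult tendsto_scaleR tendsto_const LIMSEQ_ignore_initial_segment lim_c lim_p')
      show "AE z in P. norm ((c (n + N) z * poly (pderiv (p (n + N))) (u \<bullet> aug (fst z))) *\<^sub>R aug (fst z)) \<le> 2 * C * norm (aug (fst z))" for n
        by (intro AE_I2 b2) (use N in auto)
    qed (auto intro: integrable_aug)
    then show ?thesis by (rule LIMSEQ_offset)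
  qed
  have glin_eq: "glin h \<theta> = ((\<integral>z. h z * relu (snd \<theta> \<bullet> aug (fst z)) \<partial>P),
      fst \<theta> *\<^sub>R (\<integral>z. (h z * relu' (snd \<theta> \<bullet> aug (fst z))) *\<^sub>R aug (fst z) \<partial>P))" for \<theta>
  proof (rule prod_eqI)
    show "fst (glin h \<theta>) = fst ((\<integral>z. h z * relu (snd \<theta> \<bullet> aug (fst z)) \<partial>P),
      fst \<theta> *\<^sub>R (\<integral>z. (h z * relu' (snd \<theta> \<bullet> aug (fst z))) *\<^sub>R aug (fst z) \<partial>P))"
      unfolding glin_def integral_bounded_linear[OF bounded_linear_fst integrable_glin[OF h], symmetric]
      by (simp add: grad_phi_aug)
    show "snd (glin h \<theta>) = snd ((\<integral>z. h z * relu (snd \<theta> \<bullet> aug (fst z)) \<partial>P),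
      fst \<theta> *\<^sub>R (\<integral>z. (h z * relu' (snd \<theta> \<bullet> aug (fst z))) *\<^sub>R aug (fst z) \<partial>P))"
      unfolding glin_def integral_bounded_linear[OF bounded_linear_snd integrable_glin[OF h], symmetric]
      by (simp add: grad_phi_aug mult.left_commute flip: integral_scaleR_right)
  qed
  show thesis
  \<comment> \<open>The constant has one \<open>2 * C * A\<close> from each component of
    \<open>Fg\<close>; each 2 is a growth constant of the polynomials, for \<open>p n\<close> and
    for its derivative.\<close>
  proof (rule cutoff_approximation[of F Fg "4 * C * A" UNIV "glin h"])
    show "Ck k (F n)" for n k
      unfolding F_def by (intro Ck_mult Ck_bounded_linear bounded_linear_fst Ck_plin[OF tr]) simp
    show "(F n has_derivative (\<lambda>h. Fg n \<theta> \<bullet> h)) (at \<theta>)" for n \<theta>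
    proof -
      have d: "((\<lambda>\<theta>. plin (c n) (p n) (snd \<theta>)) has_derivative (\<lambda>v. W n (snd \<theta>) \<bullet> snd v)) (at \<theta>)"
        using has_derivative_compose[OF has_derivative_snd[OF has_derivative_ident] plin_derivative[OF tr[of n], of "p n" "snd \<theta>"]]
        unfolding W_def by simp
      show ?thesis unfolding F_def
        by (rule has_derivative_eq_rhs[OF has_derivative_mult[OF has_derivative_fst[OF has_derivative_ident] d]])
           (auto simp: Fg_def fun_eq_iff algebra_simps)
    qed
    fix n \<theta>
    assume \<theta>: "norm (\<theta> :: 'n param) \<le> real (Suc n)"
    then have u: "norm (snd \<theta>) \<le> real (Suc n)" using norm_snd_le'[of \<theta>] by linarith
    have CA: "0 \<le> C * A" by (simp add: C_nonneg A_nonneg)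
    have pl: "\<bar>plin (c n) (p n) (snd \<theta>)\<bar> \<le> 2 * (C * A) * norm \<theta>"
      using nplin[OF u] mult_left_mono[OF norm_snd_le'[of \<theta>] CA] by (simp add: mult_ac)
    have "\<bar>F n \<theta>\<bar> \<le> norm \<theta> * (2 * (C * A) * norm \<theta>)"
      unfolding F_def abs_mult by (intro mult_mono pl abs_fst_le) auto
    also have "\<dots> \<le> 4 * C * A * (norm \<theta>)\<^sup>2"
      using mult_right_mono[OF CA, of "(norm \<theta>)\<^sup>2"] by (simp add: power2_eq_square mult_ac)
    finally show "\<bar>F n \<theta>\<bar> \<le> 4 * C * A * (norm \<theta>)\<^sup>2" .
    have "norm (Fg n \<theta>) \<le> \<bar>plin (c n) (p n) (snd \<theta>)\<bar> + \<bar>fst \<theta>\<bar> * norm (W n (snd \<theta>))"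
      unfolding Fg_def by (rule order_trans[OF norm_Pair_le]) simp
    also have "\<dots> \<le> 2 * (C * A) * norm \<theta> + norm \<theta> * (2 * C * A)"
      by (intro add_mono pl mult_mono abs_fst_le nW u) auto
    finally show "norm (Fg n \<theta>) \<le> 4 * C * A * norm \<theta>" by (simp add: algebra_simps)
  next
    show "(\<lambda>n. Fg n \<theta>) \<longlonglongrightarrow> glin h \<theta>" for \<theta>
      unfolding Fg_def glin_eq by (intro tendsto_intros lim1 lim2)
    show "0 \<le> 4 * C * A" by (simp add: C_nonneg A_nonneg)
    fix \<eta> assume "\<And>n. \<eta> n \<in> test_functions" "\<And>n x. norm (gradient (\<eta> n) x) \<le> 4 * C * A * (1 + 4 * exp 1) * norm x"
     "\<And>x. x \<in> UNIV \<Longrightarrow> (\<lambda>n. gradient (\<eta> n) x) \<longlonglongrightarrow> glin h x"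
    then show thesis by (intro that[of "4 * C * A * (1 + 4 * exp 1)" \<eta>]) (auto simp: C_nonneg A_nonneg)
  qed
qed

section \<open>The risk and its variations as linear functionals\<close>

lemma l_nonneg: "0 \<le> l y z"
  using loss by (simp add: loss_assms_def)

lemma l_deriv: "((\<lambda>u. l u z) has_real_derivative d1 l y z) (at y)"
  using loss unfolding loss_assms_def d1_def by (metis field_differentiable_derivI)

lemma l_lipschitz: "\<bar>l u z - l u' z\<bar> \<le> C * \<bar>u - u'\<bar>"
  using field_differentiable_bound[of UNIV "\<lambda>u. l u z" "\<lambda>u. d1 l u z" C u u'] l_deriv abs_d1_le by auto

lemma l_tangent: "l u' z - l u z \<ge> d1 l u z * (u' - u)"
proof (rule convex_on_imp_above_tangent[where A = UNIV])
  show "convex_on UNIV (\<lambda>u. l u z)" using loss by (simp add: loss_assms_def)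
qed (use l_deriv in auto)

lemma l_measurable[measurable]: "(\<lambda>z. l (fst z) (snd z)) \<in> borel_measurable borel"
  using loss by (intro borel_measurable_continuous_onI) (auto simp: loss_assms_def split_beta)

lemma l_measurable2[measurable (raw)]:
  "f \<in> borel_measurable M \<Longrightarrow> g \<in> borel_measurable M \<Longrightarrow> (\<lambda>w. l (f w) (g w)) \<in> borel_measurable M"
  using measurable_compose[OF borel_measurable_Pair l_measurable, of f M g] by simp

text \<open>Continuity of the derivative is given in the first argument only. Joint measurability
  comes from difference quotients of the jointly continuous loss.\<close>

lemma d1_measurable2[measurable (raw)]:
  assumes [measurable]: "f \<in> borel_measurable M" "g \<in> borel_measurable M"
  shows "(\<lambda>w. d1 l (f w) (g w)) \<in> borel_measurable M"
proof (rule borel_measurable_LIMSEQ_real)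
  fix w
  have "((\<lambda>h. (l (f w + h) (g w) - l (f w) (g w)) / h) \<longlongrightarrow> d1 l (f w) (g w)) (at 0)"
    using l_deriv[of "g w" "f w"] by (simp add: DERIV_def)
  moreover have "filterlim (\<lambda>n. inverse (real (Suc n))) (at 0) sequentially"
    by (auto simp: filterlim_at LIMSEQ_inverse_real_of_nat simp del: of_nat_Suc)
  ultimately show "(\<lambda>n. (l (f w + inverse (real (Suc n))) (g w) - l (f w) (g w)) / inverse (real (Suc n))) \<longlonglongrightarrow> d1 l (f w) (g w)"
    by (rule filterlim_compose)
qed measurable

lemma net_measurable: "\<rho> \<in> P2 \<Longrightarrow> (\<lambda>z. net \<rho> (fst z)) \<in> borel_measurable P"
  by (intro continuous_measurable_P continuous_on_compose2[OF continuous_net]) (auto intro: continuous_intros)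

definition dloss :: "'n param measure \<Rightarrow> (real ^ 'n) \<times> real \<Rightarrow> real" where
  "dloss \<rho> z = d1 l (net \<rho> (fst z)) (snd z)"

lemma admissible_dloss: "\<rho> \<in> P2 \<Longrightarrow> admissible (dloss \<rho>)"
  unfolding admissible_def dloss_def[abs_def]
  using net_measurable[of \<rho>] abs_d1_le by (intro conjI d1_measurable2) auto

lemma risk_var_lin: "risk_var l P \<rho> = lin (dloss \<rho>)"
  by (rule ext) (simp only: risk_var_def lin_def dloss_def case_prod_unfold)

lemma grad_risk_var_glin: "grad_risk_var l P \<rho> = glin (dloss \<rho>)"
  by (rule ext) (simp only: grad_risk_var_def glin_def dloss_def case_prod_unfold)

lemma integrable_loss:
  assumes f[measurable]: "f \<in> borel_measurable P" and i: "integrable P f"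
  shows "integrable P (\<lambda>z. l (f z) (snd z))"
proof (rule Bochner_Integration.integrable_bound)
  show "integrable P (\<lambda>z. l 0 (snd z) + C * \<bar>f z\<bar>)"
    using integrable_l0 i by (intro Bochner_Integration.integrable_add integrable_mult_right) (simp_all add: case_prod_unfold)
  show "AE z in P. norm (l (f z) (snd z)) \<le> norm (l 0 (snd z) + C * \<bar>f z\<bar>)"
  proof (rule AE_I2)
    fix z
    show "norm (l (f z) (snd z)) \<le> norm (l 0 (snd z) + C * \<bar>f z\<bar>)"
    proof -
      have "0 \<le> C * \<bar>f z\<bar>" using C_nonneg by simp
      moreover have "\<bar>l (f z) (snd z) - l 0 (snd z)\<bar> \<le> C * \<bar>f z\<bar>"
        using l_lipschitz[of "f z" "snd z" 0] by simp
      ultimately show ?thesis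
        using l_nonneg[of "f z" "snd z"] l_nonneg[of 0 "snd z"] unfolding real_norm_def by linarith
    qed
  qed
qed measurable

lemma integrable_net: "\<rho> \<in> P2 \<Longrightarrow> integrable P (\<lambda>z. net \<rho> (fst z))"
  by (rule integrable_aug_bound[where c = "moment \<rho>"]) (auto simp: net_measurable abs_net_le)

lemma integrable_loss_net: "\<rho> \<in> P2 \<Longrightarrow> integrable P (\<lambda>z. l (net \<rho> (fst z)) (snd z))"
  by (intro integrable_loss net_measurable integrable_net)

lemma risk_eq: "risk l P \<rho> = (\<integral>z. l (net \<rho> (fst z)) (snd z) \<partial>P)"
  by (simp only: risk_def case_prod_unfold)

lemma continuous_lin: "admissible h \<Longrightarrow> continuous_on UNIV (lin h)"
proof -
  assume h: "admissible h"
  have "isCont (lin h) \<theta>" for \<theta>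
  proof -
    have "((\<lambda>\<theta>'. C * A * ((norm \<theta>' + norm \<theta>) * norm (\<theta>' - \<theta>))) \<longlongrightarrow> C * A * ((norm \<theta> + norm \<theta>) * norm (\<theta> - \<theta>))) (at \<theta>)"
      by (intro tendsto_intros)
    then have 1: "((\<lambda>\<theta>'. C * A * ((norm \<theta>' + norm \<theta>) * norm (\<theta>' - \<theta>))) \<longlongrightarrow> 0) (at \<theta>)"
      by simp
    have "\<forall>\<^sub>F \<theta>' in at \<theta>. norm (lin h \<theta>' - lin h \<theta>) \<le> C * A * ((norm \<theta>' + norm \<theta>) * norm (\<theta>' - \<theta>))"
      unfolding real_norm_def by (intro always_eventually allI abs_lin_diff_le[OF h])
    from Lim_null_comparison[OF this 1] have "((\<lambda>\<theta>'. lin h \<theta>' - lin h \<theta>) \<longlongrightarrow> 0) (at \<theta>)" .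
    then show ?thesis unfolding isCont_def by (rule LIM_zero_cancel)
  qed
  then show ?thesis by (simp add: continuous_at_imp_continuous_on)
qed

lemma P2_lin_measurable: "\<rho> \<in> P2 \<Longrightarrow> admissible h \<Longrightarrow> lin h \<in> borel_measurable \<rho>"
  by (rule P2_measurable_continuous_on, assumption, rule continuous_on_subset[OF continuous_lin]) auto

lemma P2_integrable_lin: "\<rho> \<in> P2 \<Longrightarrow> admissible h \<Longrightarrow> integrable \<rho> (lin h)"
  by (rule P2_integrable_bound[where c = "C * A" and d = 0])
     (auto simp: P2_lin_measurable abs_lin_le)

lemma continuous_glin: "admissible h \<Longrightarrow> continuous_on (closure Theta) (glin h)"
proof -
  assume h: "admissible h"
  have "K1-lipschitz_on (closure Theta) (glin h)"
    by (intro lipschitz_onI K1_nonneg) (simp only: dist_norm norm_glin_diff_le[OF h])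
  then show ?thesis by (rule lipschitz_on_continuous_on)
qed

lemma P2_glin_measurable: "\<rho> \<in> P2 \<Longrightarrow> admissible h \<Longrightarrow> glin h \<in> borel_measurable \<rho>"
  by (intro P2_measurable_continuous_on continuous_glin)

text \<open>Turns a derivative in the space of predictions into an integral of the variation over
  parameters; this holds because the prediction is linear in the measure.\<close>

lemma fubini_lin:
  assumes \<rho>: "\<rho> \<in> P2" and h: "admissible h"
  shows "(\<integral>z. h z * net \<rho> (fst z) \<partial>P) = (\<integral>\<theta>. lin h \<theta> \<partial>\<rho>)"
proof -
  interpret \<rho>: prob_space \<rho> using \<rho> by (rule P2_prob)
  interpret pair_sigma_finite P \<rho> ..
  have [measurable]: "h \<in> borel_measurable P" using admissibleD(1)[OF h] .
  have [measurable]: "fst \<in> borel_measurable \<rho>" "snd \<in> borel_measurable \<rho>"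
    by (auto intro!: P2_measurable_continuous_on[OF \<rho>] continuous_intros)
  let ?f = "\<lambda>(z, \<theta>). h z * phi \<theta> (fst z)"
  have m: "?f \<in> borel_measurable (P \<Otimes>\<^sub>M \<rho>)"
    unfolding phi_aug split_beta by measurable
  have i: "integrable (P \<Otimes>\<^sub>M \<rho>) ?f"
  proof (rule Fubini_integrable[OF m])
    have "(\<lambda>z. \<integral>\<theta>. norm (?f (z, \<theta>)) \<partial>\<rho>) \<in> borel_measurable P"
      using m by (intro \<rho>.borel_measurable_lebesgue_integral) (simp add: split_beta)
    moreover have "norm (\<integral>\<theta>. norm (?f (z, \<theta>)) \<partial>\<rho>) \<le> (C * moment \<rho>) * norm (aug (fst z))" for z
    proof -
      have "norm (\<integral>\<theta>. norm (?f (z, \<theta>)) \<partial>\<rho>) \<le> (C * norm (aug (fst z))) * moment \<rho>"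
      proof (rule P2_norm_integral_bound[OF \<rho>])
        show "(\<lambda>\<theta>. norm (?f (z, \<theta>))) \<in> borel_measurable \<rho>"
          using P2_phi_measurable[OF \<rho>, of "fst z"] by simp
        show "norm (norm (?f (z, \<theta>))) \<le> C * norm (aug (fst z)) * (norm \<theta>)\<^sup>2" for \<theta>
          using lin_pointwise_bound[OF h, of z \<theta>] by (simp add: mult_ac)
      qed
      then show ?thesis by (simp add: mult_ac)
    qed
    ultimately show "integrable P (\<lambda>z. \<integral>\<theta>. norm (?f (z, \<theta>)) \<partial>\<rho>)"
      by (rule integrable_aug_bound)
    show "AE z in P. integrable \<rho> (\<lambda>\<theta>. ?f (z, \<theta>))"
      using P2_integrable_phi[OF \<rho>] by simp
  qed
  have "(\<integral>\<theta>. lin h \<theta> \<partial>\<rho>) = (\<integral>z. \<integral>\<theta>. h z * phi \<theta> (fst z) \<partial>\<rho> \<partial>P)"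
    unfolding lin_def using Fubini_integral[OF i] by simp
  also have "\<dots> = (\<integral>z. h z * net \<rho> (fst z) \<partial>P)" by (simp add: net_def)
  finally show ?thesis ..
qed

text \<open>The tangent inequality of the loss at the prediction of \<open>\<rho>\<close>,
  integrated. The variation is frozen at the first measure, so exchanging the two measures gives the
  matching lower bound.\<close>

lemma risk_diff_le:
  assumes \<rho>: "\<rho> \<in> P2" and \<mu>: "\<mu> \<in> P2"
  shows "risk l P \<rho> - risk l P \<mu> \<le> (\<integral>\<theta>. lin (dloss \<rho>) \<theta> \<partial>\<rho>) - (\<integral>\<theta>. lin (dloss \<rho>) \<theta> \<partial>\<mu>)"
proof -
  note h = admissible_dloss[OF \<rho>]
  have i: "integrable P (\<lambda>z. dloss \<rho> z * net \<nu> (fst z))" if \<nu>: "\<nu> \<in> P2" for \<nu>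
  proof (rule integrable_aug_bound[where c = "C * moment \<nu>"])
    show "norm (dloss \<rho> z * net \<nu> (fst z)) \<le> C * moment \<nu> * norm (aug (fst z))" for z
      unfolding real_norm_def abs_mult mult.assoc
      by (intro mult_mono admissibleD[OF h] abs_net_le \<nu> C_nonneg) auto
  qed (use admissibleD(1)[OF h] net_measurable[OF \<nu>] in measurable)
  have "risk l P \<rho> - risk l P \<mu> = (\<integral>z. l (net \<rho> (fst z)) (snd z) - l (net \<mu> (fst z)) (snd z) \<partial>P)"
    unfolding risk_eq using integrable_loss_net \<rho> \<mu> by simp
  also have "\<dots> \<le> (\<integral>z. dloss \<rho> z * net \<rho> (fst z) - dloss \<rho> z * net \<mu> (fst z) \<partial>P)"
  proof (intro integral_mono Bochner_Integration.integrable_diff integrable_loss_net i \<rho> \<mu>)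
    fix z
    show "l (net \<rho> (fst z)) (snd z) - l (net \<mu> (fst z)) (snd z) \<le> dloss \<rho> z * net \<rho> (fst z) - dloss \<rho> z * net \<mu> (fst z)"
      using l_tangent[of "net \<rho> (fst z)" "snd z" "net \<mu> (fst z)"] by (simp add: dloss_def algebra_simps)
  qed
  also have "\<dots> = (\<integral>z. dloss \<rho> z * net \<rho> (fst z) \<partial>P) - (\<integral>z. dloss \<rho> z * net \<mu> (fst z) \<partial>P)"
    using i \<rho> \<mu> by simp
  finally show ?thesis using fubini_lin[OF \<rho> h] fubini_lin[OF \<mu> h] by simp
qed

lemma risk_nonneg: "0 \<le> risk l P \<rho>"
  unfolding risk_eq by (intro Bochner_Integration.integral_nonneg l_nonneg)

lemma INF_risk_le: "\<rho> \<in> P2 \<Longrightarrow> (INF \<rho>\<in>P2. risk l P \<rho>) \<le> risk l P \<rho>"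
  by (rule cINF_lower) (auto intro: bdd_belowI2[of _ 0] risk_nonneg)

end

subsection \<open>Couplings\<close>

text \<open>Cauchy--Schwarz in the form of Young's inequality. The weights \<open>w / e\<close> and
  \<open>e / w\<close> balance the two halves, which is why both bounds must be positive.\<close>

lemma integral_mult_le_sqrt_bounds:
  fixes a b :: "'a \<Rightarrow> real"
  assumes [measurable]: "a \<in> borel_measurable M" "b \<in> borel_measurable M"
    and i: "integrable M (\<lambda>x. (a x)\<^sup>2)" "integrable M (\<lambda>x. (b x)\<^sup>2)"
    and le: "(\<integral>x. (a x)\<^sup>2 \<partial>M) \<le> e\<^sup>2" "(\<integral>x. (b x)\<^sup>2 \<partial>M) \<le> w\<^sup>2" and pos: "0 < e" "0 < w"
  shows "integrable M (\<lambda>x. a x * b x)" "(\<integral>x. a x * b x \<partial>M) \<le> e * w"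
proof -
  have ptw: "\<bar>a x * b x\<bar> \<le> (w / e * (a x)\<^sup>2 + e / w * (b x)\<^sup>2) / 2" for x
  proof -
    have "0 \<le> (w * \<bar>a x\<bar> - e * \<bar>b x\<bar>)\<^sup>2" by simp
    then have "2 * (w * e * (\<bar>a x\<bar> * \<bar>b x\<bar>)) \<le> w\<^sup>2 * (a x)\<^sup>2 + e\<^sup>2 * (b x)\<^sup>2"
      by (simp add: power2_diff power_mult_distrib algebra_simps)
    then show ?thesis using pos by (simp add: abs_mult field_simps power2_eq_square)
  qed
  have ib: "integrable M (\<lambda>x. (w / e * (a x)\<^sup>2 + e / w * (b x)\<^sup>2) / 2)"
    using i by (intro integrable_divide Bochner_Integration.integrable_add integrable_mult_right)
  show int: "integrable M (\<lambda>x. a x * b x)"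
  proof (rule Bochner_Integration.integrable_bound[OF ib])
    show "AE x in M. norm (a x * b x) \<le> norm ((w / e * (a x)\<^sup>2 + e / w * (b x)\<^sup>2) / 2)"
      using ptw by (intro AE_I2) (smt (verit) real_norm_def)
  qed measurable
  have "(\<integral>x. a x * b x \<partial>M) \<le> (\<integral>x. (w / e * (a x)\<^sup>2 + e / w * (b x)\<^sup>2) / 2 \<partial>M)"
    using ptw by (intro integral_mono int ib) (smt (verit))
  also have "\<dots> = (w / e * (\<integral>x. (a x)\<^sup>2 \<partial>M) + e / w * (\<integral>x. (b x)\<^sup>2 \<partial>M)) / 2"
    using i by simp
  also have "\<dots> \<le> (w / e * e\<^sup>2 + e / w * w\<^sup>2) / 2"
    using le pos by (intro divide_right_mono add_mono mult_left_mono) auto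
  also have "\<dots> = e * w" using pos by (simp add: power2_eq_square)
  finally show "(\<integral>x. a x * b x \<partial>M) \<le> e * w" .
qed

lemma P2_norm_bound_integrable:
  fixes f :: "('n::finite) param \<Rightarrow> real"
  assumes "\<rho> \<in> P2" "continuous_on (closure Theta) f" "\<And>\<theta>. \<theta> \<in> closure Theta \<Longrightarrow> \<bar>f \<theta>\<bar> \<le> c * (norm \<theta>)\<^sup>2 + d"
  shows "integrable \<rho> f"
  by (rule P2_integrable_bound[OF assms(1) P2_measurable_continuous_on[OF assms(1,2)]]) (use assms(3) in auto)

lemma square_add_le: "(x + y)\<^sup>2 \<le> 2 * x\<^sup>2 + 2 * y\<^sup>2" for x y :: real
  using zero_le_power2[of "x - y"] by (simp add: power2_eq_square algebra_simps)

context
  fixes \<mu> \<nu> :: "('n::finite) param measure" and \<gamma>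
  assumes \<mu>: "\<mu> \<in> P2" and \<nu>: "\<nu> \<in> P2" and \<gamma>: "\<gamma> \<in> couplings \<mu> \<nu>"
begin

lemma coupling_sets: "sets \<gamma> = sets (\<mu> \<Otimes>\<^sub>M \<nu>)"
  and coupling_distr: "distr \<gamma> \<mu> fst = \<mu>" "distr \<gamma> \<nu> snd = \<nu>"
  using \<gamma> by (auto simp: couplings_def)

lemma coupling_measurable: "fst \<in> \<gamma> \<rightarrow>\<^sub>M \<mu>" "snd \<in> \<gamma> \<rightarrow>\<^sub>M \<nu>"
  using measurable_cong_sets[OF coupling_sets refl] by auto

lemma coupling_space: "space \<gamma> = closure Theta \<times> closure Theta"
  using sets_eq_imp_space_eq[OF coupling_sets] P2_space[OF \<mu>] P2_space[OF \<nu>]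
  by (simp add: space_pair_measure)

lemma coupling_borel_measurable:
  "fst \<in> borel_measurable \<gamma>" "snd \<in> borel_measurable \<gamma>"
  using measurable_compose[OF coupling_measurable(1) P2_measurable[OF \<mu>, of "\<lambda>x. x"]]
    measurable_compose[OF coupling_measurable(2) P2_measurable[OF \<nu>, of "\<lambda>x. x"]]
  by auto

lemma coupling_integral:
  fixes f :: "_ \<Rightarrow> real"
  shows "f \<in> borel_measurable \<mu> \<Longrightarrow> (\<integral>w. f (fst w) \<partial>\<gamma>) = (\<integral>\<theta>. f \<theta> \<partial>\<mu>)"
    and "f \<in> borel_measurable \<nu> \<Longrightarrow> (\<integral>w. f (snd w) \<partial>\<gamma>) = (\<integral>\<theta>. f \<theta> \<partial>\<nu>)"
  using integral_distr[OF coupling_measurable(1), of f] integral_distr[OF coupling_measurable(2), of f]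
  by (simp_all add: coupling_distr)

lemma coupling_integrable:
  fixes f :: "_ \<Rightarrow> real"
  shows "integrable \<mu> f \<Longrightarrow> integrable \<gamma> (\<lambda>w. f (fst w))"
    and "integrable \<nu> f \<Longrightarrow> integrable \<gamma> (\<lambda>w. f (snd w))"
  using integrable_distr[OF coupling_measurable(1), of f] integrable_distr[OF coupling_measurable(2), of f]
  by (simp_all add: coupling_distr)

lemma coupling_square_integrable: "integrable \<gamma> (\<lambda>w. (norm (fst w) + norm (snd w))\<^sup>2)"
  "(\<integral>w. (norm (fst w) + norm (snd w))\<^sup>2 \<partial>\<gamma>) \<le> 2 * moment \<mu> + 2 * moment \<nu>"
proof -
  note [measurable] = coupling_borel_measurable
  note i = coupling_integrable(1)[OF P2_integrable_square[OF \<mu>]] coupling_integrable(2)[OF P2_integrable_square[OF \<nu>]]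
  have ib: "integrable \<gamma> (\<lambda>w. 2 * (norm (fst w))\<^sup>2 + 2 * (norm (snd w))\<^sup>2)"
    using i by simp
  show ii: "integrable \<gamma> (\<lambda>w. (norm (fst w) + norm (snd w))\<^sup>2)"
    by (rule Bochner_Integration.integrable_bound[OF ib]) (auto intro!: AE_I2 square_add_le)
  have "(\<integral>w. (norm (fst w) + norm (snd w))\<^sup>2 \<partial>\<gamma>) \<le> (\<integral>w. 2 * (norm (fst w))\<^sup>2 + 2 * (norm (snd w))\<^sup>2 \<partial>\<gamma>)"
    by (intro integral_mono ii ib square_add_le)
  also have "\<dots> = 2 * moment \<mu> + 2 * moment \<nu>"
    using i coupling_integral(1)[OF P2_measurable[OF \<mu>], of "\<lambda>\<theta>. (norm \<theta>)\<^sup>2"]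
      coupling_integral(2)[OF P2_measurable[OF \<nu>], of "\<lambda>\<theta>. (norm \<theta>)\<^sup>2"]
    by (simp add: moment_def)
  finally show "(\<integral>w. (norm (fst w) + norm (snd w))\<^sup>2 \<partial>\<gamma>) \<le> 2 * moment \<mu> + 2 * moment \<nu>" .
qed

lemma coupling_dist_integrable: "integrable \<gamma> (\<lambda>w. (dist (fst w) (snd w))\<^sup>2)"
proof -
  note [measurable] = coupling_borel_measurable
  show ?thesis
  proof (rule Bochner_Integration.integrable_bound[OF coupling_square_integrable(1)])
    show "AE w in \<gamma>. norm ((dist (fst w) (snd w))\<^sup>2) \<le> norm ((norm (fst w) + norm (snd w))\<^sup>2)"
      by (intro AE_I2) (auto simp: dist_norm intro!: power_mono norm_triangle_ineq4)
  qed measurable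
qed

end

text \<open>A coupling of finite cost. It makes the infimum in \<open>W2\<close> finite; an infinite
  one would be turned into distance 0 by \<open>enn2real\<close>, and an upper bound on
  \<open>W2\<close> would then carry no information.\<close>

lemma pair_measure_coupling:
  assumes \<mu>: "\<mu> \<in> P2" and \<nu>: "\<nu> \<in> P2"
  shows "\<mu> \<Otimes>\<^sub>M \<nu> \<in> couplings \<mu> \<nu>"
proof -
  interpret \<mu>: prob_space \<mu> using \<mu> by (rule P2_prob)
  interpret \<nu>: prob_space \<nu> using \<nu> by (rule P2_prob)
  interpret pair_prob_space \<mu> \<nu> ..
  have "distr (\<mu> \<Otimes>\<^sub>M \<nu>) \<nu> snd = \<nu>"
  proof (rule measure_eqI)
    fix X assume "X \<in> sets (distr (\<mu> \<Otimes>\<^sub>M \<nu>) \<nu> snd)"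
    then have X: "X \<in> sets \<nu>" by simp
    then have "emeasure (distr (\<mu> \<Otimes>\<^sub>M \<nu>) \<nu> snd) X = emeasure (\<mu> \<Otimes>\<^sub>M \<nu>) (space \<mu> \<times> X)"
      using sets.sets_into_space[OF X]
      by (auto simp: emeasure_distr space_pair_measure intro!: arg_cong[where f = "emeasure (\<mu> \<Otimes>\<^sub>M \<nu>)"])
    also have "\<dots> = emeasure \<nu> X" using X by (simp add: \<nu>.emeasure_pair_measure_Times \<mu>.emeasure_space_1)
    finally show "emeasure (distr (\<mu> \<Otimes>\<^sub>M \<nu>) \<nu> snd) X = emeasure \<nu> X" .
  qed simp
  then show ?thesis by (simp add: couplings_def \<nu>.distr_pair_fst)
qed

text \<open>Optimal couplings are avoided: a strict upper bound on the distance already yields a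
  coupling of at most that cost.\<close>

lemma coupling_of_W2_less:
  assumes \<mu>: "\<mu> \<in> P2" and \<nu>: "\<nu> \<in> P2" and w: "W2 \<mu> \<nu> < w"
  obtains \<gamma> where "\<gamma> \<in> couplings \<mu> \<nu>" "(\<integral>w. (dist (fst w) (snd w))\<^sup>2 \<partial>\<gamma>) \<le> w\<^sup>2"
proof -
  define J where "J = (INF \<gamma>\<in>couplings \<mu> \<nu>. \<integral>\<^sup>+(x, y). ennreal ((dist x y)\<^sup>2) \<partial>\<gamma>)"
  have e: "(\<integral>\<^sup>+(x, y). ennreal ((dist x y)\<^sup>2) \<partial>\<gamma>) = ennreal (\<integral>w. (dist (fst w) (snd w))\<^sup>2 \<partial>\<gamma>)"
    if "\<gamma> \<in> couplings \<mu> \<nu>" for \<gamma>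
    unfolding case_prod_unfold
    by (rule nn_integral_eq_integral[OF coupling_dist_integrable[OF \<mu> \<nu> that]]) simp
  have "J \<le> (\<integral>\<^sup>+(x, y). ennreal ((dist x y)\<^sup>2) \<partial>(\<mu> \<Otimes>\<^sub>M \<nu>))"
    unfolding J_def by (rule INF_lower[OF pair_measure_coupling[OF \<mu> \<nu>]])
  then have fin: "J < top"
    using e[OF pair_measure_coupling[OF \<mu> \<nu>]] by (simp add: le_less_trans ennreal_less_top)
  have W: "W2 \<mu> \<nu> = sqrt (enn2real J)" by (simp add: W2_def J_def)
  have w0: "0 \<le> W2 \<mu> \<nu>" by (simp add: W)
  have "(W2 \<mu> \<nu>)\<^sup>2 < w\<^sup>2" using w w0 by (intro power_strict_mono) auto
  then have "enn2real J < w\<^sup>2" by (simp add: W)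
  then have "J < ennreal (w\<^sup>2)"
    using fin by (metis enn2real_nonneg ennreal_enn2real ennreal_less_iff)
  then obtain \<gamma> where g: "\<gamma> \<in> couplings \<mu> \<nu>" "(\<integral>\<^sup>+(x, y). ennreal ((dist x y)\<^sup>2) \<partial>\<gamma>) < ennreal (w\<^sup>2)"
    unfolding J_def INF_less_iff by auto
  then show thesis using e[OF g(1)] by (intro that[OF g(1)]) (simp add: ennreal_less_iff)
qed

text \<open>The expansion is based at the second measure, so \<open>G\<close> has to be small in
  \<open>L^2\<close> of that measure only. Along the flow this is the measure at the fixed right end
  point, while the left one moves.\<close>

lemma integral_diff_le_expansion:
  fixes f :: "('n::finite) param \<Rightarrow> real" and G :: "'n param \<Rightarrow> 'n param"
  assumes \<mu>: "\<mu> \<in> P2" and \<nu>: "\<nu> \<in> P2" and W: "W2 \<mu> \<nu> < w" and w: "0 < w" and e: "0 < e"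
    and f: "integrable \<mu> f" "integrable \<nu> f"
    and G: "G \<in> borel_measurable \<nu>" "integrable \<nu> (\<lambda>\<theta>. (norm (G \<theta>))\<^sup>2)" "(\<integral>\<theta>. (norm (G \<theta>))\<^sup>2 \<partial>\<nu>) \<le> e\<^sup>2"
    and ex: "\<And>\<theta> \<theta>'. \<theta> \<in> closure Theta \<Longrightarrow> \<theta>' \<in> closure Theta \<Longrightarrow>
        \<bar>f \<theta>' - f \<theta> - G \<theta> \<bullet> (\<theta>' - \<theta>)\<bar> \<le> K * (norm (\<theta>' - \<theta>))\<^sup>2" and K: "0 \<le> K"
  shows "\<bar>(\<integral>\<theta>. f \<theta> \<partial>\<nu>) - (\<integral>\<theta>. f \<theta> \<partial>\<mu>)\<bar> \<le> e * w + K * w\<^sup>2"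
proof -
  obtain \<gamma> where \<gamma>: "\<gamma> \<in> couplings \<mu> \<nu>" and c: "(\<integral>w. (dist (fst w) (snd w))\<^sup>2 \<partial>\<gamma>) \<le> w\<^sup>2"
    using coupling_of_W2_less[OF \<mu> \<nu> W] .
  note [measurable] = coupling_borel_measurable[OF \<mu> \<nu> \<gamma>] measurable_compose[OF coupling_measurable(2)[OF \<mu> \<nu> \<gamma>] G(1)]
  note di = coupling_dist_integrable[OF \<mu> \<nu> \<gamma>]
  note fi = coupling_integrable(1)[OF \<mu> \<nu> \<gamma> f(1)] coupling_integrable(2)[OF \<mu> \<nu> \<gamma> f(2)]
  have Gi: "integrable \<gamma> (\<lambda>w. (norm (G (snd w)))\<^sup>2)" by (rule coupling_integrable(2)[OF \<mu> \<nu> \<gamma> G(2)])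
  have Ge: "(\<integral>w. (norm (G (snd w)))\<^sup>2 \<partial>\<gamma>) \<le> e\<^sup>2"
    using G(3) coupling_integral(2)[OF \<mu> \<nu> \<gamma> borel_measurable_integrable[OF G(2)]] by (simp only:)
  have m1: "(\<lambda>w. norm (G (snd w))) \<in> borel_measurable \<gamma>" "(\<lambda>w. dist (fst w) (snd w)) \<in> borel_measurable \<gamma>"
    by measurable
  note cs = integral_mult_le_sqrt_bounds[OF m1 Gi di Ge c e w]
  have "(\<integral>\<theta>. f \<theta> \<partial>\<nu>) - (\<integral>\<theta>. f \<theta> \<partial>\<mu>) = (\<integral>w. f (snd w) - f (fst w) \<partial>\<gamma>)"
    by (simp only: Bochner_Integration.integral_diff[OF fi(2,1)] coupling_integral(1)[OF \<mu> \<nu> \<gamma> borel_measurable_integrable[OF f(1)]]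
        coupling_integral(2)[OF \<mu> \<nu> \<gamma> borel_measurable_integrable[OF f(2)]])
  also have "norm \<dots> \<le> (\<integral>w. norm (f (snd w) - f (fst w)) \<partial>\<gamma>)" by (rule integral_norm_bound)
  also have "\<dots> \<le> (\<integral>w. norm (G (snd w)) * dist (fst w) (snd w) + K * (dist (fst w) (snd w))\<^sup>2 \<partial>\<gamma>)"
  proof (rule integral_mono)
    show "integrable \<gamma> (\<lambda>w. norm (f (snd w) - f (fst w)))"
        by (intro integrable_norm Bochner_Integration.integrable_diff fi)
    show "integrable \<gamma> (\<lambda>w. norm (G (snd w)) * dist (fst w) (snd w) + K * (dist (fst w) (snd w))\<^sup>2)"
      using cs(1) di by simp
    fix w assume "w \<in> space \<gamma>"
    then have s: "fst w \<in> closure Theta" "snd w \<in> closure Theta"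
      unfolding coupling_space[OF \<mu> \<nu> \<gamma>] by (simp_all add: mem_Times_iff)
    have "\<bar>G (snd w) \<bullet> (fst w - snd w)\<bar> \<le> norm (G (snd w)) * norm (fst w - snd w)"
      by (rule Cauchy_Schwarz_ineq2)
    then show "norm (f (snd w) - f (fst w)) \<le> norm (G (snd w)) * dist (fst w) (snd w) + K * (dist (fst w) (snd w))\<^sup>2"
      using ex[OF s(2,1)] by (simp only: dist_norm real_norm_def)
  qed
  also have "\<dots> = (\<integral>w. norm (G (snd w)) * dist (fst w) (snd w) \<partial>\<gamma>) + K * (\<integral>w. (dist (fst w) (snd w))\<^sup>2 \<partial>\<gamma>)"
    using cs(1) di by simp
  also have "\<dots> \<le> e * w + K * w\<^sup>2"
    using cs(2) c K by (intro add_mono mult_left_mono)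
  finally show ?thesis by simp
qed

text \<open>A function of quadratic growth has a Lipschitz constant of linear growth, and
  Cauchy--Schwarz pays for it with second moments: the square of the sum of norms integrates to at
  most \<open>4 * B\<close>. The 1 only keeps the root positive.\<close>

lemma integral_diff_le_W2:
  fixes f :: "('n::finite) param \<Rightarrow> real"
  assumes \<mu>: "\<mu> \<in> P2" and \<nu>: "\<nu> \<in> P2"
    and f: "integrable \<mu> f" "integrable \<nu> f"
    and lip: "\<And>\<theta> \<theta>'. \<bar>f \<theta> - f \<theta>'\<bar> \<le> D * ((norm \<theta> + norm \<theta>') * norm (\<theta> - \<theta>'))" and D: "0 \<le> D"
    and B: "moment \<mu> \<le> B" "moment \<nu> \<le> B"
  shows "\<bar>(\<integral>\<theta>. f \<theta> \<partial>\<nu>) - (\<integral>\<theta>. f \<theta> \<partial>\<mu>)\<bar> \<le> D * (sqrt (4 * B + 1) * W2 \<mu> \<nu>)"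
proof -
  have B0: "0 \<le> B" using B moment_nonneg[of \<mu>] by linarith
  have W0: "0 \<le> W2 \<mu> \<nu>" by (simp add: W2_def)
  have *: "\<bar>(\<integral>\<theta>. f \<theta> \<partial>\<nu>) - (\<integral>\<theta>. f \<theta> \<partial>\<mu>)\<bar> \<le> D * (sqrt (4 * B + 1) * w)" if W: "W2 \<mu> \<nu> < w" for w
  proof -
    obtain \<gamma> where \<gamma>: "\<gamma> \<in> couplings \<mu> \<nu>" and c: "(\<integral>w. (dist (fst w) (snd w))\<^sup>2 \<partial>\<gamma>) \<le> w\<^sup>2"
      using coupling_of_W2_less[OF \<mu> \<nu> W] .
    note [measurable] = coupling_borel_measurable[OF \<mu> \<nu> \<gamma>]
    note di = coupling_dist_integrable[OF \<mu> \<nu> \<gamma>] and si = coupling_square_integrable[OF \<mu> \<nu> \<gamma>]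
    note fi = coupling_integrable(1)[OF \<mu> \<nu> \<gamma> f(1)] coupling_integrable(2)[OF \<mu> \<nu> \<gamma> f(2)]
    have m: "(\<lambda>w. norm (fst w) + norm (snd w)) \<in> borel_measurable \<gamma>" "(\<lambda>w. dist (fst w) (snd w)) \<in> borel_measurable \<gamma>"
      by measurable
    have sB: "(\<integral>w. (norm (fst w) + norm (snd w))\<^sup>2 \<partial>\<gamma>) \<le> (sqrt (4 * B + 1))\<^sup>2"
      using si(2) B B0 by simp
    have e0: "0 < sqrt (4 * B + 1)" using B0 by simp
    have w0: "0 < w" using W W0 by linarith
    note cs = integral_mult_le_sqrt_bounds[OF m si(1) di sB c e0 w0]
    have "(\<integral>\<theta>. f \<theta> \<partial>\<nu>) - (\<integral>\<theta>. f \<theta> \<partial>\<mu>) = (\<integral>w. f (snd w) - f (fst w) \<partial>\<gamma>)"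
      by (simp only: Bochner_Integration.integral_diff[OF fi(2,1)] coupling_integral(1)[OF \<mu> \<nu> \<gamma> borel_measurable_integrable[OF f(1)]]
        coupling_integral(2)[OF \<mu> \<nu> \<gamma> borel_measurable_integrable[OF f(2)]])
    also have "norm \<dots> \<le> (\<integral>w. norm (f (snd w) - f (fst w)) \<partial>\<gamma>)" by (rule integral_norm_bound)
    also have "\<dots> \<le> (\<integral>w. D * ((norm (fst w) + norm (snd w)) * dist (fst w) (snd w)) \<partial>\<gamma>)"
    proof (rule integral_mono)
      show "integrable \<gamma> (\<lambda>w. norm (f (snd w) - f (fst w)))"
        by (intro integrable_norm Bochner_Integration.integrable_diff fi)
      show "integrable \<gamma> (\<lambda>w. D * ((norm (fst w) + norm (snd w)) * dist (fst w) (snd w)))"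
        using cs(1) by simp
      show "norm (f (snd w) - f (fst w)) \<le> D * ((norm (fst w) + norm (snd w)) * dist (fst w) (snd w))" for w
      proof -
        have "D * ((norm (snd w) + norm (fst w)) * norm (snd w - fst w)) = D * ((norm (fst w) + norm (snd w)) * dist (fst w) (snd w))"
          by (metis add.commute dist_commute dist_norm)
        with lip[of "snd w" "fst w"] show ?thesis unfolding real_norm_def by (simp only:)
      qed
    qed
    also have "\<dots> \<le> D * (sqrt (4 * B + 1) * w)"
      using cs(2) D by (simp add: mult_left_mono)
    finally show ?thesis by simp
  qed
  \<comment> \<open>The bound holds for every \<open>w\<close> above the distance; letting
    \<open>w\<close> decrease to it gives the claim.\<close>
  have lim: "((\<lambda>w. D * (sqrt (4 * B + 1) * w)) \<longlongrightarrow> D * (sqrt (4 * B + 1) * W2 \<mu> \<nu>)) (at_right (W2 \<mu> \<nu>))"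
    by (intro tendsto_intros)
  show ?thesis
    by (rule tendsto_lowerbound[OF lim])
       (use * in \<open>auto simp: eventually_at_filter\<close>)
qed

text \<open>Bounds the second moments along the flow on bounded time intervals, so that the
  Lipschitz estimates in \<open>W2\<close> have a constant common to these times.\<close>

lemma moment_le_W2:
  assumes \<mu>: "\<mu> \<in> P2" and \<nu>: "\<nu> \<in> P2" and W: "W2 \<mu> \<nu> < w"
  shows "moment \<nu> \<le> 2 * moment \<mu> + 2 * w\<^sup>2"
proof -
  obtain \<gamma> where \<gamma>: "\<gamma> \<in> couplings \<mu> \<nu>" and c: "(\<integral>w. (dist (fst w) (snd w))\<^sup>2 \<partial>\<gamma>) \<le> w\<^sup>2"
    using coupling_of_W2_less[OF \<mu> \<nu> W] .
  note di = coupling_dist_integrable[OF \<mu> \<nu> \<gamma>]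
  note i = coupling_integrable(1)[OF \<mu> \<nu> \<gamma> P2_integrable_square[OF \<mu>]] coupling_integrable(2)[OF \<mu> \<nu> \<gamma> P2_integrable_square[OF \<nu>]]
  note m = coupling_integral(1)[OF \<mu> \<nu> \<gamma> P2_measurable[OF \<mu>], of "\<lambda>\<theta>. (norm \<theta>)\<^sup>2"]
      coupling_integral(2)[OF \<mu> \<nu> \<gamma> P2_measurable[OF \<nu>], of "\<lambda>\<theta>. (norm \<theta>)\<^sup>2"]
  have "moment \<nu> = (\<integral>w. (norm (snd w))\<^sup>2 \<partial>\<gamma>)" using m(2) by (simp add: moment_def)
  also have "\<dots> \<le> (\<integral>w. 2 * (norm (fst w))\<^sup>2 + 2 * (dist (fst w) (snd w))\<^sup>2 \<partial>\<gamma>)"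
  proof (rule integral_mono[OF i(2)])
    show "integrable \<gamma> (\<lambda>w. 2 * (norm (fst w))\<^sup>2 + 2 * (dist (fst w) (snd w))\<^sup>2)" using i(1) di by simp
    fix w :: "'a param \<times> 'a param"
    have "norm (snd w) \<le> norm (fst w) + dist (fst w) (snd w)"
      using norm_triangle_sub[of "snd w" "fst w"] by (simp add: dist_norm norm_minus_commute)
    then have "(norm (snd w))\<^sup>2 \<le> (norm (fst w) + dist (fst w) (snd w))\<^sup>2" by (intro power_mono) auto
    then show "(norm (snd w))\<^sup>2 \<le> 2 * (norm (fst w))\<^sup>2 + 2 * (dist (fst w) (snd w))\<^sup>2"
      using square_add_le order_trans by blast
  qed
  also have "\<dots> \<le> 2 * moment \<mu> + 2 * w\<^sup>2" using i(1) di c m(1) by (simp add: moment_def)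
  finally show ?thesis .
qed

subsection \<open>The flow\<close>

locale flow_setting = risk_setting l P C L
  for l :: "real \<Rightarrow> real \<Rightarrow> real" and P :: "((real ^ 'n::finite) \<times> real) measure" and C L +
  fixes \<pi> :: "real \<Rightarrow> 'n param measure" and m :: "real \<Rightarrow> real"
  assumes flow_P2: "\<And>t. 0 \<le> t \<Longrightarrow> \<pi> t \<in> P2"
    and m_integrable: "\<And>T. 0 \<le> T \<Longrightarrow> set_integrable lborel {0..T} m"
    and m_nonneg: "\<And>t. 0 \<le> m t"
    and W2_le: "\<And>s t. 0 \<le> s \<Longrightarrow> s \<le> t \<Longrightarrow> W2 (\<pi> s) (\<pi> t) \<le> (LINT r:{s..t}|lborel. m r)"
    and weak_flow: "AE t in lborel. t > 0 \<longrightarrow> (\<forall>\<psi>\<in>test_functions.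
        ((\<lambda>s. \<integral>\<theta>. \<psi> \<theta> \<partial>\<pi> s) has_real_derivative
           - (\<integral>\<theta>. gradient \<psi> \<theta> \<bullet> grad_risk_var l P (\<pi> t) \<theta> \<partial>\<pi> t)) (at t))"
begin

definition M :: "real \<Rightarrow> real \<Rightarrow> real" where
  "M s t = (LINT r:{s..t}|lborel. m r)"

lemma m_integrable': "0 \<le> s \<Longrightarrow> set_integrable lborel {s..t} m"
  by (rule set_integrable_subset[OF m_integrable[of "max t 0"]]) auto

lemma M_nonneg: "0 \<le> M s t"
  unfolding M_def set_lebesgue_integral_def
  by (intro Bochner_Integration.integral_nonneg) (auto simp: m_nonneg)

lemma M_mono: "0 \<le> a \<Longrightarrow> a \<le> s \<Longrightarrow> t \<le> b \<Longrightarrow> M s t \<le> M a b"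
  using m_integrable'[of s t] m_integrable'[of a b]
  unfolding M_def set_lebesgue_integral_def set_integrable_def
  by (intro integral_mono) (auto simp: m_nonneg split: split_indicator)

lemma M_tendsto_0: "0 < t \<Longrightarrow> ((\<lambda>y. M y t) \<longlongrightarrow> 0) (at_left t)"
proof -
  assume t: "0 < t"
  have i: "m integrable_on {0..t}" using set_borel_integral_eq_integral(1)[OF m_integrable[of t]] t by simp
  have e: "M y t = integral {y..t} m" if "y \<in> {0..t}" for y
    unfolding M_def using set_borel_integral_eq_integral(2)[OF m_integrable'[of y t]] that by simp
  have "continuous_on {0..t} (\<lambda>y. M y t)"
    by (rule continuous_on_eq[OF indefinite_integral_continuous_1'[OF i]]) (simp add: e)
  then have "((\<lambda>y. M y t) \<longlongrightarrow> M t t) (at t within {0..t})"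
    using t unfolding continuous_on_def by simp
  then show ?thesis using t e[of t] by (simp add: at_within_Icc_at_left)
qed

lemma moment_bounded:
  assumes "0 \<le> t" "t \<le> b"
  shows "moment (\<pi> t) \<le> 2 * moment (\<pi> 0) + 2 * (M 0 b + 1)\<^sup>2"
proof (rule moment_le_W2[OF flow_P2 flow_P2])
  show "W2 (\<pi> 0) (\<pi> t) < M 0 b + 1"
    using W2_le[of 0 t] M_mono[of 0 0 t b] assms by (simp add: M_def)
qed (use assms in auto)

text \<open>\<open>D'\<close> is chosen before \<open>f\<close> and the times, so one dominating
  function serves the variations frozen at all times. With \<open>1 \<le> D'\<close> it also
  dominates \<open>M\<close> itself, the scale on which the errors are measured.\<close>

lemma integral_increment_le:
  fixes b :: real
  assumes b: "0 \<le> b" and D: "0 \<le> D"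
  obtains D' where "1 \<le> D'" "\<And>f s t. 0 \<le> s \<Longrightarrow> s \<le> t \<Longrightarrow> t \<le> b \<Longrightarrow>
      integrable (\<pi> s) f \<Longrightarrow> integrable (\<pi> t) f \<Longrightarrow>
      (\<And>\<theta> \<theta>'. \<bar>f \<theta> - f \<theta>'\<bar> \<le> D * ((norm \<theta> + norm \<theta>') * norm (\<theta> - \<theta>'))) \<Longrightarrow>
      \<bar>(\<integral>\<theta>. f \<theta> \<partial>\<pi> t) - (\<integral>\<theta>. f \<theta> \<partial>\<pi> s)\<bar> \<le> D' * M s t"
proof -
  define B where "B = 2 * moment (\<pi> 0) + 2 * (M 0 b + 1)\<^sup>2"
  have B0: "0 \<le> B" by (simp add: B_def moment_nonneg)
  show thesis
  proof (rule that[of "1 + D * sqrt (4 * B + 1)"])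
    show "1 \<le> 1 + D * sqrt (4 * B + 1)" using D B0 by simp
    fix f s t
    assume st: "0 \<le> s" "s \<le> t" "t \<le> b" and i: "integrable (\<pi> s) f" "integrable (\<pi> t) f"
      and lip: "\<And>\<theta> \<theta>'. \<bar>f \<theta> - f \<theta>'\<bar> \<le> D * ((norm \<theta> + norm \<theta>') * norm (\<theta> - \<theta>'))"
    have "\<bar>(\<integral>\<theta>. f \<theta> \<partial>\<pi> t) - (\<integral>\<theta>. f \<theta> \<partial>\<pi> s)\<bar> \<le> D * (sqrt (4 * B + 1) * W2 (\<pi> s) (\<pi> t))"
      by (rule integral_diff_le_W2[OF _ _ i lip D])
         (use st moment_bounded[of s b] moment_bounded[of t b] flow_P2 in \<open>auto simp: B_def\<close>)
    also have "\<dots> \<le> D * (sqrt (4 * B + 1) * M s t)"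
      using W2_le[of s t] st D B0 by (intro mult_left_mono) (auto simp: M_def)
    also have "\<dots> \<le> (1 + D * sqrt (4 * B + 1)) * M s t"
      using M_nonneg[of s t] by (simp add: algebra_simps)
    finally show "\<bar>(\<integral>\<theta>. f \<theta> \<partial>\<pi> t) - (\<integral>\<theta>. f \<theta> \<partial>\<pi> s)\<bar> \<le> (1 + D * sqrt (4 * B + 1)) * M s t" .
  qed
qed

text \<open>The function is split as a test function plus a remainder: the weak formulation
  differentiates the former, couplings bound the latter. The order of choices matters:
  \<open>n\<close> is fixed from the measure at time \<open>t\<close> and \<open>\<epsilon>\<close>
  alone, and only then does \<open>y\<close> approach \<open>t\<close>, so the possibly huge
  second-order constant of \<open>\<eta> n\<close> does no harm.\<close>

lemma left_difference_bound:
  fixes \<psi> :: "'n param \<Rightarrow> real" and G :: "'n param \<Rightarrow> 'n param" and \<eta> :: "nat \<Rightarrow> 'n param \<Rightarrow> real"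
  assumes t: "0 < t"
    and weak: "\<And>\<psi>. \<psi> \<in> test_functions \<Longrightarrow> ((\<lambda>s. \<integral>\<theta>. \<psi> \<theta> \<partial>\<pi> s) has_real_derivative
           - (\<integral>\<theta>. gradient \<psi> \<theta> \<bullet> glin (dloss (\<pi> t)) \<theta> \<partial>\<pi> t)) (at t)"
    and \<psi>: "\<And>\<rho>. \<rho> \<in> P2 \<Longrightarrow> integrable \<rho> \<psi>"
    and ex: "\<And>\<theta> \<theta>'. \<theta> \<in> closure Theta \<Longrightarrow> \<theta>' \<in> closure Theta \<Longrightarrow>
        \<bar>\<psi> \<theta>' - \<psi> \<theta> - G \<theta> \<bullet> (\<theta>' - \<theta>)\<bar> \<le> K * (norm (\<theta>' - \<theta>))\<^sup>2" and K: "0 \<le> K"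
    and \<eta>: "\<And>n. \<eta> n \<in> test_functions" "\<And>n \<theta>. norm (gradient (\<eta> n) \<theta>) \<le> B * norm \<theta>"
      "\<And>\<theta>. (\<lambda>n. gradient (\<eta> n) \<theta>) \<longlonglongrightarrow> G \<theta>" and B: "0 \<le> B"
    and e: "0 < \<epsilon>"
  shows "\<forall>\<^sub>F y in at_left t. (\<integral>\<theta>. \<psi> \<theta> \<partial>\<pi> t) - (\<integral>\<theta>. \<psi> \<theta> \<partial>\<pi> y)
      \<le> (t - y) * - (\<integral>\<theta>. G \<theta> \<bullet> glin (dloss (\<pi> t)) \<theta> \<partial>\<pi> t) + \<epsilon> * ((t - y) + M y t)"
proof -
  have \<pi>t: "\<pi> t \<in> P2" using t by (intro flow_P2) simp
  interpret \<pi>t: prob_space "\<pi> t" using \<pi>t by (rule P2_prob)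
  define V where "V = glin (dloss (\<pi> t))"
  note adm = admissible_dloss[OF \<pi>t]
  have mV[measurable]: "V \<in> borel_measurable (\<pi> t)" unfolding V_def by (rule P2_glin_measurable[OF \<pi>t adm])
  have nV: "norm (V \<theta>) \<le> 2 * C * A * norm \<theta>" for \<theta> unfolding V_def by (rule norm_glin_le[OF adm])
  have mg[measurable]: "gradient (\<eta> n) \<in> borel_measurable (\<pi> t)" for n
    by (intro P2_measurable_continuous_on[OF \<pi>t] test_function_continuous \<eta>)
  have mG[measurable]: "G \<in> borel_measurable (\<pi> t)"
    by (rule borel_measurable_LIMSEQ_metric[OF mg \<eta>(3)])
  have nG: "norm (G \<theta>) \<le> B * norm \<theta>" for \<theta>
    by (rule Lim_bounded[OF tendsto_norm[OF \<eta>(3)]]) (use \<eta>(2) in auto)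
  note sq = P2_integrable_square[OF \<pi>t]
  have CA: "0 \<le> 2 * C * A" by (simp add: C_nonneg A_nonneg)
  have nd: "norm (G \<theta> - gradient (\<eta> n) \<theta>) \<le> 2 * B * norm \<theta>" for n \<theta>
    using norm_triangle_ineq4[of "G \<theta>" "gradient (\<eta> n) \<theta>"] nG[of \<theta>] \<eta>(2)[of n \<theta>] by simp
  have nd2: "(norm (G \<theta> - gradient (\<eta> n) \<theta>))\<^sup>2 \<le> 4 * B\<^sup>2 * (norm \<theta>)\<^sup>2" for n \<theta>
    using power_mono[OF nd[of \<theta> n], of 2] by (simp add: power_mult_distrib)
  have id2: "integrable (\<pi> t) (\<lambda>\<theta>. (norm (G \<theta> - gradient (\<eta> n) \<theta>))\<^sup>2)" for n
    by (rule P2_integrable_bound[OF \<pi>t, where c = "4 * B\<^sup>2" and d = 0]) (use nd2 in auto)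
  have lim1: "(\<lambda>n. \<integral>\<theta>. (norm (G \<theta> - gradient (\<eta> n) \<theta>))\<^sup>2 \<partial>\<pi> t) \<longlonglongrightarrow> (\<integral>\<theta>. 0 \<partial>\<pi> t)"
  proof (rule integral_dominated_convergence[where w = "\<lambda>\<theta>. 4 * B\<^sup>2 * (norm \<theta>)\<^sup>2"])
    show "AE \<theta> in \<pi> t. (\<lambda>n. (norm (G \<theta> - gradient (\<eta> n) \<theta>))\<^sup>2) \<longlonglongrightarrow> 0"
    proof (rule AE_I2)
      fix \<theta>
      have "(\<lambda>n. (norm (G \<theta> - gradient (\<eta> n) \<theta>))\<^sup>2) \<longlonglongrightarrow> (norm (G \<theta> - G \<theta>))\<^sup>2"
        by (intro tendsto_intros \<eta>(3))
      then show "(\<lambda>n. (norm (G \<theta> - gradient (\<eta> n) \<theta>))\<^sup>2) \<longlonglongrightarrow> 0" by simp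
    qed
  qed (use sq nd2 in auto)
  have lim2: "(\<lambda>n. \<integral>\<theta>. gradient (\<eta> n) \<theta> \<bullet> V \<theta> \<partial>\<pi> t) \<longlonglongrightarrow> (\<integral>\<theta>. G \<theta> \<bullet> V \<theta> \<partial>\<pi> t)"
  proof (rule integral_dominated_convergence[where w = "\<lambda>\<theta>. B * (2 * C * A) * (norm \<theta>)\<^sup>2"])
    show "AE \<theta> in \<pi> t. (\<lambda>n. gradient (\<eta> n) \<theta> \<bullet> V \<theta>) \<longlonglongrightarrow> G \<theta> \<bullet> V \<theta>"
      by (intro AE_I2 tendsto_intros \<eta>(3))
    show "AE \<theta> in \<pi> t. norm (gradient (\<eta> n) \<theta> \<bullet> V \<theta>) \<le> B * (2 * C * A) * (norm \<theta>)\<^sup>2" for n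
    proof (rule AE_I2)
      fix \<theta>
      have "norm (gradient (\<eta> n) \<theta> \<bullet> V \<theta>) \<le> norm (gradient (\<eta> n) \<theta>) * norm (V \<theta>)"
        unfolding real_norm_def by (rule Cauchy_Schwarz_ineq2)
      also have "\<dots> \<le> (B * norm \<theta>) * (2 * C * A * norm \<theta>)"
        using B by (intro mult_mono \<eta> nV) auto
      finally show "norm (gradient (\<eta> n) \<theta> \<bullet> V \<theta>) \<le> B * (2 * C * A) * (norm \<theta>)\<^sup>2"
        by (simp add: power2_eq_square mult_ac)
    qed
  qed (use sq in auto)
  \<comment> \<open>Four errors are to be added: Cauchy--Schwarz, the quadratic remainder, the
    difference quotient of the test function, and the replacement of its gradient by
    \<open>G\<close>.\<close>
  define e where "e = \<epsilon> / 4"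
  have e0: "0 < e" using e by (simp add: e_def)
  have "\<forall>\<^sub>F n in sequentially. (\<integral>\<theta>. (norm (G \<theta> - gradient (\<eta> n) \<theta>))\<^sup>2 \<partial>\<pi> t) < e\<^sup>2"
    using lim1 e0 by (intro order_tendstoD(2)) auto
  moreover have "\<forall>\<^sub>F n in sequentially. (\<integral>\<theta>. G \<theta> \<bullet> V \<theta> \<partial>\<pi> t) - e < (\<integral>\<theta>. gradient (\<eta> n) \<theta> \<bullet> V \<theta> \<partial>\<pi> t)"
    using lim2 e0 by (intro order_tendstoD(1)) auto
  ultimately have "\<forall>\<^sub>F n in sequentially. (\<integral>\<theta>. (norm (G \<theta> - gradient (\<eta> n) \<theta>))\<^sup>2 \<partial>\<pi> t) < e\<^sup>2 \<and>
      (\<integral>\<theta>. G \<theta> \<bullet> V \<theta> \<partial>\<pi> t) - e < (\<integral>\<theta>. gradient (\<eta> n) \<theta> \<bullet> V \<theta> \<partial>\<pi> t)"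
    by eventually_elim simp
  then obtain n where n1: "(\<integral>\<theta>. (norm (G \<theta> - gradient (\<eta> n) \<theta>))\<^sup>2 \<partial>\<pi> t) \<le> e\<^sup>2"
    and n2: "(\<integral>\<theta>. G \<theta> \<bullet> V \<theta> \<partial>\<pi> t) - e \<le> (\<integral>\<theta>. gradient (\<eta> n) \<theta> \<bullet> V \<theta> \<partial>\<pi> t)"
    using eventually_happens'[OF sequentially_bot] by (metis (no_types, lifting) less_imp_le)
  obtain K' where K': "0 \<le> K'" "\<And>x y. \<bar>\<eta> n y - \<eta> n x - gradient (\<eta> n) x \<bullet> (y - x)\<bar> \<le> K' * (norm (y - x))\<^sup>2"
    using test_function_expansion[OF \<eta>(1)[of n]] by blast
  obtain B\<eta> where B\<eta>: "\<And>x. \<bar>\<eta> n x\<bar> \<le> B\<eta>"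
    using test_function_bounded[OF \<eta>(1)[of n]] by blast
  have i\<eta>: "integrable \<rho> (\<eta> n)" if "\<rho> \<in> P2" for \<rho>
    by (rule P2_norm_bound_integrable[OF that test_function_continuous(1)[OF \<eta>(1)], of n 0 B\<eta>]) (use B\<eta> in auto)
  define \<Psi> where "\<Psi> y = (\<integral>\<theta>. \<eta> n \<theta> \<partial>\<pi> y)" for y
  define D where "D = - (\<integral>\<theta>. gradient (\<eta> n) \<theta> \<bullet> V \<theta> \<partial>\<pi> t)"
  have "(\<Psi> has_real_derivative D) (at t)"
    using weak[OF \<eta>(1)[of n]] by (simp add: \<Psi>_def[abs_def] D_def V_def)
  then have "((\<lambda>y. (\<Psi> y - \<Psi> t) / (y - t)) \<longlongrightarrow> D) (at_left t)"
    unfolding has_field_derivative_iff by (rule filterlim_mono) (auto simp: at_le)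
  then have ev1: "\<forall>\<^sub>F y in at_left t. (\<Psi> y - \<Psi> t) / (y - t) < D + e"
    using e0 by (intro order_tendstoD(2)) auto
  have ev2: "\<forall>\<^sub>F y in at_left t. y \<in> {0<..<t}"
    using eventually_at_left_real[OF t] .
  \<comment> \<open>The distance tends to 0, so the quadratic remainder is eventually at most
    \<open>e\<close> times the distance bound.\<close>
  have "((\<lambda>y. (K + K') * ((t - y) + M y t)) \<longlongrightarrow> (K + K') * ((t - t) + 0)) (at_left t)"
    by (intro tendsto_intros M_tendsto_0 t)
  then have ev3: "\<forall>\<^sub>F y in at_left t. (K + K') * ((t - y) + M y t) < e"
    using e0 by (intro order_tendstoD(2)) auto
  show ?thesis
    using ev1 ev2 ev3
  proof eventually_elim
    case (elim y)
    \<comment> \<open>\<open>M y t\<close> may vanish or equal the distance; adding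
      \<open>t - y\<close> makes \<open>w\<close> positive and strictly larger than the
      distance.\<close>
    define w where "w = (t - y) + M y t"
    have y: "0 < y" "y < t" using elim by auto
    have \<pi>y: "\<pi> y \<in> P2" using y by (intro flow_P2) simp
    have w0: "0 < w" using y M_nonneg[of y t] by (simp add: w_def)
    have Ww: "W2 (\<pi> y) (\<pi> t) < w" using W2_le[of y t] y by (simp add: w_def M_def)
    have "\<bar>(\<integral>\<theta>. \<psi> \<theta> - \<eta> n \<theta> \<partial>\<pi> t) - (\<integral>\<theta>. \<psi> \<theta> - \<eta> n \<theta> \<partial>\<pi> y)\<bar> \<le> e * w + (K + K') * w\<^sup>2"
    proof (rule integral_diff_le_expansion[OF \<pi>y \<pi>t Ww w0 e0, where G = "\<lambda>\<theta>. G \<theta> - gradient (\<eta> n) \<theta>"])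
      show "\<bar>(\<psi> \<theta>' - \<eta> n \<theta>') - (\<psi> \<theta> - \<eta> n \<theta>) - (G \<theta> - gradient (\<eta> n) \<theta>) \<bullet> (\<theta>' - \<theta>)\<bar> \<le> (K + K') * (norm (\<theta>' - \<theta>))\<^sup>2"
        if "\<theta> \<in> closure Theta" "\<theta>' \<in> closure Theta" for \<theta> \<theta>'
        using ex[OF that] K'(2)[of \<theta>' \<theta>] by (simp add: inner_diff_left distrib_right)
    qed (use \<psi>[OF \<pi>y] \<psi>[OF \<pi>t] i\<eta>[OF \<pi>y] i\<eta>[OF \<pi>t] id2 n1 K K' in auto)
    also have "(K + K') * w\<^sup>2 \<le> e * w"
      using elim(3) w0 by (simp add: power2_eq_square w_def flip: mult.assoc)
    finally have 1: "(\<integral>\<theta>. \<psi> \<theta> \<partial>\<pi> t) - (\<integral>\<theta>. \<psi> \<theta> \<partial>\<pi> y) \<le> (\<Psi> t - \<Psi> y) + 2 * (e * w)"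
      using \<psi>[OF \<pi>y] \<psi>[OF \<pi>t] i\<eta>[OF \<pi>y] i\<eta>[OF \<pi>t] by (simp add: \<Psi>_def)
    have "\<Psi> t - \<Psi> y = (t - y) * ((\<Psi> y - \<Psi> t) / (y - t))" using y by (simp add: field_simps)
    also have "\<dots> \<le> (t - y) * (D + e)" using elim(1) y by (intro mult_left_mono) auto
    also have "\<dots> \<le> (t - y) * (- (\<integral>\<theta>. G \<theta> \<bullet> V \<theta> \<partial>\<pi> t) + 2 * e)"
      using n2 y by (intro mult_left_mono) (auto simp: D_def)
    also have "\<dots> = (t - y) * - (\<integral>\<theta>. G \<theta> \<bullet> V \<theta> \<partial>\<pi> t) + 2 * (e * (t - y))" by (simp add: algebra_simps)
    also have "e * (t - y) \<le> e * w" using e0 M_nonneg[of y t] by (intro mult_left_mono) (auto simp: w_def)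
    finally have 2: "\<Psi> t - \<Psi> y \<le> (t - y) * - (\<integral>\<theta>. G \<theta> \<bullet> V \<theta> \<partial>\<pi> t) + 2 * (e * w)" by simp
    have "4 * (e * w) = \<epsilon> * ((t - y) + M y t)" by (simp add: e_def w_def)
    with 1 2 show ?case unfolding V_def by linarith
  qed
qed

lemma moment_test_approximation:
  obtains \<eta> :: "nat \<Rightarrow> 'n param \<Rightarrow> real" and B where "0 \<le> B" "\<And>n. \<eta> n \<in> test_functions"
    "\<And>n \<theta>. norm (gradient (\<eta> n) \<theta>) \<le> B * norm \<theta>" "\<And>\<theta>. (\<lambda>n. gradient (\<eta> n) \<theta>) \<longlonglongrightarrow> 2 *\<^sub>R \<theta>"
proof (rule cutoff_approximation[of "\<lambda>n \<theta> :: 'n param. (norm \<theta>)\<^sup>2" "\<lambda>n \<theta>. 2 *\<^sub>R \<theta>" 2 UNIV "\<lambda>\<theta>. 2 *\<^sub>R \<theta>"])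
  show "((\<lambda>\<theta> :: 'n param. (norm \<theta>)\<^sup>2) has_derivative (\<lambda>h. (2 *\<^sub>R \<theta>) \<bullet> h)) (at \<theta>)" for \<theta>
    unfolding power2_norm_eq_inner by (auto intro!: derivative_eq_intros simp: inner_commute)
  fix \<eta> :: "nat \<Rightarrow> 'n param \<Rightarrow> real" assume "\<And>n. \<eta> n \<in> test_functions" "\<And>n x. norm (gradient (\<eta> n) x) \<le> 2 * (1 + 4 * exp 1) * norm x"
     "\<And>x. x \<in> UNIV \<Longrightarrow> (\<lambda>n. gradient (\<eta> n) x) \<longlonglongrightarrow> 2 *\<^sub>R x"
  then show thesis by (intro that[of "2 * (1 + 4 * exp 1)" \<eta>]) auto
qed (auto simp: Ck_norm_square)

text \<open>Convexity at each of the two times bounds the increment from both sides by increments of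
  frozen linear functionals. Absolute continuity of the risk thus follows from that of linear
  functionals, uniformly in the weight.\<close>

lemma risk_increment_le:
  assumes s: "0 \<le> s" and t: "0 \<le> t" and D: "\<And>h. admissible h \<Longrightarrow> \<bar>(\<integral>\<theta>. lin h \<theta> \<partial>\<pi> t) - (\<integral>\<theta>. lin h \<theta> \<partial>\<pi> s)\<bar> \<le> B"
  shows "\<bar>risk l P (\<pi> t) - risk l P (\<pi> s)\<bar> \<le> B"
  using risk_diff_le[OF flow_P2[OF s] flow_P2[OF t]] risk_diff_le[OF flow_P2[OF t] flow_P2[OF s]]
    D[OF admissible_dloss[OF flow_P2[OF s]]] D[OF admissible_dloss[OF flow_P2[OF t]]]
  by linarith

lemma scaled_m:
  assumes "0 \<le> a"
  shows "set_integrable lborel {a..b} (\<lambda>r. D * m r + c)"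
    and "a \<le> b \<Longrightarrow> (LINT r:{a..b}|lborel. D * m r + c) = D * M a b + c * (b - a)"
proof -
  have i: "set_integrable lborel {a..b} (\<lambda>r. D * m r)"
    using m_integrable'[OF assms, of b] by (simp add: set_integrable_mult_right)
  have j: "set_integrable lborel {a..b} (\<lambda>r. c)"
    by (rule borel_integrable_atLeastAtMost'[OF continuous_on_const])
  show "set_integrable lborel {a..b} (\<lambda>r. D * m r + c)" by (rule set_integral_add(1)[OF i j])
  show "(LINT r:{a..b}|lborel. D * m r + c) = D * M a b + c * (b - a)" if "a \<le> b"
  proof -
    have "(LINT r:{a..b}|lborel. c) = c * (b - a)" "(LINT r:{a..b}|lborel. D * m r) = D * M a b"
      using that by (simp_all add: set_lebesgue_integral_def M_def mult.left_commute[of _ D])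
    then show ?thesis by (simp only: set_integral_add(2)[OF i j])
  qed
qed

text \<open>Of the dissipation, which is minus the integral of the squared gradient, only the sign
  is kept.\<close>

lemma risk_antimono:
  assumes ab: "0 \<le> a" "a \<le> b"
  shows "risk l P (\<pi> b) \<le> risk l P (\<pi> a)"
proof -
  have "0 \<le> b" "0 \<le> C * A" using ab C_nonneg A_nonneg by auto
  from integral_increment_le[OF this] obtain D' where D': "1 \<le> D'" "\<And>f s t. 0 \<le> s \<Longrightarrow> s \<le> t \<Longrightarrow> t \<le> b \<Longrightarrow>
      integrable (\<pi> s) f \<Longrightarrow> integrable (\<pi> t) f \<Longrightarrow>
      (\<And>\<theta> \<theta>'. \<bar>f \<theta> - f \<theta>'\<bar> \<le> C * A * ((norm \<theta> + norm \<theta>') * norm (\<theta> - \<theta>'))) \<Longrightarrow>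
      \<bar>(\<integral>\<theta>. f \<theta> \<partial>\<pi> t) - (\<integral>\<theta>. f \<theta> \<partial>\<pi> s)\<bar> \<le> D' * M s t" by blast
  show ?thesis
  proof (rule left_growth_nonincreasing[of a b "\<lambda>r. D' * m r + 0" "\<lambda>t. risk l P (\<pi> t)"])
    show "set_integrable lborel {a..b} (\<lambda>r. D' * m r + 0)" by (rule scaled_m) (use ab in auto)
    show "\<And>x. 0 \<le> D' * m x + 0" using D'(1) m_nonneg by simp
    show "\<bar>risk l P (\<pi> t) - risk l P (\<pi> s)\<bar> \<le> (LINT r:{s..t}|lborel. D' * m r + 0)"
      if st: "a \<le> s" "s \<le> t" "t \<le> b" for s t
    proof -
      have "\<bar>risk l P (\<pi> t) - risk l P (\<pi> s)\<bar> \<le> D' * M s t"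
        by (rule risk_increment_le, use st ab in simp, use st ab in simp, rule D'(2))
           (use st ab flow_P2 abs_lin_diff_le in \<open>auto intro!: P2_integrable_lin\<close>)
      then show ?thesis by (subst scaled_m(2)) (use st ab in simp_all)
    qed
    show "AE s in lborel. a < s \<and> s < b \<longrightarrow> (\<forall>\<epsilon>>0. \<forall>\<^sub>F y in at_left s.
       risk l P (\<pi> s) - risk l P (\<pi> y) \<le> \<epsilon> * (s - y + (LINT r:{y..s}|lborel. D' * m r + 0)))"
      using weak_flow
    proof (eventually_elim, intro impI allI)
      fix s \<epsilon> :: real
      assume w: "0 < s \<longrightarrow> (\<forall>\<psi>\<in>test_functions. ((\<lambda>s. \<integral>\<theta>. \<psi> \<theta> \<partial>\<pi> s) has_real_derivative
           - (\<integral>\<theta>. gradient \<psi> \<theta> \<bullet> grad_risk_var l P (\<pi> s) \<theta> \<partial>\<pi> s)) (at s))"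
        and s: "a < s \<and> s < b" and e: "0 < \<epsilon>"
      have s0: "0 < s" using s ab by simp
      have \<pi>s: "\<pi> s \<in> P2" using s0 by (intro flow_P2) simp
      note adm = admissible_dloss[OF \<pi>s]
      obtain \<eta> :: "nat \<Rightarrow> 'n param \<Rightarrow> real" and B where \<eta>: "0 \<le> B" "\<And>n. \<eta> n \<in> test_functions"
        "\<And>n \<theta>. norm (gradient (\<eta> n) \<theta>) \<le> B * norm \<theta>"
        "\<And>\<theta>. (\<lambda>n. gradient (\<eta> n) \<theta>) \<longlonglongrightarrow> glin (dloss (\<pi> s)) \<theta>"
        using lin_test_approximation[OF adm] by metis
      have "\<forall>\<^sub>F y in at_left s. (\<integral>\<theta>. lin (dloss (\<pi> s)) \<theta> \<partial>\<pi> s) - (\<integral>\<theta>. lin (dloss (\<pi> s)) \<theta> \<partial>\<pi> y)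
        \<le> (s - y) * - (\<integral>\<theta>. glin (dloss (\<pi> s)) \<theta> \<bullet> glin (dloss (\<pi> s)) \<theta> \<partial>\<pi> s) + \<epsilon> * ((s - y) + M y s)"
        by (rule left_difference_bound[OF s0 _ _ _ _ \<eta>(2) \<eta>(3) \<eta>(4) \<eta>(1) e, of "lin (dloss (\<pi> s))" K1])
           (use w s0 in \<open>auto simp: grad_risk_var_glin K1_nonneg intro: P2_integrable_lin[OF _ adm] lin_expansion[OF adm]\<close>)
      moreover have "\<forall>\<^sub>F y in at_left s. y \<in> {0<..<s}" using eventually_at_left_real[OF s0] .
      ultimately show "\<forall>\<^sub>F y in at_left s.
       risk l P (\<pi> s) - risk l P (\<pi> y) \<le> \<epsilon> * (s - y + (LINT r:{y..s}|lborel. D' * m r + 0))"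
      proof eventually_elim
        case (elim y)
        have y: "0 < y" "y < s" using elim by auto
        \<comment> \<open>Freezing at \<open>s\<close> fixes the functional while \<open>y\<close>
          varies, so the left quotient bound for one function applies.\<close>
        have "risk l P (\<pi> s) - risk l P (\<pi> y) \<le> (\<integral>\<theta>. lin (dloss (\<pi> s)) \<theta> \<partial>\<pi> s) - (\<integral>\<theta>. lin (dloss (\<pi> s)) \<theta> \<partial>\<pi> y)"
          using y by (intro risk_diff_le \<pi>s flow_P2) simp
        also note elim(1)
        also have "(s - y) * - (\<integral>\<theta>. glin (dloss (\<pi> s)) \<theta> \<bullet> glin (dloss (\<pi> s)) \<theta> \<partial>\<pi> s) \<le> 0"
          using y by (intro mult_nonneg_nonpos) (auto intro!: Bochner_Integration.integral_nonneg)
        finally have "risk l P (\<pi> s) - risk l P (\<pi> y) \<le> \<epsilon> * ((s - y) + M y s)" by simp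
        also have "\<dots> \<le> \<epsilon> * ((s - y) + D' * M y s)"
          using e D'(1) M_nonneg[of y s] mult_right_mono[of 1 D' "M y s"] by (intro mult_left_mono) auto
        finally show ?case by (subst scaled_m(2)) (use y in simp_all)
      qed
    qed
  qed (use ab in auto)
qed

text \<open>The monotonicity criterion is applied to the moment plus
  \<open>4 * \<delta> * t\<close>. The gradient \<open>2 *\<^sub>R \<theta>\<close> paired with that
  of the variation is 4 times the variation, by Euler's identity. The linear term is accounted for
  by the constant in the dominating function.\<close>

lemma moment_decrease:
  assumes ab: "0 \<le> a" "a \<le> b" and \<delta>: "0 \<le> \<delta>"
    and lower: "\<And>t. a \<le> t \<Longrightarrow> t \<le> b \<Longrightarrow> \<delta> \<le> (\<integral>\<theta>. risk_var l P (\<pi> t) \<theta> \<partial>\<pi> t)"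
  shows "moment (\<pi> b) + 4 * \<delta> * b \<le> moment (\<pi> a) + 4 * \<delta> * a"
proof -
  have "0 \<le> b" "(0::real) \<le> 1" using ab by auto
  from integral_increment_le[OF this] obtain D' where D': "1 \<le> D'" "\<And>f s t. 0 \<le> s \<Longrightarrow> s \<le> t \<Longrightarrow> t \<le> b \<Longrightarrow>
      integrable (\<pi> s) f \<Longrightarrow> integrable (\<pi> t) f \<Longrightarrow>
      (\<And>\<theta> \<theta>'. \<bar>f \<theta> - f \<theta>'\<bar> \<le> 1 * ((norm \<theta> + norm \<theta>') * norm (\<theta> - \<theta>'))) \<Longrightarrow>
      \<bar>(\<integral>\<theta>. f \<theta> \<partial>\<pi> t) - (\<integral>\<theta>. f \<theta> \<partial>\<pi> s)\<bar> \<le> D' * M s t" by blast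
  obtain \<eta> :: "nat \<Rightarrow> 'n param \<Rightarrow> real" and B where \<eta>: "0 \<le> B" "\<And>n. \<eta> n \<in> test_functions"
    "\<And>n \<theta>. norm (gradient (\<eta> n) \<theta>) \<le> B * norm \<theta>"
    "\<And>\<theta>. (\<lambda>n. gradient (\<eta> n) \<theta>) \<longlonglongrightarrow> 2 *\<^sub>R \<theta>"
    using moment_test_approximation by metis
  have lip: "\<bar>(norm \<theta>)\<^sup>2 - (norm \<theta>')\<^sup>2\<bar> \<le> 1 * ((norm \<theta> + norm \<theta>') * norm (\<theta> - \<theta>'))" for \<theta> \<theta>' :: "'n param"
  proof -
    have "(norm \<theta>)\<^sup>2 - (norm \<theta>')\<^sup>2 = (norm \<theta> + norm \<theta>') * (norm \<theta> - norm \<theta>')"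
      by (simp add: power2_eq_square algebra_simps)
    then show ?thesis using norm_triangle_ineq3[of \<theta> \<theta>'] by (simp add: abs_mult mult_left_mono)
  qed
  have ex: "\<bar>(norm \<theta>')\<^sup>2 - (norm \<theta>)\<^sup>2 - (2 *\<^sub>R \<theta>) \<bullet> (\<theta>' - \<theta>)\<bar> \<le> 1 * (norm (\<theta>' - \<theta>))\<^sup>2" for \<theta> \<theta>' :: "'n param"
  proof -
    have "(norm \<theta>')\<^sup>2 - (norm \<theta>)\<^sup>2 - (2 *\<^sub>R \<theta>) \<bullet> (\<theta>' - \<theta>) = (norm (\<theta>' - \<theta>))\<^sup>2"
      unfolding power2_norm_eq_inner by (simp add: inner_diff_left inner_diff_right inner_commute)
    then show ?thesis by simp
  qed
  show ?thesis
  proof (rule left_growth_nonincreasing[of a b "\<lambda>r. D' * m r + 4 * \<delta>" "\<lambda>t. moment (\<pi> t) + 4 * \<delta> * t"])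
    show "set_integrable lborel {a..b} (\<lambda>r. D' * m r + 4 * \<delta>)" by (rule scaled_m) (use ab in auto)
    show "\<And>x. 0 \<le> D' * m x + 4 * \<delta>" using D'(1) m_nonneg \<delta> by simp
    show "\<bar>moment (\<pi> t) + 4 * \<delta> * t - (moment (\<pi> s) + 4 * \<delta> * s)\<bar> \<le> (LINT r:{s..t}|lborel. D' * m r + 4 * \<delta>)"
      if st: "a \<le> s" "s \<le> t" "t \<le> b" for s t
    proof -
      have "\<bar>moment (\<pi> t) - moment (\<pi> s)\<bar> \<le> D' * M s t"
        unfolding moment_def
        by (rule D'(2)[OF _ _ _ P2_integrable_square[OF flow_P2] P2_integrable_square[OF flow_P2] lip])
           (use st ab in auto)
      moreover have "\<bar>4 * \<delta> * t - 4 * \<delta> * s\<bar> \<le> 4 * \<delta> * (t - s)"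
        using \<delta> st by (simp add: abs_mult flip: right_diff_distrib)
      ultimately show ?thesis using scaled_m(2)[of s t D' "4 * \<delta>"] st ab by linarith
    qed
    show "AE s in lborel. a < s \<and> s < b \<longrightarrow> (\<forall>\<epsilon>>0. \<forall>\<^sub>F y in at_left s.
       moment (\<pi> s) + 4 * \<delta> * s - (moment (\<pi> y) + 4 * \<delta> * y) \<le> \<epsilon> * (s - y + (LINT r:{y..s}|lborel. D' * m r + 4 * \<delta>)))"
      using weak_flow
    proof (eventually_elim, intro impI allI)
      fix s \<epsilon> :: real
      assume w: "0 < s \<longrightarrow> (\<forall>\<psi>\<in>test_functions. ((\<lambda>s. \<integral>\<theta>. \<psi> \<theta> \<partial>\<pi> s) has_real_derivative
           - (\<integral>\<theta>. gradient \<psi> \<theta> \<bullet> grad_risk_var l P (\<pi> s) \<theta> \<partial>\<pi> s)) (at s))"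
        and s: "a < s \<and> s < b" and e: "0 < \<epsilon>"
      have s0: "0 < s" using s ab by simp
      have \<pi>s: "\<pi> s \<in> P2" using s0 by (intro flow_P2) simp
      note adm = admissible_dloss[OF \<pi>s]
      have "\<forall>\<^sub>F y in at_left s. moment (\<pi> s) - moment (\<pi> y)
        \<le> (s - y) * - (\<integral>\<theta>. (2 *\<^sub>R \<theta>) \<bullet> glin (dloss (\<pi> s)) \<theta> \<partial>\<pi> s) + \<epsilon> * ((s - y) + M y s)"
        unfolding moment_def
        by (rule left_difference_bound[OF s0 _ _ _ _ \<eta>(2) \<eta>(3) \<eta>(4) \<eta>(1) e, of "\<lambda>\<theta>. (norm \<theta>)\<^sup>2" 1, OF _ P2_integrable_square ex])
           (use w s0 in \<open>auto simp: grad_risk_var_glin\<close>)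
      moreover have "(\<integral>\<theta>. (2 *\<^sub>R \<theta>) \<bullet> glin (dloss (\<pi> s)) \<theta> \<partial>\<pi> s) = 4 * (\<integral>\<theta>. risk_var l P (\<pi> s) \<theta> \<partial>\<pi> s)"
        by (simp add: euler_lin[OF adm] risk_var_lin)
      moreover have "\<forall>\<^sub>F y in at_left s. y \<in> {0<..<s}" using eventually_at_left_real[OF s0] .
      ultimately have "\<forall>\<^sub>F y in at_left s. moment (\<pi> s) - moment (\<pi> y)
        \<le> (s - y) * - (4 * (\<integral>\<theta>. risk_var l P (\<pi> s) \<theta> \<partial>\<pi> s)) + \<epsilon> * ((s - y) + M y s) \<and> y \<in> {0<..<s}"
        by (simp only: eventually_conj_iff)
      then show "\<forall>\<^sub>F y in at_left s.
       moment (\<pi> s) + 4 * \<delta> * s - (moment (\<pi> y) + 4 * \<delta> * y) \<le> \<epsilon> * (s - y + (LINT r:{y..s}|lborel. D' * m r + 4 * \<delta>))"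
      proof eventually_elim
        case (elim y)
        have y: "0 < y" "y < s" using elim by auto
        have "(s - y) * - (4 * (\<integral>\<theta>. risk_var l P (\<pi> s) \<theta> \<partial>\<pi> s)) \<le> (s - y) * - (4 * \<delta>)"
          using y lower[of s] s by (intro mult_left_mono) auto
        then have "moment (\<pi> s) + 4 * \<delta> * s - (moment (\<pi> y) + 4 * \<delta> * y) \<le> \<epsilon> * ((s - y) + M y s)"
          using elim by (simp add: algebra_simps)
        also have "\<dots> \<le> \<epsilon> * ((s - y) + (D' * M y s + 4 * \<delta> * (s - y)))"
        proof -
          have "M y s \<le> D' * M y s" using D'(1) M_nonneg[of y s] mult_right_mono[of 1 D' "M y s"] by simp
          moreover have "0 \<le> 4 * \<delta> * (s - y)" using \<delta> y by simp
          ultimately show ?thesis using e by (intro mult_left_mono) auto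
        qed
        finally show ?case by (subst scaled_m(2)) (use y in simp_all)
      qed
    qed
  qed (use ab in auto)
qed

end

subsection \<open>Limit points\<close>

context flow_setting
begin

abbreviation unit_domain :: "'n param set" where
  "unit_domain \<equiv> closure Theta \<inter> cball 0 1"

text \<open>The variation and its gradient are treated as one vector-valued function, so a single
  subsequence serves both. The uniform convergence on \<open>unit_domain\<close> is recorded
  separately because membership in \<open>Omega_lim\<close> hides the sequence of times.\<close>

lemma Omega_lim_subsequence:
  assumes t0: "\<And>n. 0 \<le> t n" and t: "filterlim t at_top sequentially"
  obtains k :: "nat \<Rightarrow> nat" and g V where "strict_mono k" "(g, V) \<in> Omega_lim l P \<pi>"
    "\<And>e. 0 < e \<Longrightarrow> \<exists>N. \<forall>n\<ge>N. \<forall>\<theta>\<in>unit_domain. \<bar>risk_var l P (\<pi> (t (k n))) \<theta> - g \<theta>\<bar> < e"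
proof -
  define h where "h n = dloss (\<pi> (t n))" for n
  have adm: "admissible (h n)" for n unfolding h_def by (intro admissible_dloss flow_P2 t0)
  define F where "F n \<theta> = (lin (h n) \<theta>, glin (h n) \<theta>)" for n \<theta>
  have CA: "0 \<le> C * A" by (simp add: C_nonneg A_nonneg)
  have diff: "norm (F n x - F n y) \<le> (2 * (C * A) + K1) * norm (x - y)"
    if "x \<in> unit_domain" "y \<in> unit_domain" for n x y
  proof -
    have "norm (F n x - F n y) \<le> \<bar>lin (h n) x - lin (h n) y\<bar> + norm (glin (h n) x - glin (h n) y)"
      unfolding F_def by (simp, rule order_trans[OF norm_Pair_le]) simp
    also have "\<bar>lin (h n) x - lin (h n) y\<bar> \<le> C * A * ((norm x + norm y) * norm (x - y))"
      by (rule abs_lin_diff_le[OF adm])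
    also have "\<dots> \<le> C * A * (2 * norm (x - y))"
      using that CA by (intro mult_left_mono mult_right_mono) auto
    also have "norm (glin (h n) x - glin (h n) y) \<le> K1 * norm (x - y)"
      using that by (intro norm_glin_diff_le adm) auto
    finally show ?thesis by (simp add: algebra_simps)
  qed
  obtain g0 k where k: "strict_mono (k :: nat \<Rightarrow> nat)"
    and lim: "\<And>e. 0 < e \<Longrightarrow> \<exists>N. \<forall>n x. n \<ge> N \<and> x \<in> unit_domain \<longrightarrow> norm (F (k n) x - g0 x) < e"
  proof (rule Arzela_Ascoli[of unit_domain F "C * A + 2 * C * A"])
    show "compact unit_domain" by (intro closed_Int_compact) auto
    show "norm (F n x) \<le> C * A + 2 * C * A" if x: "x \<in> unit_domain" for n x
    proof -
      have "norm (F n x) \<le> \<bar>lin (h n) x\<bar> + norm (glin (h n) x)"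
        unfolding F_def by (rule order_trans[OF norm_Pair_le]) simp
      also have "\<dots> \<le> C * A * (norm x)\<^sup>2 + 2 * C * A * norm x"
        by (intro add_mono abs_lin_le norm_glin_le adm)
      also have "\<dots> \<le> C * A * 1 + 2 * C * A * 1"
        using x CA by (intro add_mono mult_left_mono power_le_one) auto
      finally show ?thesis by simp
    qed
    show "\<exists>d>0. \<forall>n y. y \<in> unit_domain \<and> norm (x - y) < d \<longrightarrow> norm (F n x - F n y) < e"
      if x: "x \<in> unit_domain" and e: "0 < e" for x e
    proof (intro exI[of _ "e / (2 * (C * A) + K1 + 1)"] conjI allI impI)
      have p: "0 < 2 * (C * A) + K1 + 1" using CA K1_nonneg by linarith
      then show "0 < e / (2 * (C * A) + K1 + 1)" using e by simp
      fix n y assume y: "y \<in> unit_domain \<and> norm (x - y) < e / (2 * (C * A) + K1 + 1)"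
      have "norm (F n x - F n y) \<le> (2 * (C * A) + K1) * norm (x - y)" using diff x y by blast
      also have "\<dots> \<le> (2 * (C * A) + K1 + 1) * norm (x - y)" by (intro mult_right_mono) auto
      also have "\<dots> < e" using y p by (simp add: pos_less_divide_eq mult.commute)
      finally show "norm (F n x - F n y) < e" .
    qed
  qed blast
  \<comment> \<open>Dividing by \<open>1 + norm \<theta>\<close> maps into the unit ball and makes
    sense at 0 as well. Homogeneity then extends the limits from \<open>unit_domain\<close> to all
    of \<open>closure Theta\<close>.\<close>
  define q where "q \<theta> = \<theta> /\<^sub>R (1 + norm \<theta>)" for \<theta> :: "'n param"
  have n1: "0 < 1 + norm \<theta>" for \<theta> :: "'n param" using norm_ge_zero[of \<theta>] by linarith
  have q: "q \<theta> \<in> unit_domain" if "\<theta> \<in> closure Theta" for \<theta>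
    unfolding q_def using n1[of \<theta>] closure_Theta_scaleR[OF _ that, of "inverse (1 + norm \<theta>)"]
    by (simp add: field_simps)
  have qs: "\<theta> = (1 + norm \<theta>) *\<^sub>R q \<theta>" for \<theta>
    using n1[of \<theta>] by (simp add: q_def)
  define g where "g \<theta> = (1 + norm \<theta>)\<^sup>2 * fst (g0 (q \<theta>))" for \<theta>
  define V where "V \<theta> = (1 + norm \<theta>) *\<^sub>R snd (g0 (q \<theta>))" for \<theta>
  have dg: "\<bar>lin (h n) \<theta> - g \<theta>\<bar> \<le> (1 + norm \<theta>)\<^sup>2 * norm (F n (q \<theta>) - g0 (q \<theta>))" for n \<theta>
  proof -
    have "lin (h n) \<theta> = (1 + norm \<theta>)\<^sup>2 * lin (h n) (q \<theta>)"
      using lin_scaleR[of "1 + norm \<theta>" "h n" "q \<theta>"] n1[of \<theta>] qs[of \<theta>] by simp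
    then have "lin (h n) \<theta> - g \<theta> = (1 + norm \<theta>)\<^sup>2 * fst (F n (q \<theta>) - g0 (q \<theta>))"
      by (simp add: g_def F_def right_diff_distrib)
    then show ?thesis
      using abs_fst_le[of "F n (q \<theta>) - g0 (q \<theta>)"] by (simp only: abs_mult abs_power2 mult_left_mono zero_le_power2)
  qed
  have dV: "norm (glin (h n) \<theta> - V \<theta>) \<le> (1 + norm \<theta>) * norm (F n (q \<theta>) - g0 (q \<theta>))" for n \<theta>
  proof -
    have "glin (h n) \<theta> = (1 + norm \<theta>) *\<^sub>R glin (h n) (q \<theta>)"
      using glin_scaleR[of "1 + norm \<theta>" "h n" "q \<theta>"] n1[of \<theta>] qs[of \<theta>] by simp
    then have "glin (h n) \<theta> - V \<theta> = (1 + norm \<theta>) *\<^sub>R snd (F n (q \<theta>) - g0 (q \<theta>))"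
      by (simp add: V_def F_def scaleR_right_diff_distrib)
    then have "norm (glin (h n) \<theta> - V \<theta>) = (1 + norm \<theta>) * norm (snd (F n (q \<theta>) - g0 (q \<theta>)))"
      using n1[of \<theta>] by simp
    also have "\<dots> \<le> (1 + norm \<theta>) * norm (F n (q \<theta>) - g0 (q \<theta>))"
      using n1[of \<theta>] by (intro mult_left_mono norm_snd_le') simp
    finally show ?thesis .
  qed
  have bnd: "\<exists>N. \<forall>n\<ge>N. \<forall>\<theta>\<in>closure Theta \<inter> cball 0 R. \<bar>lin (h (k n)) \<theta> - g \<theta>\<bar> < e \<and> norm (glin (h (k n)) \<theta> - V \<theta>) < e"
    if e: "0 < e" and R: "0 \<le> R" for e R
  proof -
    have p: "0 < e / (1 + R)\<^sup>2" using e R by simp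
    from lim[OF this] obtain N where N: "\<And>n x. n \<ge> N \<Longrightarrow> x \<in> unit_domain \<Longrightarrow> norm (F (k n) x - g0 x) < e / (1 + R)\<^sup>2" by blast
    have "\<bar>lin (h (k n)) \<theta> - g \<theta>\<bar> < e \<and> norm (glin (h (k n)) \<theta> - V \<theta>) < e"
      if n: "n \<ge> N" and \<theta>: "\<theta> \<in> closure Theta \<inter> cball 0 R" for n \<theta>
    proof -
      let ?d = "norm (F (k n) (q \<theta>) - g0 (q \<theta>))"
      have "?d < e / (1 + R)\<^sup>2" using \<theta> by (intro N[OF n] q) simp
      then have d: "(1 + R)\<^sup>2 * ?d < e" using R by (simp add: pos_less_divide_eq mult.commute)
      have nR: "1 + norm \<theta> \<le> 1 + R" using \<theta> by simp
      \<comment> \<open>The gradient scales with the first power, the variation with the second; the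
        larger factor covers both.\<close>
      have "1 + norm \<theta> \<le> (1 + norm \<theta>)\<^sup>2"
        using self_le_power[of "1 + norm \<theta>" 2] by simp
      then have "(1 + norm \<theta>) * ?d \<le> (1 + norm \<theta>)\<^sup>2 * ?d" by (rule mult_right_mono) simp
      moreover have "(1 + norm \<theta>)\<^sup>2 * ?d \<le> (1 + R)\<^sup>2 * ?d"
        using nR by (intro mult_right_mono power_mono) auto
      ultimately show ?thesis using dg[of "k n" \<theta>] dV[of "k n" \<theta>] d by linarith
    qed
    then show ?thesis by blast
  qed
  have "(g, V) \<in> Omega_lim l P \<pi>"
    unfolding Omega_lim_def
  proof (clarsimp, intro exI[of _ "\<lambda>n. t (k n)"] conjI allI)
    show "filterlim (\<lambda>n. t (k n)) at_top sequentially"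
      by (rule filterlim_compose[OF t filterlim_subseq[OF k]])
    have nb: "\<theta> \<in> closure Theta \<inter> cball 0 (norm x + 1)" if "\<theta> \<in> closure Theta \<inter> ball x 1" for x \<theta>
    proof -
      have "norm \<theta> \<le> norm x + dist x \<theta>" using norm_triangle_sub[of \<theta> x] by (simp add: dist_norm norm_minus_commute)
      then show ?thesis using that by simp
    qed
    show "locally_uniform_limit (closure Theta) (\<lambda>n. risk_var l P (\<pi> (t (k n)))) g"
      unfolding locally_uniform_limit_def
    proof (intro ballI exI[of _ 1] conjI)
      fix x :: "'n param"
      show "uniform_limit (closure Theta \<inter> ball x 1) (\<lambda>n. risk_var l P (\<pi> (t (k n)))) g sequentially"
        unfolding uniform_limit_sequentially_iff
      proof (intro allI impI)
        fix e :: real assume "0 < e"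
        from bnd[OF this, of "norm x + 1"] show "\<exists>N. \<forall>n\<ge>N. \<forall>\<theta>\<in>closure Theta \<inter> ball x 1. dist (risk_var l P (\<pi> (t (k n))) \<theta>) (g \<theta>) < e"
          using nb[of _ x] unfolding risk_var_lin h_def dist_real_def
          by (metis add_nonneg_nonneg norm_ge_zero zero_le_one)
      qed
    qed simp
    show "locally_uniform_limit (closure Theta) (\<lambda>n. grad_risk_var l P (\<pi> (t (k n)))) V"
      unfolding locally_uniform_limit_def
    proof (intro ballI exI[of _ 1] conjI)
      fix x :: "'n param"
      show "uniform_limit (closure Theta \<inter> ball x 1) (\<lambda>n. grad_risk_var l P (\<pi> (t (k n)))) V sequentially"
        unfolding uniform_limit_sequentially_iff
      proof (intro allI impI)
        fix e :: real assume "0 < e"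
        from bnd[OF this, of "norm x + 1"] show "\<exists>N. \<forall>n\<ge>N. \<forall>\<theta>\<in>closure Theta \<inter> ball x 1. dist (grad_risk_var l P (\<pi> (t (k n))) \<theta>) (V \<theta>) < e"
          using nb[of _ x] unfolding grad_risk_var_glin h_def dist_norm
          by (metis add_nonneg_nonneg norm_ge_zero zero_le_one)
      qed
    qed simp
  qed (use t0 in auto)
  moreover have "\<exists>N. \<forall>n\<ge>N. \<forall>\<theta>\<in>unit_domain. \<bar>risk_var l P (\<pi> (t (k n))) \<theta> - g \<theta>\<bar> < e" if "0 < e" for e
    using bnd[OF that, of 1] unfolding risk_var_lin h_def by fastforce
  ultimately show thesis using that[OF k] by blast
qed

lemma Omega_lim_nonempty: "Omega_lim l P \<pi> \<noteq> {}"
  by (rule Omega_lim_subsequence[of real]) (auto simp: filterlim_real_sequentially)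

text \<open>By contradiction and compactness: times tending to infinity with values of size at least
  \<open>e\<close> on \<open>unit_domain\<close> would produce a nonzero limit point. Scaling then
  gives a bound relative to \<open>(norm \<theta>)^2\<close>, which can be integrated against any
  measure in \<open>P2\<close>.\<close>

lemma risk_var_uniformly_small:
  assumes zero: "\<forall>(g, V)\<in>Omega_lim l P \<pi>. \<forall>\<theta>\<in>closure Theta. g \<theta> = 0" and e: "0 < e"
  obtains T where "0 \<le> T" "\<And>t \<theta>. T \<le> t \<Longrightarrow> \<theta> \<in> closure Theta \<Longrightarrow> \<bar>risk_var l P (\<pi> t) \<theta>\<bar> \<le> e * (norm \<theta>)\<^sup>2"
proof -
  have "\<exists>T\<ge>0. \<forall>t\<ge>T. \<forall>\<theta>\<in>unit_domain. \<bar>risk_var l P (\<pi> t) \<theta>\<bar> < e"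
  proof (rule ccontr)
    assume "\<not> ?thesis"
    then have "\<forall>n::nat. \<exists>t \<theta>. real n \<le> t \<and> \<theta> \<in> unit_domain \<and> \<not> \<bar>risk_var l P (\<pi> t) \<theta>\<bar> < e"
      by (meson of_nat_0_le_iff)
    then obtain t \<theta> where t: "\<And>n::nat. real n \<le> t n" "\<And>n. \<theta> n \<in> unit_domain" "\<And>n. \<not> \<bar>risk_var l P (\<pi> (t n)) (\<theta> n)\<bar> < e"
      by metis
    have t0: "0 \<le> t n" for n using t(1)[of n] by linarith
    have tl: "filterlim t at_top sequentially"
      by (rule filterlim_at_top_mono[OF filterlim_real_sequentially]) (use t(1) in auto)
    obtain k :: "nat \<Rightarrow> nat" and g V where "strict_mono k" and gV: "(g, V) \<in> Omega_lim l P \<pi>"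
      and lim: "\<And>e. 0 < e \<Longrightarrow> \<exists>N. \<forall>n\<ge>N. \<forall>\<theta>\<in>unit_domain. \<bar>risk_var l P (\<pi> (t (k n))) \<theta> - g \<theta>\<bar> < e"
      using Omega_lim_subsequence[OF t0 tl] by metis
    from lim[OF e] obtain N where "\<bar>risk_var l P (\<pi> (t (k N))) (\<theta> (k N)) - g (\<theta> (k N))\<bar> < e"
      using t(2) by blast
    moreover have "g (\<theta> (k N)) = 0" using bspec[OF zero gV] t(2)[of "k N"] by auto
    ultimately show False using t(3)[of "k N"] by simp
  qed
  then obtain T where T: "0 \<le> T" "\<And>t \<theta>. T \<le> t \<Longrightarrow> \<theta> \<in> unit_domain \<Longrightarrow> \<bar>risk_var l P (\<pi> t) \<theta>\<bar> < e" by blast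
  show thesis
  proof (rule that[OF T(1)])
    fix t and \<theta> :: "'n param" assume t: "T \<le> t" and \<theta>: "\<theta> \<in> closure Theta"
    show "\<bar>risk_var l P (\<pi> t) \<theta>\<bar> \<le> e * (norm \<theta>)\<^sup>2"
    proof (cases "\<theta> = 0")
      case True
      then show ?thesis using lin_scaleR[of 0 "dloss (\<pi> t)" 0] by (simp add: risk_var_lin)
    next
      case False
      then have u: "\<theta> /\<^sub>R norm \<theta> \<in> unit_domain"
        using closure_Theta_scaleR[OF _ \<theta>, of "inverse (norm \<theta>)"] by simp
      have "risk_var l P (\<pi> t) \<theta> = (norm \<theta>)\<^sup>2 * risk_var l P (\<pi> t) (\<theta> /\<^sub>R norm \<theta>)"
        unfolding risk_var_lin using lin_scaleR[of "norm \<theta>" "dloss (\<pi> t)" "\<theta> /\<^sub>R norm \<theta>"] False by simp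
      then have "\<bar>risk_var l P (\<pi> t) \<theta>\<bar> = (norm \<theta>)\<^sup>2 * \<bar>risk_var l P (\<pi> t) (\<theta> /\<^sub>R norm \<theta>)\<bar>"
        by (simp add: abs_mult)
      also have "\<dots> \<le> (norm \<theta>)\<^sup>2 * e" using T(2)[OF t u] by (intro mult_left_mono) auto
      finally show ?thesis by (simp add: mult.commute)
    qed
  qed
qed

lemma risk_tendsto_INF:
  assumes zero: "\<forall>(g, V)\<in>Omega_lim l P \<pi>. \<forall>\<theta>\<in>closure Theta. g \<theta> = 0"
  shows "((\<lambda>t. risk l P (\<pi> t)) \<longlongrightarrow> (INF \<rho>\<in>P2. risk l P \<rho>)) at_top"
proof -
  let ?I = "INF \<rho>\<in>P2. risk l P \<rho>"
  have ex: "\<exists>T\<ge>0. risk l P (\<pi> T) < ?I + e" if e: "0 < e" for e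
  proof (rule ccontr)
    assume "\<not> ?thesis"
    then have big: "?I + e \<le> risk l P (\<pi> t)" if "0 \<le> t" for t using that by force
    have "?I < ?I + e / 2" using e by simp
    then obtain \<rho> where \<rho>: "\<rho> \<in> P2" "risk l P \<rho> < ?I + e / 2"
      using cInf_lessD[of "(\<lambda>\<rho>. risk l P \<rho>) ` P2" "?I + e / 2"] flow_P2[of 0] by auto
    \<comment> \<open>Makes the integral of the variation against the competitor at most
      \<open>e / 4\<close>; the risk gap of \<open>e / 2\<close> then leaves \<open>e / 4\<close>
      for the integral along the flow.\<close>
    have p: "0 < e / (4 * (moment \<rho> + 1))" using e moment_nonneg[of \<rho>] by simp
    obtain T where T: "0 \<le> T" "\<And>t \<theta>. T \<le> t \<Longrightarrow> \<theta> \<in> closure Theta \<Longrightarrow>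
        \<bar>risk_var l P (\<pi> t) \<theta>\<bar> \<le> e / (4 * (moment \<rho> + 1)) * (norm \<theta>)\<^sup>2"
      using risk_var_uniformly_small[OF zero p] by metis
    have lower: "e / 4 \<le> (\<integral>\<theta>. risk_var l P (\<pi> t) \<theta> \<partial>\<pi> t)" if t: "T \<le> t" for t
    proof -
      have t0: "0 \<le> t" using t T by linarith
      note \<pi>t = flow_P2[OF t0]
      have "norm (\<integral>\<theta>. risk_var l P (\<pi> t) \<theta> \<partial>\<rho>) \<le> e / (4 * (moment \<rho> + 1)) * moment \<rho>"
        by (rule P2_norm_integral_bound[OF \<rho>(1)])
           (use T(2)[OF t] in \<open>auto simp: risk_var_lin intro: P2_lin_measurable[OF \<rho>(1) admissible_dloss[OF \<pi>t]]\<close>)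
      also have "\<dots> \<le> e / 4" using e moment_nonneg[of \<rho>] by (simp add: field_simps)
      finally have "\<bar>\<integral>\<theta>. risk_var l P (\<pi> t) \<theta> \<partial>\<rho>\<bar> \<le> e / 4" by simp
      moreover have "e / 2 \<le> risk l P (\<pi> t) - risk l P \<rho>" using big[OF t0] \<rho>(2) by linarith
      ultimately show ?thesis using risk_diff_le[OF \<pi>t \<rho>(1)] unfolding risk_var_lin by linarith
    qed
    \<comment> \<open>The time after which decay at rate \<open>e\<close> would bring the second
      moment down to at most -1.\<close>
    define b where "b = T + (moment (\<pi> T) + 1) / e"
    have "T \<le> b" using e moment_nonneg[of "\<pi> T"] by (simp add: b_def)
    then have "moment (\<pi> b) + 4 * (e / 4) * b \<le> moment (\<pi> T) + 4 * (e / 4) * T"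
      using e by (intro moment_decrease T lower) auto
    moreover have "e * b = e * T + (moment (\<pi> T) + 1)" using e by (simp add: b_def field_simps)
    ultimately show False using moment_nonneg[of "\<pi> b"] by simp
  qed
  show ?thesis
  proof (rule order_tendstoI)
    fix c assume "c < ?I"
    moreover have "\<forall>\<^sub>F t in at_top. ?I \<le> risk l P (\<pi> t)"
      using eventually_ge_at_top[of 0] by eventually_elim (intro INF_risk_le flow_P2)
    ultimately show "\<forall>\<^sub>F t in at_top. c < risk l P (\<pi> t)"
      by (auto elim: eventually_mono)
  next
    \<comment> \<open>Values near the infimum at a single time suffice, since the risk is
      nonincreasing.\<close>
    fix c assume "?I < c"
    then obtain T where T: "0 \<le> T" "risk l P (\<pi> T) < c" using ex[of "c - ?I"] by auto
    show "\<forall>\<^sub>F t in at_top. risk l P (\<pi> t) < c"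
      using eventually_ge_at_top[of T] by eventually_elim (use risk_antimono[OF T(1)] T(2) in fastforce)
  qed
qed

end

subsection \<open>Disintegration and the conditional loss\<close>

text \<open>\<open>\<kappa>\<close> is a continuous selection of subgradients: nonpositive left and
  nonnegative right of a minimiser. Working with slopes saves differentiating
  \<open>F\<close>.\<close>

lemma convex_minimizer_stationary:
  fixes F \<kappa> :: "real \<Rightarrow> real"
  assumes sub: "\<And>x y. F x + \<kappa> x * (y - x) \<le> F y" and cont: "continuous_on UNIV \<kappa>"
    and a: "\<And>y. F a \<le> F y"
  shows "\<kappa> a = 0"
proof -
  have c: "(\<kappa> \<longlongrightarrow> \<kappa> a) (at a within S)" for S
    using cont by (simp add: continuous_on_eq_continuous_at continuous_at_imp_continuous_within continuous_within[symmetric])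
  have r: "0 \<le> \<kappa> y * (y - a)" for y
    using sub[of y a] a[of y] by (simp add: algebra_simps)
  have r1: "0 \<le> \<kappa> y" if "a < y" for y using r[of y] that by (simp add: zero_le_mult_iff)
  have r2: "\<kappa> y \<le> 0" if "y < a" for y using r[of y] that by (simp add: zero_le_mult_iff)
  have "0 \<le> \<kappa> a"
    by (rule tendsto_lowerbound[OF c[of "{a<..}"]])
       (use r1 in \<open>auto simp: eventually_at_filter intro!: always_eventually\<close>)
  moreover have "\<kappa> a \<le> 0"
    by (rule tendsto_upperbound[OF c[of "{..<a}"]])
       (use r2 in \<open>auto simp: eventually_at_filter intro!: always_eventually\<close>)
  ultimately show ?thesis by simp
qed

text \<open>The sequence itself need not converge. Coercivity confines it to a ball. The points of
  that ball with slope of modulus at least \<open>e\<close> form a compact set without minimisers of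
  \<open>F\<close>, on which \<open>F\<close> therefore stays above its minimum, and so the sequence
  eventually avoids this set.\<close>

lemma convex_minimizing_sequence_derivative:
  fixes F \<kappa> :: "real \<Rightarrow> real"
  assumes sub: "\<And>x y. F x + \<kappa> x * (y - x) \<le> F y" and cont: "continuous_on UNIV \<kappa>" "continuous_on UNIV F"
    and a: "\<And>y. F a \<le> F y" and coercive: "filterlim F at_top at_infinity"
    and u: "(\<lambda>n. F (u n)) \<longlonglongrightarrow> F a"
  shows "(\<lambda>n. \<kappa> (u n)) \<longlonglongrightarrow> 0"
proof (rule tendstoI)
  fix e :: real assume e: "0 < e"
  have "\<forall>\<^sub>F x in at_infinity. F a + 1 \<le> F x"
    using coercive unfolding filterlim_at_top by blast
  then obtain b where b: "\<And>x. b \<le> \<bar>x\<bar> \<Longrightarrow> F a + 1 \<le> F x"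
    unfolding eventually_at_infinity by auto
  have ev1: "\<forall>\<^sub>F n in sequentially. F (u n) < F a + 1" using u by (rule order_tendstoD(2)) simp
  define Z where "Z = {x \<in> cball 0 b. e \<le> \<bar>\<kappa> x\<bar>}"
  have "closed {x. e \<le> \<bar>\<kappa> x\<bar>}"
    by (intro closed_Collect_le continuous_intros cont)
  then have "compact (cball 0 b \<inter> {x. e \<le> \<bar>\<kappa> x\<bar>})" by (intro compact_Int_closed compact_cball)
  then have Z: "compact Z" by (simp add: Z_def Int_def)
  have ev2: "\<forall>\<^sub>F n in sequentially. u n \<notin> Z"
  proof (cases "Z = {}")
    case False
    obtain x0 where x0: "x0 \<in> Z" "\<And>y. y \<in> Z \<Longrightarrow> F x0 \<le> F y"
      using continuous_attains_inf[OF Z False continuous_on_subset[OF cont(2)]] by auto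
    have "F a < F x0"
    proof (rule ccontr)
      assume "\<not> F a < F x0"
      then have "\<And>y. F x0 \<le> F y" using a by (meson linorder_not_less order_trans)
      from convex_minimizer_stationary[OF sub cont(1) this] have "\<kappa> x0 = 0" .
      then show False using x0(1) e by (simp add: Z_def)
    qed
    then have "\<forall>\<^sub>F n in sequentially. F (u n) < F x0" using u by (rule order_tendstoD(2)[rotated])
    then show ?thesis by eventually_elim (use x0(2) in force)
  qed simp
  show "\<forall>\<^sub>F n in sequentially. dist (\<kappa> (u n)) 0 < e"
    using ev1 ev2
  proof eventually_elim
    case (elim n)
    then have "\<bar>u n\<bar> < b" using b[of "u n"] by linarith
    then show ?case using elim(2) by (auto simp: Z_def)
  qed
qed

locale conditional_setting = risk_setting l P C L
  for l :: "real \<Rightarrow> real \<Rightarrow> real" and P :: "((real ^ 'n::finite) \<times> real) measure" and C L +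
  fixes K :: "real ^ 'n \<Rightarrow> real measure"
  assumes cond: "conditional_distribution P K" and compat: "compatibility l P K"
begin

lemma sets_marginal[measurable_cong]: "sets (marginal P) = sets borel"
  by (simp add: marginal_def)

lemma space_marginal: "space (marginal P) = UNIV"
  by (simp add: marginal_def)

lemma K_kernel: "K \<in> borel \<rightarrow>\<^sub>M prob_algebra borel"
  using cond by (simp add: conditional_distribution_def)

lemma K_prob: "prob_space (K x)" and K_sets[measurable_cong]: "sets (K x) = sets borel"
  using measurable_space[OF K_kernel, of x] by (auto simp: space_prob_algebra)

definition pair_kernel :: "real ^ 'n \<Rightarrow> ((real ^ 'n) \<times> real) measure" where
  "pair_kernel x = distr (K x) borel (Pair x)"

lemma Pair_measurable: "Pair x \<in> K x \<rightarrow>\<^sub>M borel"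
proof -
  have "Pair x \<in> borel \<rightarrow>\<^sub>M borel" by (intro borel_measurable_continuous_onI continuous_intros)
  then show ?thesis using measurable_cong_sets[OF K_sets refl] by blast
qed

lemma pair_kernel_measurable: "pair_kernel \<in> borel \<rightarrow>\<^sub>M subprob_algebra borel"
  unfolding pair_kernel_def[abs_def]
proof (rule measurable_distr2)
  have "(\<lambda>z. z) \<in> (borel \<Otimes>\<^sub>M borel :: ((real ^ 'n) \<times> real) measure) \<rightarrow>\<^sub>M borel"
    unfolding borel_prod by simp
  then show "case_prod Pair \<in> (borel \<Otimes>\<^sub>M borel :: ((real ^ 'n) \<times> real) measure) \<rightarrow>\<^sub>M borel"
    by (simp add: case_prod_unfold)
  show "K \<in> borel \<rightarrow>\<^sub>M subprob_algebra borel" by (rule measurable_prob_algebraD[OF K_kernel])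
qed

lemma pair_kernel_measurable': "pair_kernel \<in> marginal P \<rightarrow>\<^sub>M subprob_algebra borel"
  using pair_kernel_measurable measurable_cong_sets[OF sets_marginal refl] by blast

text \<open>The conditional distribution is given on measurable rectangles only; these are stable
  under intersection and generate the sets of the product, so the two measures agree.\<close>

lemma P_disintegration: "P = marginal P \<bind> pair_kernel"
proof -
  let ?E = "{A \<times> B | A B. A \<in> sets (borel :: (real ^ 'n) measure) \<and> B \<in> sets (borel :: real measure)}"
  have sE: "sets (borel :: ((real ^ 'n) \<times> real) measure) = sigma_sets UNIV ?E"
    using sets_pair_measure[of "borel :: (real ^ 'n) measure" "borel :: real measure"] unfolding borel_prod by simp
  have ne: "space (marginal P) \<noteq> {}" by (simp add: space_marginal)
  show ?thesis
  proof (rule measure_eqI_generator_eq[where E = ?E and \<Omega> = UNIV and A = "\<lambda>_. UNIV"])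
    show "Int_stable ?E" by (rule Int_stable_pair_measure_generator)
    show "sets P = sigma_sets UNIV ?E" by (simp add: sets_P sE)
    show "sets (marginal P \<bind> pair_kernel) = sigma_sets UNIV ?E"
      using sets_bind[of "marginal P" pair_kernel borel] ne by (simp add: pair_kernel_def sE)
    show "emeasure P X = emeasure (marginal P \<bind> pair_kernel) X" if "X \<in> ?E" for X
    proof -
      from that obtain A B where X: "X = A \<times> B" "A \<in> sets borel" "B \<in> sets borel" by blast
      have Xb: "X \<in> sets borel" using X(2,3) unfolding X(1) borel_prod[symmetric] by (rule pair_measureI)
      have "emeasure (marginal P \<bind> pair_kernel) X = (\<integral>\<^sup>+x. emeasure (pair_kernel x) X \<partial>marginal P)"
        by (rule emeasure_bind[OF ne pair_kernel_measurable' Xb])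
      also have "\<dots> = (\<integral>\<^sup>+x\<in>A. emeasure (K x) B \<partial>marginal P)"
      proof (rule nn_integral_cong)
        fix x
        have "emeasure (pair_kernel x) X = emeasure (K x) (Pair x -` X \<inter> space (K x))"
          unfolding pair_kernel_def by (rule emeasure_distr[OF Pair_measurable Xb])
        also have "Pair x -` X \<inter> space (K x) = (if x \<in> A then B else {})"
          using sets_eq_imp_space_eq[OF K_sets[of x]] by (auto simp: X(1))
        finally show "emeasure (pair_kernel x) X = emeasure (K x) B * indicator A x" by auto
      qed
      finally show ?thesis
        using cond X by (simp add: conditional_distribution_def)
    qed
    show "range (\<lambda>_ :: nat. UNIV) \<subseteq> ?E" by (auto intro!: exI[of _ UNIV])
    show "emeasure P UNIV \<noteq> \<infinity>" using P.emeasure_space_1 by (simp add: space_P)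
  qed auto
qed

lemma section_measurable:
  assumes "F \<in> borel_measurable P"
  shows "(\<lambda>y. F (x, y)) \<in> borel_measurable (K x)"
  using measurable_compose[OF Pair_measurable, of F borel] assms measurable_cong_sets[OF sets_P refl] by auto

lemma nn_integral_disintegration:
  fixes F :: "_ \<Rightarrow> ennreal"
  assumes F: "F \<in> borel_measurable P"
  shows "(\<integral>\<^sup>+z. F z \<partial>P) = (\<integral>\<^sup>+x. \<integral>\<^sup>+y. F (x, y) \<partial>K x \<partial>marginal P)"
proof -
  have Fb: "F \<in> borel_measurable borel" using F measurable_cong_sets[OF sets_P refl] by blast
  have "(\<integral>\<^sup>+z. F z \<partial>P) = (\<integral>\<^sup>+x. \<integral>\<^sup>+z. F z \<partial>pair_kernel x \<partial>marginal P)"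
    by (subst P_disintegration) (rule nn_integral_bind[OF Fb pair_kernel_measurable'])
  also have "\<dots> = (\<integral>\<^sup>+x. \<integral>\<^sup>+y. F (x, y) \<partial>K x \<partial>marginal P)"
    unfolding pair_kernel_def by (intro nn_integral_cong nn_integral_distr Pair_measurable) (simp add: Fb)
  finally show ?thesis .
qed

lemma section_integral_measurable:
  fixes F :: "_ \<Rightarrow> real"
  assumes F: "F \<in> borel_measurable P"
  shows "(\<lambda>x. \<integral>y. F (x, y) \<partial>K x) \<in> borel_measurable (marginal P)"
proof -
  have Fb: "F \<in> borel_measurable borel" using F measurable_cong_sets[OF sets_P refl] by blast
  have "(\<lambda>x. \<integral>z. F z \<partial>pair_kernel x) \<in> borel_measurable (marginal P)"
    by (rule measurable_compose[OF pair_kernel_measurable' integral_measurable_subprob_algebra[OF Fb]])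
  then show ?thesis
    unfolding pair_kernel_def by (simp add: integral_distr[OF Pair_measurable Fb])
qed

lemma integrable_section:
  fixes F :: "_ \<Rightarrow> real"
  assumes F: "integrable P F"
  shows "AE x in marginal P. integrable (K x) (\<lambda>y. F (x, y))"
    and "integrable (marginal P) (\<lambda>x. \<integral>y. F (x, y) \<partial>K x)"
proof -
  have Fm: "F \<in> borel_measurable P" using F by (rule borel_measurable_integrable)
  have m: "(\<lambda>x. \<integral>\<^sup>+y. ennreal (norm (F (x, y))) \<partial>K x) \<in> borel_measurable (marginal P)"
  proof -
    have "(\<lambda>z. ennreal (norm (F z))) \<in> borel_measurable borel"
      using Fm measurable_cong_sets[OF sets_P refl] by (auto intro: measurable_compose)
    from measurable_compose[OF pair_kernel_measurable' nn_integral_measurable_subprob_algebra[OF this]]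
    show ?thesis
      unfolding pair_kernel_def by (subst (asm) nn_integral_distr) (use Pair_measurable \<open>_ \<in> borel_measurable borel\<close> in auto)
  qed
  have fin: "(\<integral>\<^sup>+x. \<integral>\<^sup>+y. ennreal (norm (F (x, y))) \<partial>K x \<partial>marginal P) < \<infinity>"
    using F Fm nn_integral_disintegration[of "\<lambda>z. ennreal (norm (F z))"] by (simp add: integrable_iff_bounded)
  then have "AE x in marginal P. (\<integral>\<^sup>+y. ennreal (norm (F (x, y))) \<partial>K x) \<noteq> \<infinity>"
    using nn_integral_PInf_AE[OF m] by (simp add: less_top)
  then show ae: "AE x in marginal P. integrable (K x) (\<lambda>y. F (x, y))"
    by eventually_elim (simp add: integrable_iff_bounded section_measurable[OF Fm] less_top)
  show "integrable (marginal P) (\<lambda>x. \<integral>y. F (x, y) \<partial>K x)"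
  proof (rule integrableI_bounded[OF section_integral_measurable[OF Fm]])
    have "(\<integral>\<^sup>+x. ennreal (norm (\<integral>y. F (x, y) \<partial>K x)) \<partial>marginal P) \<le> (\<integral>\<^sup>+x. \<integral>\<^sup>+y. ennreal (norm (F (x, y))) \<partial>K x \<partial>marginal P)"
      by (rule nn_integral_mono_AE, use ae in eventually_elim) (rule integral_norm_bound_ennreal)
    then show "(\<integral>\<^sup>+x. ennreal (norm (\<integral>y. F (x, y) \<partial>K x)) \<partial>marginal P) < \<infinity>" using fin by (rule le_less_trans)
  qed
qed

lemma integral_disintegration_nonneg:
  fixes F :: "_ \<Rightarrow> real"
  assumes F: "integrable P F" and F0: "\<And>z. 0 \<le> F z"
  shows "(\<integral>z. F z \<partial>P) = (\<integral>x. (\<integral>y. F (x, y) \<partial>K x) \<partial>marginal P)"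
proof -
  have Fm: "F \<in> borel_measurable P" using F by (rule borel_measurable_integrable)
  have "(\<integral>z. F z \<partial>P) = enn2real (\<integral>\<^sup>+z. ennreal (F z) \<partial>P)"
    by (rule integral_eq_nn_integral[OF Fm]) (simp add: F0)
  also have "(\<integral>\<^sup>+z. ennreal (F z) \<partial>P) = (\<integral>\<^sup>+x. \<integral>\<^sup>+y. ennreal (F (x, y)) \<partial>K x \<partial>marginal P)"
    using Fm by (intro nn_integral_disintegration) simp
  also have "\<dots> = (\<integral>\<^sup>+x. ennreal (\<integral>y. F (x, y) \<partial>K x) \<partial>marginal P)"
    by (rule nn_integral_cong_AE, use integrable_section(1)[OF F] in eventually_elim)
       (simp add: nn_integral_eq_integral F0)
  also have "enn2real \<dots> = (\<integral>x. (\<integral>y. F (x, y) \<partial>K x) \<partial>marginal P)"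
    by (rule integral_eq_nn_integral[symmetric, OF section_integral_measurable[OF Fm]]) (simp add: F0)
  finally show ?thesis .
qed

text \<open>Reduction to nonnegative functions by writing \<open>F\<close> as
  \<open>F + \<bar>F\<bar>\<close> minus \<open>\<bar>F\<bar>\<close>. The inner integral splits for
  almost every \<open>x\<close> only, namely where the section is integrable.\<close>

lemma integral_disintegration:
  fixes F :: "_ \<Rightarrow> real"
  assumes F: "integrable P F"
  shows "(\<integral>z. F z \<partial>P) = (\<integral>x. (\<integral>y. F (x, y) \<partial>K x) \<partial>marginal P)"
proof -
  have a: "integrable P (\<lambda>z. \<bar>F z\<bar>)" "integrable P (\<lambda>z. F z + \<bar>F z\<bar>)" using F by auto
  have "(\<integral>z. F z \<partial>P) = (\<integral>z. F z + \<bar>F z\<bar> \<partial>P) - (\<integral>z. \<bar>F z\<bar> \<partial>P)" using F by simp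
  also have "\<dots> = (\<integral>x. (\<integral>y. F (x, y) + \<bar>F (x, y)\<bar> \<partial>K x) \<partial>marginal P) - (\<integral>x. (\<integral>y. \<bar>F (x, y)\<bar> \<partial>K x) \<partial>marginal P)"
    using integral_disintegration_nonneg[OF a(1)] integral_disintegration_nonneg[OF a(2)] by simp
  also have "\<dots> = (\<integral>x. (\<integral>y. F (x, y) + \<bar>F (x, y)\<bar> \<partial>K x) - (\<integral>y. \<bar>F (x, y)\<bar> \<partial>K x) \<partial>marginal P)"
    by (rule Bochner_Integration.integral_diff[symmetric, OF integrable_section(2)[OF a(2)] integrable_section(2)[OF a(1)]])
  also have "\<dots> = (\<integral>x. (\<integral>y. F (x, y) \<partial>K x) \<partial>marginal P)"
  proof (rule integral_cong_AE)
    show "AE x in marginal P. (\<integral>y. F (x, y) + \<bar>F (x, y)\<bar> \<partial>K x) - (\<integral>y. \<bar>F (x, y)\<bar> \<partial>K x) = (\<integral>y. F (x, y) \<partial>K x)"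
      using integrable_section(1)[OF F] by eventually_elim simp
  qed (use integrable_section(2)[OF a(2)] integrable_section(2)[OF a(1)] integrable_section(2)[OF F] in
      \<open>auto dest!: borel_measurable_integrable\<close>)
  finally show ?thesis .
qed

text \<open>The slope of the conditional loss. It enters through the tangent inequality
  \<open>cond_loss_tangent\<close> and its continuity, without differentiation under the
  integral.\<close>

definition \<kappa> :: "real ^ 'n \<Rightarrow> real \<Rightarrow> real" where
  "\<kappa> x \<alpha> = (\<integral>y. d1 l \<alpha> y \<partial>K x)"

lemma d1_measurable_K: "(\<lambda>y. d1 l \<alpha> y) \<in> borel_measurable (K x)"
  by measurable

lemma integrable_d1_K: "integrable (K x) (\<lambda>y. d1 l \<alpha> y)"
proof -
  interpret prob_space "K x" by (rule K_prob)
  show ?thesis by (rule integrable_const_bound[where B = C]) (auto simp: abs_d1_le d1_measurable_K)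
qed

lemma abs_\<kappa>_le: "\<bar>\<kappa> x \<alpha>\<bar> \<le> C"
proof -
  interpret prob_space "K x" by (rule K_prob)
  have "norm (\<kappa> x \<alpha>) \<le> (\<integral>y. norm (d1 l \<alpha> y) \<partial>K x)" unfolding \<kappa>_def by (rule integral_norm_bound)
  also have "\<dots> \<le> (\<integral>y. C \<partial>K x)" by (intro integral_mono integrable_norm integrable_d1_K) (auto simp: abs_d1_le)
  finally show ?thesis by (simp add: prob_space)
qed

lemma continuous_\<kappa>: "continuous_on UNIV (\<kappa> x)"
proof -
  interpret prob_space "K x" by (rule K_prob)
  have "isCont (\<kappa> x) \<alpha>" for \<alpha>
  proof (subst continuous_at_sequentially, intro allI impI)
    fix u :: "nat \<Rightarrow> real" assume u: "u \<longlonglongrightarrow> \<alpha>"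
    show "(\<kappa> x \<circ> u) \<longlonglongrightarrow> \<kappa> x \<alpha>"
      unfolding \<kappa>_def o_def
    proof (rule integral_dominated_convergence[where w = "\<lambda>_. C"])
      show "AE y in K x. (\<lambda>n. d1 l (u n) y) \<longlonglongrightarrow> d1 l \<alpha> y"
      proof (rule AE_I2)
        fix y
        have "isCont (\<lambda>u. d1 l u y) \<alpha>"
          using loss by (auto simp: loss_assms_def continuous_on_eq_continuous_at)
        then show "(\<lambda>n. d1 l (u n) y) \<longlonglongrightarrow> d1 l \<alpha> y" using u by (rule isCont_tendsto_compose)
      qed
    qed (auto simp: abs_d1_le d1_measurable_K)
  qed
  then show ?thesis by (simp add: continuous_at_imp_continuous_on)
qed

context
  fixes x assumes x: "integrable (K x) (\<lambda>y. l 0 y)"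
begin

lemma integrable_l_K: "integrable (K x) (\<lambda>y. l \<alpha> y)"
proof -
  interpret prob_space "K x" by (rule K_prob)
  have "integrable (K x) (\<lambda>y. l 0 y + C * \<bar>\<alpha>\<bar>)" using x by simp
  then show ?thesis
  proof (rule Bochner_Integration.integrable_bound)
    show "AE y in K x. norm (l \<alpha> y) \<le> norm (l 0 y + C * \<bar>\<alpha>\<bar>)"
    proof (rule AE_I2)
      fix y
      have "\<bar>l \<alpha> y - l 0 y\<bar> \<le> C * \<bar>\<alpha>\<bar>" using l_lipschitz[of \<alpha> y 0] by simp
      moreover have "0 \<le> C * \<bar>\<alpha>\<bar>" using C_nonneg by simp
      ultimately show "norm (l \<alpha> y) \<le> norm (l 0 y + C * \<bar>\<alpha>\<bar>)"
        using l_nonneg[of \<alpha> y] l_nonneg[of 0 y] unfolding real_norm_def by linarith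
    qed
  qed measurable
qed

lemma cond_loss_tangent: "cond_loss l K x \<alpha> + \<kappa> x \<alpha> * (\<beta> - \<alpha>) \<le> cond_loss l K x \<beta>"
proof -
  have "cond_loss l K x \<alpha> + \<kappa> x \<alpha> * (\<beta> - \<alpha>) = (\<integral>y. l \<alpha> y + d1 l \<alpha> y * (\<beta> - \<alpha>) \<partial>K x)"
    unfolding cond_loss_def \<kappa>_def using integrable_l_K integrable_d1_K by simp
  also have "\<dots> \<le> (\<integral>y. l \<beta> y \<partial>K x)"
  proof (rule integral_mono)
    show "l \<alpha> y + d1 l \<alpha> y * (\<beta> - \<alpha>) \<le> l \<beta> y" for y using l_tangent[of \<alpha> y \<beta>] by simp
  qed (use integrable_l_K integrable_d1_K in auto)
  finally show ?thesis by (simp add: cond_loss_def)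
qed

lemma continuous_cond_loss: "continuous_on UNIV (cond_loss l K x)"
proof -
  have "\<bar>cond_loss l K x \<alpha> - cond_loss l K x \<beta>\<bar> \<le> C * \<bar>\<alpha> - \<beta>\<bar>" for \<alpha> \<beta>
  proof -
    have 1: "\<bar>\<kappa> x \<alpha> * (\<beta> - \<alpha>)\<bar> \<le> C * \<bar>\<alpha> - \<beta>\<bar>" "\<bar>\<kappa> x \<beta> * (\<alpha> - \<beta>)\<bar> \<le> C * \<bar>\<alpha> - \<beta>\<bar>"
      unfolding abs_mult abs_minus_commute[of \<beta> \<alpha>] by (intro mult_right_mono abs_\<kappa>_le; simp)+
    show ?thesis using cond_loss_tangent[of \<alpha> \<beta>] cond_loss_tangent[of \<beta> \<alpha>] 1 by linarith
  qed
  then have "C-lipschitz_on UNIV (cond_loss l K x)"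
    by (intro lipschitz_onI C_nonneg) (simp add: dist_real_def)
  then show ?thesis by (rule lipschitz_on_continuous_on)
qed

end

section \<open>Transfer between the data distribution and its marginal\<close>

lemma measurable_marginal_P: "f \<in> borel_measurable (marginal P) \<Longrightarrow> (\<lambda>z. f (fst z)) \<in> borel_measurable P"
  using measurable_compose[OF fst_measurable_P, of f borel] measurable_cong_sets[OF sets_marginal refl] by blast

lemma integral_marginal:
  fixes f :: "_ \<Rightarrow> real"
  assumes "f \<in> borel_measurable (marginal P)"
  shows "(\<integral>x. f x \<partial>marginal P) = (\<integral>z. f (fst z) \<partial>P)"
    and "integrable (marginal P) f \<longleftrightarrow> integrable P (\<lambda>z. f (fst z))"
proof -
  have f: "f \<in> borel_measurable borel" using assms measurable_cong_sets[OF sets_marginal refl] by blast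
  show "(\<integral>x. f x \<partial>marginal P) = (\<integral>z. f (fst z) \<partial>P)" unfolding marginal_def by (rule integral_distr[OF fst_measurable_P f])
  show "integrable (marginal P) f \<longleftrightarrow> integrable P (\<lambda>z. f (fst z))"
    unfolding marginal_def by (rule integrable_distr_eq[OF fst_measurable_P f])
qed

lemma loss_disintegration:
  assumes f: "integrable (marginal P) f"
  shows "(\<integral>z. l (f (fst z)) (snd z) \<partial>P) = (\<integral>x. cond_loss l K x (f x) \<partial>marginal P)"
    and "integrable (marginal P) (\<lambda>x. cond_loss l K x (f x))"
    and "integrable P (\<lambda>z. l (f (fst z)) (snd z))"
proof -
  have fm: "f \<in> borel_measurable (marginal P)" using f by (rule borel_measurable_integrable)
  show i: "integrable P (\<lambda>z. l (f (fst z)) (snd z))"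
    using integral_marginal(2)[OF fm] f by (intro integrable_loss measurable_marginal_P fm) simp
  show "(\<integral>z. l (f (fst z)) (snd z) \<partial>P) = (\<integral>x. cond_loss l K x (f x) \<partial>marginal P)"
    using integral_disintegration[OF i] by (simp add: cond_loss_def)
  show "integrable (marginal P) (\<lambda>x. cond_loss l K x (f x))"
    using integrable_section(2)[OF i] by (simp add: cond_loss_def)
qed

lemma net_marginal: "\<rho> \<in> P2 \<Longrightarrow> net \<rho> \<in> borel_measurable (marginal P)" "\<rho> \<in> P2 \<Longrightarrow> integrable (marginal P) (net \<rho>)"
proof -
  show m: "net \<rho> \<in> borel_measurable (marginal P)" if "\<rho> \<in> P2" for \<rho> :: "'n param measure"
    using borel_measurable_continuous_onI[OF continuous_net[OF that]] measurable_cong_sets[OF sets_marginal refl] by blast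
  show "\<rho> \<in> P2 \<Longrightarrow> integrable (marginal P) (net \<rho>)"
    using integral_marginal(2)[OF m] integrable_net by blast
qed

end

subsection \<open>Minimising sequences\<close>

text \<open>A probability measure has only positive weights of total mass 1, but homogeneity lets
  the parameters absorb arbitrary real coefficients: the size of a coefficient by scaling, its sign
  by reflecting \<open>a\<close>, under which \<open>Theta\<close> is symmetric.\<close>

lemma finite_net_realization:
  fixes S :: "('n::finite) param set"
  assumes S: "finite S" "S \<subseteq> Theta"
  obtains \<rho> where "\<rho> \<in> P2" "\<And>x. net \<rho> x = (\<Sum>\<theta>\<in>S. c \<theta> * phi \<theta> x)"
proof -
  \<comment> \<open>The point 0 is added so that the uniform distribution exists even for empty
    \<open>S\<close>; it contributes nothing to the network but is counted in
    \<open>N\<close>.\<close>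
  define N where "N = real (card (insert 0 S))"
  have N: "0 < N" using S by (simp add: N_def card_gt_0_iff)
  \<comment> \<open>Degree 2 turns the square root into the factor
    \<open>N * \<bar>c \<theta>\<bar>\<close>, whose \<open>N\<close> cancels the weight
    \<open>1 / N\<close>.\<close>
  define s where "s \<theta> = sqrt (N * \<bar>c \<theta>\<bar>)" for \<theta>
  define T where "T \<theta> = (if \<theta> \<in> S then (sgn (c \<theta>) * s \<theta> * fst \<theta>, s \<theta> *\<^sub>R snd \<theta>) else 0)" for \<theta> :: "'n param"
  have T: "T \<theta> \<in> closure Theta" for \<theta>
  proof (cases "\<theta> \<in> S \<and> c \<theta> \<noteq> 0")
    case True
    then have "s \<theta> > 0" using N by (simp add: s_def)
    then have "s \<theta> *\<^sub>R \<theta> \<in> Theta" using True S Theta_scaleR by blast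
    then have "T \<theta> \<in> Theta" using True
      by (cases \<theta>) (auto simp: T_def Theta_def power_mult_distrib sgn_if split: if_splits)
    then show ?thesis using closure_subset by blast
  next
    case False
    then have "T \<theta> = 0" by (auto simp: T_def s_def zero_prod_def)
    then show ?thesis using zero_in_closure_Theta by simp
  qed
  have phiT: "phi (T \<theta>) x = N * c \<theta> * phi \<theta> x" if "\<theta> \<in> S" for \<theta> x
  proof -
    have s0: "0 \<le> s \<theta>" using N by (simp add: s_def)
    have "relu (s \<theta> * (snd \<theta> \<bullet> aug x)) = s \<theta> * relu (snd \<theta> \<bullet> aug x)"
      using s0 by (auto simp: relu_def max_def mult_le_0_iff zero_le_mult_iff)
    then have "phi (T \<theta>) x = sgn (c \<theta>) * (s \<theta> * s \<theta>) * phi \<theta> x"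
      using that by (simp add: phi_aug T_def)
    also have "s \<theta> * s \<theta> = N * \<bar>c \<theta>\<bar>" using N by (simp add: s_def)
    also have "sgn (c \<theta>) * (N * \<bar>c \<theta>\<bar>) = N * c \<theta>" by (simp add: sgn_if)
    finally show ?thesis .
  qed
  let ?M = "measure_pmf (pmf_of_set (insert 0 S))"
  let ?R = "restrict_space borel (closure Theta) :: 'n param measure"
  define \<rho> where "\<rho> = distr ?M ?R T"
  have Tm: "T \<in> ?M \<rightarrow>\<^sub>M ?R"
    by (rule measurableI) (auto simp: space_restrict_space T)
  have R: "f \<in> borel_measurable ?R" if "f \<in> borel_measurable borel" for f :: "'n param \<Rightarrow> real"
    using that by (rule measurable_restrict_space1)
  have fin: "finite (set_pmf (pmf_of_set (insert 0 S)))" using S by simp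
  have int: "(\<integral>\<theta>. f \<theta> \<partial>\<rho>) = (\<Sum>\<theta>\<in>insert 0 S. f (T \<theta>)) / N" if "f \<in> borel_measurable borel" for f :: "'n param \<Rightarrow> real"
    unfolding \<rho>_def integral_distr[OF Tm R[OF that]] N_def using S by (intro integral_pmf_of_set) auto
  have "prob_space \<rho>" unfolding \<rho>_def by (intro prob_space.prob_space_distr Tm prob_space_measure_pmf)
  moreover have "integrable \<rho> (\<lambda>\<theta>. (norm \<theta>)\<^sup>2)"
    unfolding \<rho>_def by (subst integrable_distr_eq[OF Tm R]) (auto intro: integrable_measure_pmf_finite[OF fin])
  ultimately have "\<rho> \<in> P2" by (simp add: P2_def \<rho>_def)
  moreover have "net \<rho> x = (\<Sum>\<theta>\<in>S. c \<theta> * phi \<theta> x)" for x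
  proof -
    have "net \<rho> x = (\<Sum>\<theta>\<in>insert 0 S. phi (T \<theta>) x) / N"
      unfolding net_def by (intro int borel_measurable_continuous_onI continuous_phi)
    also have "(\<Sum>\<theta>\<in>insert 0 S. phi (T \<theta>) x) = (\<Sum>\<theta>\<in>S. phi (T \<theta>) x)"
    proof (rule sum.mono_neutral_right)
      show "\<forall>\<theta>\<in>insert 0 S - S. phi (T \<theta>) x = 0"
        by (auto simp: T_def phi_aug)
    qed (use S in auto)
    also have "\<dots> / N = (\<Sum>\<theta>\<in>S. c \<theta> * phi \<theta> x)"
      using N by (simp add: phiT sum_divide_distrib)
    finally show ?thesis .
  qed
  ultimately show thesis by (rule that)
qed

context conditional_setting
begin

text \<open>Density in \<open>L^1\<close> passes to the risk because the loss is
  \<open>C\<close>-Lipschitz. Hence the infimum over \<open>P2\<close> is no larger than the risk of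
  any integrable predictor.\<close>

lemma risk_approximation:
  assumes f: "integrable (marginal P) f" and e: "0 < e"
  obtains \<rho> where "\<rho> \<in> P2" "risk l P \<rho> \<le> (\<integral>z. l (f (fst z)) (snd z) \<partial>P) + e"
proof -
  \<comment> \<open>\<open>C + 1\<close> rather than \<open>C\<close>, since \<open>C\<close> may be
    0.\<close>
  have p: "0 < e / (C + 1)" using e C_nonneg by simp
  have "\<forall>f. integrable (marginal P) f \<longrightarrow> (\<forall>\<epsilon>>0. \<exists>S c. finite S \<and> S \<subseteq> Theta \<and>
        (\<integral>x. \<bar>f x - (\<Sum>\<theta>\<in>S. c \<theta> * phi \<theta> x)\<bar> \<partial>marginal P) < \<epsilon>)"
    using data unfolding data_assms_def by blast
  from this[rule_format, OF f p] obtain S c where S: "finite S" "S \<subseteq> Theta"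
    and le: "(\<integral>x. \<bar>f x - (\<Sum>\<theta>\<in>S. c \<theta> * phi \<theta> x)\<bar> \<partial>marginal P) < e / (C + 1)"
    by blast
  obtain \<rho> where \<rho>: "\<rho> \<in> P2" "\<And>x. net \<rho> x = (\<Sum>\<theta>\<in>S. c \<theta> * phi \<theta> x)"
    using finite_net_realization[OF S, of c] by blast
  have fm: "f \<in> borel_measurable (marginal P)" using f by (rule borel_measurable_integrable)
  note li = loss_disintegration(3)[OF f] integrable_loss_net[OF \<rho>(1)]
  have di: "integrable (marginal P) (\<lambda>x. \<bar>f x - net \<rho> x\<bar>)" using f net_marginal(2)[OF \<rho>(1)] by simp
  have di': "integrable P (\<lambda>z. \<bar>f (fst z) - net \<rho> (fst z)\<bar>)"
    using integral_marginal(2)[OF borel_measurable_integrable[OF di]] di by simp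
  have "risk l P \<rho> - (\<integral>z. l (f (fst z)) (snd z) \<partial>P) = (\<integral>z. l (net \<rho> (fst z)) (snd z) - l (f (fst z)) (snd z) \<partial>P)"
    unfolding risk_eq using li by simp
  also have "\<dots> \<le> (\<integral>z. C * \<bar>f (fst z) - net \<rho> (fst z)\<bar> \<partial>P)"
  proof (intro integral_mono)
    show "l (net \<rho> (fst z)) (snd z) - l (f (fst z)) (snd z) \<le> C * \<bar>f (fst z) - net \<rho> (fst z)\<bar>" for z
      using l_lipschitz[of "net \<rho> (fst z)" "snd z" "f (fst z)"] by (simp add: abs_minus_commute)
  qed (use li di' in auto)
  also have "\<dots> = C * (\<integral>x. \<bar>f x - net \<rho> x\<bar> \<partial>marginal P)"
    using integral_marginal(1)[OF borel_measurable_integrable[OF di]] by simp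
  also have "\<dots> \<le> C * (e / (C + 1))"
    using le C_nonneg unfolding \<rho>(2) by (intro mult_left_mono) simp_all
  also have "\<dots> \<le> e" using C_nonneg e by (simp add: field_simps)
  finally show thesis using \<rho>(1) by (intro that[of \<rho>]) auto
qed

text \<open>A subsequence is enough for its purpose: it is applied to variations that already
  converge pointwise, so their limit can be read off along it.\<close>

lemma minimizing_sequence_risk_var:
  assumes \<rho>: "\<And>n. \<rho> n \<in> P2"
    and lim: "(\<lambda>n. risk l P (\<rho> n)) \<longlonglongrightarrow> (INF \<rho>\<in>P2. risk l P \<rho>)"
  obtains r :: "nat \<Rightarrow> nat" where "strict_mono r" "\<And>\<theta>. (\<lambda>n. risk_var l P (\<rho> (r n)) \<theta>) \<longlonglongrightarrow> 0"
proof -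
  let ?I = "INF \<rho>\<in>P2. risk l P \<rho>"
  obtain fs where fs: "integrable (marginal P) fs"
    and min: "AE x in marginal P. is_arg_min (cond_loss l K x) (\<lambda>_. True) (fs x)"
    and coercive: "AE x in marginal P. filterlim (cond_loss l K x) at_top at_infinity"
    using compat by (auto simp: compatibility_def)
  define J where "J = (\<integral>z. l (fs (fst z)) (snd z) \<partial>P)"
  \<comment> \<open>The pointwise minimiser \<open>fs\<close> need not be a network, but networks
    approximate its risk. So the infimum is at most \<open>J\<close>, and minimising the risk forces
    minimisation of almost every conditional loss.\<close>
  have IJ: "?I \<le> J"
  proof (rule field_le_epsilon)
    fix e :: real assume "0 < e"
    then obtain \<mu> where \<mu>: "\<mu> \<in> P2" "risk l P \<mu> \<le> J + e" using risk_approximation[OF fs] unfolding J_def by blast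
    have "?I \<le> risk l P \<mu>"
      by (rule INF_risk_le[OF \<mu>(1)])
    then show "?I \<le> J + e" using \<mu> by linarith
  qed
  \<comment> \<open>The excess conditional loss is nonnegative almost everywhere, so its norm in
    \<open>L^1\<close> is just the excess risk. Convergence in \<open>L^1\<close> then gives a
    subsequence converging almost everywhere.\<close>
  define D where "D n x = cond_loss l K x (net (\<rho> n) x) - cond_loss l K x (fs x)" for n x
  note ln = loss_disintegration[OF net_marginal(2)[OF \<rho>]] and lf = loss_disintegration[OF fs]
  have Di: "integrable (marginal P) (D n)" for n
    unfolding D_def using ln(2)[of n] lf(2) by simp
  have D0: "AE x in marginal P. 0 \<le> D n x" for n
    using min by eventually_elim (auto simp: D_def is_arg_min_def not_less)
  have Dn: "(\<integral>x. norm (D n x) \<partial>marginal P) = risk l P (\<rho> n) - J" for n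
  proof -
    have "(\<integral>x. norm (D n x) \<partial>marginal P) = (\<integral>x. D n x \<partial>marginal P)"
      by (rule integral_cong_AE) (use Di[of n] D0[of n] in \<open>auto dest: borel_measurable_integrable\<close>)
    also have "\<dots> = risk l P (\<rho> n) - J"
      unfolding D_def J_def risk_eq using ln[of n] lf by simp
    finally show ?thesis .
  qed
  have "(\<lambda>n. \<integral>x. norm (D n x) \<partial>marginal P) \<longlonglongrightarrow> 0"
  proof -
    have l: "(\<lambda>n. \<integral>x. norm (D n x) \<partial>marginal P) \<longlonglongrightarrow> ?I - J"
      unfolding Dn by (intro tendsto_intros lim)
    have "0 \<le> ?I - J" by (rule LIMSEQ_le_const[OF l]) (auto intro!: exI[of _ 0] Bochner_Integration.integral_nonneg)
    with IJ have "?I - J = 0" by linarith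
    with l show ?thesis by (simp only:)
  qed
  from tendsto_L1_AE_subseq[OF Di this] obtain r :: "nat \<Rightarrow> nat" where r: "strict_mono r"
    and ae: "AE x in marginal P. (\<lambda>n. D (r n) x) \<longlonglongrightarrow> 0" by blast
  have l0: "AE x in marginal P. integrable (K x) (\<lambda>y. l 0 y)"
    using integrable_section(1)[OF integrable_l0] by simp
  have \<kappa>0: "AE x in marginal P. (\<lambda>n. \<kappa> x (net (\<rho> (r n)) x)) \<longlonglongrightarrow> 0"
    using min coercive ae l0
  proof eventually_elim
    case (elim x)
    show ?case
    proof (rule convex_minimizing_sequence_derivative[where F = "cond_loss l K x" and \<kappa> = "\<kappa> x" and a = "fs x" and u = "\<lambda>n. net (\<rho> (r n)) x"])
      show "cond_loss l K x (fs x) \<le> cond_loss l K x y" for y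
        using elim(1) by (auto simp: is_arg_min_def not_less)
      show "(\<lambda>n. cond_loss l K x (net (\<rho> (r n)) x)) \<longlonglongrightarrow> cond_loss l K x (fs x)"
        using elim(3) unfolding D_def by (rule LIM_zero_cancel)
    qed (rule cond_loss_tangent[OF elim(4)] continuous_\<kappa> continuous_cond_loss[OF elim(4)] elim(2))+
  qed
  have "(\<lambda>n. risk_var l P (\<rho> (r n)) \<theta>) \<longlonglongrightarrow> 0" for \<theta>
  proof -
    \<comment> \<open>The response enters through the derivative of the loss only; integrating it
      out first leaves the slope of the conditional loss at the prediction.\<close>
    have eq: "risk_var l P (\<rho> n) \<theta> = (\<integral>x. \<kappa> x (net (\<rho> n) x) * phi \<theta> x \<partial>marginal P)" for n
    proof -
      have "risk_var l P (\<rho> n) \<theta> = (\<integral>z. dloss (\<rho> n) z * phi \<theta> (fst z) \<partial>P)"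
        by (simp add: risk_var_lin lin_def)
      also have "\<dots> = (\<integral>x. (\<integral>y. dloss (\<rho> n) (x, y) * phi \<theta> x \<partial>K x) \<partial>marginal P)"
        using integral_disintegration[OF integrable_lin[OF admissible_dloss[OF \<rho>]], of n \<theta>] by simp
      finally show ?thesis by (simp add: dloss_def \<kappa>_def)
    qed
    have m: "(\<lambda>x. \<kappa> x (net (\<rho> n) x) * phi \<theta> x) \<in> borel_measurable (marginal P)" for n
      using section_integral_measurable[OF borel_measurable_integrable[OF integrable_lin[OF admissible_dloss[OF \<rho>]]], of n \<theta>]
      by (simp add: dloss_def \<kappa>_def)
    have "(\<lambda>n. \<integral>x. \<kappa> x (net (\<rho> (r n)) x) * phi \<theta> x \<partial>marginal P) \<longlonglongrightarrow> (\<integral>x. 0 \<partial>marginal P)"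
    proof (rule integral_dominated_convergence[where w = "\<lambda>x. C * (norm \<theta>)\<^sup>2 * norm (aug x)"])
      show "AE x in marginal P. (\<lambda>n. \<kappa> x (net (\<rho> (r n)) x) * phi \<theta> x) \<longlonglongrightarrow> 0"
        using \<kappa>0 by eventually_elim (rule tendsto_mult_left_zero)
      have "(\<lambda>x. norm (aug x)) \<in> borel_measurable (marginal P)"
        unfolding measurable_cong_sets[OF sets_marginal refl] aug_def
        by (intro borel_measurable_continuous_onI continuous_intros)
      then show "integrable (marginal P) (\<lambda>x. C * (norm \<theta>)\<^sup>2 * norm (aug x))"
        using integral_marginal(2)[of "\<lambda>x. norm (aug x)"] integrable_aug by simp
      show "AE x in marginal P. norm (\<kappa> x (net (\<rho> (r n)) x) * phi \<theta> x) \<le> C * (norm \<theta>)\<^sup>2 * norm (aug x)" for n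
        unfolding real_norm_def abs_mult mult.assoc
        by (intro AE_I2 mult_mono abs_\<kappa>_le abs_phi_le C_nonneg) auto
    qed (use m in auto)
    then show ?thesis unfolding eq by simp
  qed
  with r show thesis by (rule that)
qed

end

theorem theorem3p6:
  fixes l :: "real \<Rightarrow> real \<Rightarrow> real"
    and P :: "((real ^ 'n::finite) \<times> real) measure"
    and K :: "real ^ 'n \<Rightarrow> real measure"
    and \<pi>0 :: "'n param measure"
    and \<pi> :: "real \<Rightarrow> 'n param measure"
  assumes "loss_assms l"
    and "data_assms P"
    and "conditional_distribution P K"
    and "compatibility l P K"
    and "\<pi>0 \<in> P2"
    and "wasserstein_gradient_flow l P \<pi>0 \<pi>"
  shows "Omega_lim l P \<pi> \<noteq> {} \<and>
    (((\<lambda>t. risk l P (\<pi> t)) \<longlongrightarrow> (INF \<rho>\<in>P2. risk l P \<rho>)) at_top \<longleftrightarrow>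
      (\<forall>(g, V) \<in> Omega_lim l P \<pi>. \<forall>\<theta> \<in> closure Theta. g \<theta> = 0))"
proof -
  obtain C where C: "\<And>y z. \<bar>d1 l y z\<bar> \<le> C"
    using assms(1) by (auto simp: loss_assms_def)
  obtain L where L: "\<forall>(w, b) \<in> sphere 0 1. \<forall>(w', b') \<in> sphere 0 1.
        (\<integral>x. \<bar>indicator {x. w \<bullet> x + b > 0} x - indicator {x. w' \<bullet> x + b' > 0} x\<bar>
           \<partial>density (marginal P) (\<lambda>x. ennreal (sqrt (1 + (norm x)\<^sup>2))))
        \<le> L * dist (w, b) (w', b')"
    using assms(2) unfolding data_assms_def by blast
  have flow: "\<And>t. 0 \<le> t \<Longrightarrow> \<pi> t \<in> P2" "locally_AC_W2 \<pi>"
    "AE t in lborel. t > 0 \<longrightarrow> (\<forall>\<psi>\<in>test_functions.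
        ((\<lambda>s. \<integral>\<theta>. \<psi> \<theta> \<partial>\<pi> s) has_real_derivative
           - (\<integral>\<theta>. gradient \<psi> \<theta> \<bullet> grad_risk_var l P (\<pi> t) \<theta> \<partial>\<pi> t)) (at t))"
    using assms(6) by (auto simp: wasserstein_gradient_flow_def)
  obtain m where m: "\<And>T. 0 \<le> T \<Longrightarrow> set_integrable lborel {0..T} m"
    "\<And>s t. 0 \<le> s \<Longrightarrow> s \<le> t \<Longrightarrow> W2 (\<pi> s) (\<pi> t) \<le> (LINT r:{s..t}|lborel. m r)"
    using flow(2) unfolding locally_AC_W2_def by blast
  \<comment> \<open>The Lipschitz constant is given without a sign, hence the maximum with
    0.\<close>
  interpret risk_setting l P C "max L 0"
  proof
    show "integrable P (\<lambda>(x, y). l 0 y)" using assms(4) by (simp add: compatibility_def)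
    fix u u' :: "(real ^ 'n) \<times> real" assume u: "u \<in> sphere 0 1" "u' \<in> sphere 0 1"
    have "(\<integral>x. \<bar>indicator {x. fst u \<bullet> x + snd u > 0} x - indicator {x. fst u' \<bullet> x + snd u' > 0} x\<bar>
           \<partial>density (marginal P) (\<lambda>x. ennreal (sqrt (1 + (norm x)\<^sup>2)))) \<le> L * dist u u'"
      using bspec[OF L u(1)] u(2) by (cases u, cases u') force
    also have "\<dots> \<le> max L 0 * dist u u'" by (intro mult_right_mono) auto
    finally show "(\<integral>x. \<bar>indicator {x. fst u \<bullet> x + snd u > 0} x - indicator {x. fst u' \<bullet> x + snd u' > 0} x\<bar>
           \<partial>density (marginal P) (\<lambda>x. ennreal (sqrt (1 + (norm x)\<^sup>2)))) \<le> max L 0 * dist u u'" .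
  qed (use assms(1,2) C in auto)
  \<comment> \<open>Likewise the metric derivative bound \<open>m\<close> may be negative somewhere;
    its modulus bounds the distances just as well.\<close>
  interpret flow_setting l P C "max L 0" \<pi> "\<lambda>r. \<bar>m r\<bar>"
  proof
    show "set_integrable lborel {0..T} (\<lambda>r. \<bar>m r\<bar>)" if "0 \<le> T" for T
      by (rule set_integrable_abs[OF m(1)[OF that]])
    show "W2 (\<pi> s) (\<pi> t) \<le> (LINT r:{s..t}|lborel. \<bar>m r\<bar>)" if "0 \<le> s" "s \<le> t" for s t
    proof -
      have i: "set_integrable lborel {s..t} m"
        by (rule set_integrable_subset[OF m(1)[of t]]) (use that in auto)
      show ?thesis
        using m(2)[OF that] set_integral_mono[OF i set_integrable_abs[OF i]] by force
    qed
  qed (use flow in auto)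
  interpret conditional_setting l P C "max L 0" K
    by unfold_locales (use assms in auto)
  have "\<forall>(g, V) \<in> Omega_lim l P \<pi>. \<forall>\<theta> \<in> closure Theta. g \<theta> = 0"
    if lim: "((\<lambda>t. risk l P (\<pi> t)) \<longlongrightarrow> (INF \<rho>\<in>P2. risk l P \<rho>)) at_top"
  proof (clarify)
    fix g V and \<theta>w :: real and w :: "real ^ 'n" and b :: real
    assume gV: "(g, V) \<in> Omega_lim l P \<pi>" and \<theta>: "(\<theta>w, w, b) \<in> closure Theta"
    let ?\<theta> = "(\<theta>w, w, b)"
    from gV obtain t where t: "\<And>n. 0 \<le> t n" "filterlim t at_top sequentially"
      and g: "locally_uniform_limit (closure Theta) (\<lambda>n. risk_var l P (\<pi> (t n))) g"
      by (auto simp: Omega_lim_def)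
    obtain \<epsilon> where \<epsilon>: "\<epsilon> > 0" "uniform_limit (closure Theta \<inter> ball ?\<theta> \<epsilon>) (\<lambda>n. risk_var l P (\<pi> (t n))) g sequentially"
      using g \<theta> unfolding locally_uniform_limit_def by blast
    have 1: "(\<lambda>n. risk_var l P (\<pi> (t n)) ?\<theta>) \<longlonglongrightarrow> g ?\<theta>"
      by (rule tendsto_uniform_limitI[OF \<epsilon>(2)]) (use \<theta> \<epsilon>(1) in simp)
    have 2: "(\<lambda>n. risk l P (\<pi> (t n))) \<longlonglongrightarrow> (INF \<rho>\<in>P2. risk l P \<rho>)"
      by (rule filterlim_compose[OF lim t(2)])
    \<comment> \<open>The variations tend to 0 along a subsequence and to \<open>g\<close> along the
      whole sequence, so \<open>g\<close> vanishes at this point.\<close>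
    obtain r :: "nat \<Rightarrow> nat" where r: "strict_mono r" "\<And>\<theta>. (\<lambda>n. risk_var l P (\<pi> (t (r n))) \<theta>) \<longlonglongrightarrow> 0"
      using minimizing_sequence_risk_var[OF flow_P2[OF t(1)] 2] by blast
    have "(\<lambda>n. risk_var l P (\<pi> (t (r n))) ?\<theta>) \<longlonglongrightarrow> g ?\<theta>"
      using LIMSEQ_subseq_LIMSEQ[OF 1 r(1)] by (simp add: o_def)
    then show "g ?\<theta> = 0" using r(2) by (rule LIMSEQ_unique)
  qed
  then show ?thesis using Omega_lim_nonempty risk_tendsto_INF by blast
qed

end
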